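(* Let $\mathcal{K}$ be a class of instances that is expressible in ECML (Existential Counting Modal Logic). Then there exist a constant $c$ and an algorithm that, given an instance $I=(G,\overline{FX},\overline{FY},\overline{k})$ together with a tree decomposition of $G$ of width $t$, decides whether $I\in\mathcal{K}$ in time $c^t|G|^{O(1)}$. Moreover, the algorithm can also compute (within the same time bound) the number of pairs of vectors $(\overline{X},\overline{Y})$ satisfying $\phi\wedge\forall_v\, G,\overline{FX},\overline{FY},\overline{X},\overline{Y},v\models\psi$, where $\varphi=\exists_{\overline{X}}\exists_{\overline{Y}}[\phi\wedge\forall_v\, G,\overline{FX},\overline{FY},\overline{X},\overline{Y},v\models\psi]$ is the formula defining $\mathcal{K}$.
   Context: Graphs may be undirected or directed; $|G|=|V(G)|+|E(G)|$. A tree decomposition of $G$ is a tree $\mathbb{T}$ with a bag $B_x\subseteq V(G)$ for each node $x$, such that every vertex lies in some bag, every edge has both endpoints in some bag, and for each vertex the nodes whose bags contain it form a connected subtree; its width is the maximum bag size minus one. Finitely recognizable sets: $S\subseteq\mathbb{N}$ is finitely recognizable iff $S=\alpha^{-1}(F)$ for some homomorphism $\alpha:(\mathbb{N},+)\to M$ into a finite monoid $M$ and some $F\subseteq M$. Counting Modal Logic (CML): formulas are evaluated at a vertex $v$ of a (directed) graph $G$ supplied with a vector $\overline{X}=(X_1,\dots,X_p)$ of vertex subsets and a vector $\overline{Y}=(Y_1,\dots,Y_q)$ of edge subsets. Syntax: $\psi ::= \neg\psi \mid \psi\wedge\psi\mid\psi\vee\psi\mid\psi\Rightarrow\psi\mid\psi\Leftrightarrow\psi\mid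 X_i\mid Y_j\mid \diamondsuit^S\psi\mid\square^S\psi$, where $S$ ranges over finitely recognizable sets; for directed graphs there are additionally the edge operators $\downarrow$ and $\uparrow$. Semantics: boolean connectives as usual; $X_i$ is true at $v$ iff $v\in X_i$; $\diamondsuit^S\psi$ is true at $v$ iff the number of neighbours $w$ of $v$ at which $\psi$ is true (with $w$ accessed directly from $v$ via the edge $vw$) belongs to $S$; $\square^S\psi$ is equivalent to $\neg\diamondsuit^S\neg\psi$. In a directed graph a neighbour is a vertex adjacent via an arc in either direction. Edge operators may only be used inside the scope of some modal quantifier: $Y_j$ is true at the current vertex iff the edge via which it was directly accessed (from its neighbour by the innermost enclosing quantifier) belongs to $Y_j$; $\downarrow$ is true iff that arc is directed towards the current vertex, and $\uparrow$ iff it is directed towards the neighbour from which it was accessed. ECML: an instance is a quadruple $(G,\overline{FX},\overline{FY},\overline{k})$ of a (directed) graph $G=(V,E)$, a vector of fixed vertex subsets, a vector of fixed edge subsets and a vector of integer parameters; a class of instances has fixed lengths of these vectors. A class $\mathcal{K}$ is expressible in ECML iff there is a fixed formula $\varphi=\exists_{\overline{X}}\exists_{\overline{Y}}[\phi\wedge\forall_{v\in V}\ G,\overline{FX},\overline{FY},\overline{X},\overline{Y},v\models\psi]$ such that an instance belongs to $\mathcal{K}$ iff it satisfies $\varphi$; here $\overline{X}$ ranges over vectors of subsets of $V$, $\overline{Y}$ over vectors of subsets of $E$, $\phi$ is an arbitrary quantifier-free arithmetic formula over the parameters $\overline{k}$, $|V|$, $|E|$ and the cardinalities of the fixed and quantified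 sets, and $\psi$ is a CML formula evaluated in $G$ supplied with all fixed and quantified sets.
   Formalization: The time bound is c^t times a polynomial in |G| plus the number of nodes of the given tree decomposition plus the bit lengths of the integer parameters, since reading these parts of the input is not bounded in terms of |G|. *)

theory Defs
  imports "HOL-Algebra.Group"
begin

section \<open>Graphs\<close>

datatype edge = Undirected "nat set" | Directed nat nat

fun ends :: "edge \<Rightarrow> nat set" where
  "ends (Undirected e) = e"
| "ends (Directed u v) = {u, v}"

fun points_to :: "edge \<Rightarrow> nat \<Rightarrow> bool" where
  "points_to (Undirected e) w \<longleftrightarrow> False"
| "points_to (Directed u v) w \<longleftrightarrow> v = w"

record graph =
  verts :: "nat set"
  edges :: "edge set"

definition undirected_graph :: "graph \<Rightarrow> bool" where
  "undirected_graph G \<longleftrightarrow> finite (verts G) \<and>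
     edges G \<subseteq> {Undirected e | e. e \<subseteq> verts G \<and> card e = 2}"

text \<open>Loops and parallel arcs are excluded; a pair of opposite arcs is allowed.\<close>

definition directed_graph :: "graph \<Rightarrow> bool" where
  "directed_graph G \<longleftrightarrow> finite (verts G) \<and>
     edges G \<subseteq> {Directed u v | u v. u \<in> verts G \<and> v \<in> verts G \<and> u \<noteq> v}"

definition graph_size :: "graph \<Rightarrow> nat" where
  "graph_size G = card (verts G) + card (edges G)"

text \<open>Algorithms receive graphs whose vertices are numbered \<open>0, \<dots>, n - 1\<close>.\<close>

definition numbered :: "graph \<Rightarrow> bool" where
  "numbered G \<longleftrightarrow> verts G = {..<card (verts G)}"

definition adjacent :: "graph \<Rightarrow> nat \<Rightarrow> nat \<Rightarrow> bool" where
  "adjacent G u v \<longleftrightarrow> (\<exists>e\<in>edges G. ends e = {u, v})"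


section \<open>Tree decompositions\<close>

text \<open>The subgraph induced by \<open>A\<close> is connected; vacuously true for the empty set.\<close>

definition connected_in :: "graph \<Rightarrow> nat set \<Rightarrow> bool" where
  "connected_in G A \<longleftrightarrow>
     (\<forall>u\<in>A. \<forall>v\<in>A. (u, v) \<in> {(x, y). x \<in> A \<and> y \<in> A \<and> adjacent G x y}\<^sup>*)"

definition is_cycle :: "graph \<Rightarrow> nat list \<Rightarrow> bool" where
  "is_cycle G xs \<longleftrightarrow> 3 \<le> length xs \<and> distinct xs \<and>
     (\<forall>i<length xs. adjacent G (xs ! i) (xs ! (Suc i mod length xs)))"

definition is_tree :: "graph \<Rightarrow> bool" where
  "is_tree T \<longleftrightarrow> undirected_graph T \<and> verts T \<noteq> {} \<and>
     connected_in T (verts T) \<and> (\<nexists>xs. is_cycle T xs)"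

record tree_decomp =
  tree :: graph
  bag :: "nat \<Rightarrow> nat set"

definition tree_decomposition :: "graph \<Rightarrow> tree_decomp \<Rightarrow> bool" where
  "tree_decomposition G D \<longleftrightarrow> is_tree (tree D) \<and>
     (\<forall>x\<in>verts (tree D). bag D x \<subseteq> verts G) \<and>
     (\<forall>v\<in>verts G. \<exists>x\<in>verts (tree D). v \<in> bag D x) \<and>
     (\<forall>e\<in>edges G. \<exists>x\<in>verts (tree D). ends e \<subseteq> bag D x) \<and>
     (\<forall>v\<in>verts G. connected_in (tree D) {x \<in> verts (tree D). v \<in> bag D x})"

text \<open>Natural-number subtraction: the empty graph gets width 0 instead of -1.\<close>

definition width :: "tree_decomp \<Rightarrow> nat" where
  "width D = Max ((\<lambda>x. card (bag D x)) ` verts (tree D)) - 1"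


section \<open>Counting Modal Logic\<close>

text \<open>
  Every finite monoid is isomorphic to one whose carrier consists of natural numbers,
  so quantifying over monoids on \<^typ>\<open>nat\<close> loses nothing. The constant \<^const>\<open>hom\<close> only requires
  compatibility with multiplication, hence the separate condition on units.
\<close>

definition finitely_recognizable :: "nat set \<Rightarrow> bool" where
  "finitely_recognizable S \<longleftrightarrow>
     (\<exists>(M :: nat monoid) \<alpha> F. monoid M \<and> finite (carrier M) \<and>
        \<alpha> \<in> hom \<lparr>carrier = UNIV, mult = (+), one = 0\<rparr> M \<and> \<alpha> 0 = \<one>\<^bsub>M\<^esub> \<and>
        F \<subseteq> carrier M \<and> S = \<alpha> -` F)"

datatype cml =
    XVar nat | YVar nat | Down | Up
  | CNot cml | CAnd cml cml | COr cml cml | CImp cml cml | CIff cml cml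
  | Dia "nat set" cml | Box "nat set" cml

text \<open>
  \<open>wf_cml dir p q inner \<psi>\<close>: the formula uses only the first \<open>p\<close> vertex sets and the first \<open>q\<close>
  edge sets, the arrows occur only if \<open>dir\<close> holds (directed graphs), and edge operators occur only
  in the scope of a modal quantifier; \<open>inner\<close> tells whether \<open>\<psi>\<close> itself is in such a scope.
\<close>

primrec wf_cml :: "bool \<Rightarrow> nat \<Rightarrow> nat \<Rightarrow> bool \<Rightarrow> cml \<Rightarrow> bool" where
  "wf_cml dir p q inner (XVar i) \<longleftrightarrow> i < p"
| "wf_cml dir p q inner (YVar j) \<longleftrightarrow> inner \<and> j < q"
| "wf_cml dir p q inner Down \<longleftrightarrow> inner \<and> dir"
| "wf_cml dir p q inner Up \<longleftrightarrow> inner \<and> dir"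
| "wf_cml dir p q inner (CNot \<psi>) \<longleftrightarrow> wf_cml dir p q inner \<psi>"
| "wf_cml dir p q inner (CAnd \<psi> \<chi>) \<longleftrightarrow> wf_cml dir p q inner \<psi> \<and> wf_cml dir p q inner \<chi>"
| "wf_cml dir p q inner (COr \<psi> \<chi>) \<longleftrightarrow> wf_cml dir p q inner \<psi> \<and> wf_cml dir p q inner \<chi>"
| "wf_cml dir p q inner (CImp \<psi> \<chi>) \<longleftrightarrow> wf_cml dir p q inner \<psi> \<and> wf_cml dir p q inner \<chi>"
| "wf_cml dir p q inner (CIff \<psi> \<chi>) \<longleftrightarrow> wf_cml dir p q inner \<psi> \<and> wf_cml dir p q inner \<chi>"
| "wf_cml dir p q inner (Dia S \<psi>) \<longleftrightarrow> finitely_recognizable S \<and> wf_cml dir p q True \<psi>"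
| "wf_cml dir p q inner (Box S \<psi>) \<longleftrightarrow> finitely_recognizable S \<and> wf_cml dir p q True \<psi>"

text \<open>
  \<open>sat \<psi> G Xs Ys acc v\<close>: truth of \<open>\<psi>\<close> at the vertex \<open>v\<close>. The argument \<open>acc\<close> is \<open>Some (u, e)\<close> if the
  innermost enclosing modal quantifier was evaluated at \<open>u\<close> and accessed \<open>v\<close> via the edge \<open>e\<close>, and
  \<open>None\<close> outside all modal quantifiers (where well-formed formulas do not inspect it).
  Modal quantifiers count neighbours, not arcs: if \<open>v\<close> and \<open>w\<close> are joined by two opposite arcs,
  then \<open>w\<close> is counted once if the formula holds at \<open>w\<close> accessed via at least one of them.
\<close>

primrec sat ::
  "cml \<Rightarrow> graph \<Rightarrow> nat set list \<Rightarrow> edge set list \<Rightarrow> (nat \<times> edge) option \<Rightarrow> nat \<Rightarrow> bool" where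
  "sat (XVar i) G Xs Ys acc v \<longleftrightarrow> v \<in> Xs ! i"
| "sat (YVar j) G Xs Ys acc v \<longleftrightarrow> (case acc of None \<Rightarrow> False | Some (u, e) \<Rightarrow> e \<in> Ys ! j)"
| "sat Down G Xs Ys acc v \<longleftrightarrow> (case acc of None \<Rightarrow> False | Some (u, e) \<Rightarrow> points_to e v)"
| "sat Up G Xs Ys acc v \<longleftrightarrow> (case acc of None \<Rightarrow> False | Some (u, e) \<Rightarrow> points_to e u)"
| "sat (CNot \<psi>) G Xs Ys acc v \<longleftrightarrow> \<not> sat \<psi> G Xs Ys acc v"
| "sat (CAnd \<psi> \<chi>) G Xs Ys acc v \<longleftrightarrow> sat \<psi> G Xs Ys acc v \<and> sat \<chi> G Xs Ys acc v"
| "sat (COr \<psi> \<chi>) G Xs Ys acc v \<longleftrightarrow> sat \<psi> G Xs Ys acc v \<or> sat \<chi> G Xs Ys acc v"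
| "sat (CImp \<psi> \<chi>) G Xs Ys acc v \<longleftrightarrow> (sat \<psi> G Xs Ys acc v \<longrightarrow> sat \<chi> G Xs Ys acc v)"
| "sat (CIff \<psi> \<chi>) G Xs Ys acc v \<longleftrightarrow> (sat \<psi> G Xs Ys acc v \<longleftrightarrow> sat \<chi> G Xs Ys acc v)"
| "sat (Dia S \<psi>) G Xs Ys acc v \<longleftrightarrow>
     card {w \<in> verts G. \<exists>e\<in>edges G. ends e = {v, w} \<and> sat \<psi> G Xs Ys (Some (v, e)) w} \<in> S"
| "sat (Box S \<psi>) G Xs Ys acc v \<longleftrightarrow>
     \<not> card {w \<in> verts G. \<exists>e\<in>edges G. ends e = {v, w} \<and> \<not> sat \<psi> G Xs Ys (Some (v, e)) w} \<in> S"


section \<open>Existential Counting Modal Logic\<close>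

text \<open>In arithmetic formulas, as in modal formulas, sets are indexed with the fixed ones first.\<close>

datatype aterm =
    Const int | Param nat | NumV | NumE | CardX nat | CardY nat
  | Add aterm aterm | Sub aterm aterm | Mul aterm aterm

datatype arith =
    Equal aterm aterm | Less aterm aterm
  | ANot arith | AAnd arith arith | AOr arith arith

primrec wf_aterm :: "nat \<Rightarrow> nat \<Rightarrow> nat \<Rightarrow> aterm \<Rightarrow> bool" where
  "wf_aterm r p q (Const c) \<longleftrightarrow> True"
| "wf_aterm r p q (Param i) \<longleftrightarrow> i < r"
| "wf_aterm r p q NumV \<longleftrightarrow> True"
| "wf_aterm r p q NumE \<longleftrightarrow> True"
| "wf_aterm r p q (CardX i) \<longleftrightarrow> i < p"
| "wf_aterm r p q (CardY j) \<longleftrightarrow> j < q"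
| "wf_aterm r p q (Add s t) \<longleftrightarrow> wf_aterm r p q s \<and> wf_aterm r p q t"
| "wf_aterm r p q (Sub s t) \<longleftrightarrow> wf_aterm r p q s \<and> wf_aterm r p q t"
| "wf_aterm r p q (Mul s t) \<longleftrightarrow> wf_aterm r p q s \<and> wf_aterm r p q t"

primrec wf_arith :: "nat \<Rightarrow> nat \<Rightarrow> nat \<Rightarrow> arith \<Rightarrow> bool" where
  "wf_arith r p q (Equal s t) \<longleftrightarrow> wf_aterm r p q s \<and> wf_aterm r p q t"
| "wf_arith r p q (Less s t) \<longleftrightarrow> wf_aterm r p q s \<and> wf_aterm r p q t"
| "wf_arith r p q (ANot a) \<longleftrightarrow> wf_arith r p q a"
| "wf_arith r p q (AAnd a b) \<longleftrightarrow> wf_arith r p q a \<and> wf_arith r p q b"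
| "wf_arith r p q (AOr a b) \<longleftrightarrow> wf_arith r p q a \<and> wf_arith r p q b"

primrec aval :: "graph \<Rightarrow> int list \<Rightarrow> nat set list \<Rightarrow> edge set list \<Rightarrow> aterm \<Rightarrow> int" where
  "aval G ks Xs Ys (Const c) = c"
| "aval G ks Xs Ys (Param i) = ks ! i"
| "aval G ks Xs Ys NumV = int (card (verts G))"
| "aval G ks Xs Ys NumE = int (card (edges G))"
| "aval G ks Xs Ys (CardX i) = int (card (Xs ! i))"
| "aval G ks Xs Ys (CardY j) = int (card (Ys ! j))"
| "aval G ks Xs Ys (Add s t) = aval G ks Xs Ys s + aval G ks Xs Ys t"
| "aval G ks Xs Ys (Sub s t) = aval G ks Xs Ys s - aval G ks Xs Ys t"
| "aval G ks Xs Ys (Mul s t) = aval G ks Xs Ys s * aval G ks Xs Ys t"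

primrec aholds :: "graph \<Rightarrow> int list \<Rightarrow> nat set list \<Rightarrow> edge set list \<Rightarrow> arith \<Rightarrow> bool" where
  "aholds G ks Xs Ys (Equal s t) \<longleftrightarrow> aval G ks Xs Ys s = aval G ks Xs Ys t"
| "aholds G ks Xs Ys (Less s t) \<longleftrightarrow> aval G ks Xs Ys s < aval G ks Xs Ys t"
| "aholds G ks Xs Ys (ANot a) \<longleftrightarrow> \<not> aholds G ks Xs Ys a"
| "aholds G ks Xs Ys (AAnd a b) \<longleftrightarrow> aholds G ks Xs Ys a \<and> aholds G ks Xs Ys b"
| "aholds G ks Xs Ys (AOr a b) \<longleftrightarrow> aholds G ks Xs Ys a \<or> aholds G ks Xs Ys b"

record ecml_instance =
  graph_of :: graph
  fixed_X :: "nat set list"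
  fixed_Y :: "edge set list"
  params :: "int list"

record signature =
  is_directed :: bool
  num_FX :: nat
  num_FY :: nat
  num_params :: nat

definition instances :: "signature \<Rightarrow> ecml_instance set" where
  "instances \<Sigma> = {I.
     (if is_directed \<Sigma> then directed_graph (graph_of I) else undirected_graph (graph_of I)) \<and>
     length (fixed_X I) = num_FX \<Sigma> \<and> (\<forall>X\<in>set (fixed_X I). X \<subseteq> verts (graph_of I)) \<and>
     length (fixed_Y I) = num_FY \<Sigma> \<and> (\<forall>Y\<in>set (fixed_Y I). Y \<subseteq> edges (graph_of I)) \<and>
     length (params I) = num_params \<Sigma>}"

record ecml =
  num_X :: nat
  num_Y :: nat
  arith_part :: arith
  modal_part :: cml

definition wf_ecml :: "signature \<Rightarrow> ecml \<Rightarrow> bool" where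
  "wf_ecml \<Sigma> \<phi> \<longleftrightarrow>
     wf_arith (num_params \<Sigma>) (num_FX \<Sigma> + num_X \<phi>) (num_FY \<Sigma> + num_Y \<phi>) (arith_part \<phi>) \<and>
     wf_cml (is_directed \<Sigma>) (num_FX \<Sigma> + num_X \<phi>) (num_FY \<Sigma> + num_Y \<phi>) False (modal_part \<phi>)"

definition solutions :: "ecml \<Rightarrow> ecml_instance \<Rightarrow> (nat set list \<times> edge set list) set" where
  "solutions \<phi> I = {(Xs, Ys).
     length Xs = num_X \<phi> \<and> (\<forall>X\<in>set Xs. X \<subseteq> verts (graph_of I)) \<and>
     length Ys = num_Y \<phi> \<and> (\<forall>Y\<in>set Ys. Y \<subseteq> edges (graph_of I)) \<and>
     aholds (graph_of I) (params I) (fixed_X I @ Xs) (fixed_Y I @ Ys) (arith_part \<phi>) \<and>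
     (\<forall>v\<in>verts (graph_of I).
        sat (modal_part \<phi>) (graph_of I) (fixed_X I @ Xs) (fixed_Y I @ Ys) None v)}"

definition satisfies :: "ecml_instance \<Rightarrow> ecml \<Rightarrow> bool" where
  "satisfies I \<phi> \<longleftrightarrow> (\<exists>Xs Ys. (Xs, Ys) \<in> solutions \<phi> I)"

definition defines_class :: "signature \<Rightarrow> ecml \<Rightarrow> ecml_instance set \<Rightarrow> bool" where
  "defines_class \<Sigma> \<phi> \<K> \<longleftrightarrow> wf_ecml \<Sigma> \<phi> \<and> \<K> \<subseteq> instances \<Sigma> \<and>
     (\<forall>I\<in>instances \<Sigma>. I \<in> \<K> \<longleftrightarrow> satisfies I \<phi>)"


section \<open>Algorithms and running time\<close>

text \<open>
  The machine model is a first-order, call-by-value functional language (in the style of Jones's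
  languages \<open>F\<close> and \<open>WHILE\<close>) over binary trees. A program is a list of function bodies with
  arguments accessed by position, and function 0 is the main function. Each evaluation step costs
  one unit: constructing, testing or destructing a single cell, looking up a variable, or calling a
  function. There are no unit-cost operations on numbers and no unit-cost equality tests. With
  trees stored as shared cells, \<open>n\<close> steps of a fixed program can be simulated in time polynomial
  in \<open>n\<close> and the input size on a Turing machine, and conversely.
\<close>

datatype data = Nul | Cell data data

datatype exp =
    Var nat
  | MkNul
  | MkCell exp exp
  | Match exp exp exp \<comment> \<open>on a cell, its components become variables 0 and 1 of the third part\<close>
  | Let exp exp \<comment> \<open>the value of the first part becomes variable 0 of the second\<close>
  | Call nat "exp list"

type_synonym program = "exp list"

inductive eval :: "program \<Rightarrow> data list \<Rightarrow> exp \<Rightarrow> data \<Rightarrow> nat \<Rightarrow> bool"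
  and evals :: "program \<Rightarrow> data list \<Rightarrow> exp list \<Rightarrow> data list \<Rightarrow> nat \<Rightarrow> bool"
  for P :: program
where
  var: "i < length env \<Longrightarrow> eval P env (Var i) (env ! i) 1"
| mknul: "eval P env MkNul Nul 1"
| mkcell: "\<lbrakk>eval P env e1 v1 n1; eval P env e2 v2 n2\<rbrakk>
    \<Longrightarrow> eval P env (MkCell e1 e2) (Cell v1 v2) (Suc (n1 + n2))"
| match_nul: "\<lbrakk>eval P env e Nul n; eval P env e1 v n1\<rbrakk>
    \<Longrightarrow> eval P env (Match e e1 e2) v (Suc (n + n1))"
| match_cell: "\<lbrakk>eval P env e (Cell a b) n; eval P (a # b # env) e2 v n2\<rbrakk>
    \<Longrightarrow> eval P env (Match e e1 e2) v (Suc (n + n2))"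
| let_in: "\<lbrakk>eval P env e1 v1 n1; eval P (v1 # env) e2 v n2\<rbrakk>
    \<Longrightarrow> eval P env (Let e1 e2) v (Suc (n1 + n2))"
| call: "\<lbrakk>f < length P; evals P env es vs n; eval P vs (P ! f) v m\<rbrakk>
    \<Longrightarrow> eval P env (Call f es) v (Suc (n + m))"
| nil: "evals P env [] [] 0"
| cons: "\<lbrakk>eval P env e v n; evals P env es vs m\<rbrakk>
    \<Longrightarrow> evals P env (e # es) (v # vs) (n + m)"

definition computes_in :: "program \<Rightarrow> data \<Rightarrow> data \<Rightarrow> nat \<Rightarrow> bool" where
  "computes_in P x y n \<longleftrightarrow> 0 < length P \<and> eval P [x] (P ! 0) y n"

text \<open>Evaluation is deterministic, so results and running times are unique.\<close>

lemma eval_evals_deterministic: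
  "eval P env e v n \<Longrightarrow> eval P env e v' n' \<Longrightarrow> v = v' \<and> n = n'"
  "evals P env es vs m \<Longrightarrow> evals P env es vs' m' \<Longrightarrow> vs = vs' \<and> m = m'"
proof (induction arbitrary: v' n' and vs' m' rule: eval_evals.inducts)
  case (var i env)
  then show ?case by (auto elim: eval.cases)
next
  case (mknul env)
  then show ?case by (auto elim: eval.cases)
next
  case (mkcell env e1 v1 n1 e2 v2 n2)
  from mkcell.prems show ?case by cases (use mkcell.IH in blast)
next
  case (match_nul env e n e1 v n1 e2)
  from match_nul.prems show ?case by cases (use match_nul.IH in \<open>blast+\<close>)
next
  case (match_cell env e a b n e2 v n2 e1)
  from match_cell.prems show ?case by cases (use match_cell.IH in \<open>blast+\<close>)
next
  case (let_in env e1 v1 n1 e2 v n2)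
  from let_in.prems show ?case by cases (use let_in.IH in blast)
next
  case (call f env es vs n v m)
  from call.prems show ?case by cases (use call.IH in blast)
next
  case (nil env)
  then show ?case by (auto elim: evals.cases)
next
  case (cons env e v n es vs m)
  from cons.prems show ?case by cases (use cons.IH in blast)
qed


section \<open>Encoding of inputs and outputs\<close>

definition enc_bool :: "bool \<Rightarrow> data" where
  "enc_bool b = (if b then Cell Nul Nul else Nul)"

primrec enc_list :: "data list \<Rightarrow> data" where
  "enc_list [] = Nul"
| "enc_list (x # xs) = Cell x (enc_list xs)"

text \<open>Binary representation, least significant bit first, without leading zeros.\<close>

fun enc_nat :: "nat \<Rightarrow> data" where
  "enc_nat n = (if n = 0 then Nul else Cell (enc_bool (odd n)) (enc_nat (n div 2)))"

declare enc_nat.simps [simp del]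

definition enc_int :: "int \<Rightarrow> data" where
  "enc_int k = Cell (enc_bool (k < 0)) (enc_nat (nat \<bar>k\<bar>))"

fun enc_edge :: "edge \<Rightarrow> data" where
  "enc_edge (Undirected e) = Cell (enc_nat (Min e)) (enc_nat (Max e))"
| "enc_edge (Directed u v) = Cell (enc_nat u) (enc_nat v)"

text \<open>
  A finite set may be presented to an algorithm as a list of its elements in any order, so that a
  set (and likewise an input) has several encodings; an algorithm must work for all of them.
\<close>

definition encodes_set :: "('a \<Rightarrow> data) \<Rightarrow> 'a set \<Rightarrow> data \<Rightarrow> bool" where
  "encodes_set enc A x \<longleftrightarrow> (\<exists>as. distinct as \<and> set as = A \<and> x = enc_list (map enc as))"

text \<open>
  The vertices of \<open>G\<close> and the nodes of the decomposition tree are assumed to be \<^const>\<open>numbered\<close>,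
  so vertex sets are given by their cardinality and bags are listed in the order of the nodes.
\<close>

definition encodes_graph :: "graph \<Rightarrow> data \<Rightarrow> bool" where
  "encodes_graph G x \<longleftrightarrow>
     (\<exists>es. encodes_set enc_edge (edges G) es \<and> x = Cell (enc_nat (card (verts G))) es)"

definition encodes_instance :: "ecml_instance \<Rightarrow> data \<Rightarrow> bool" where
  "encodes_instance I x \<longleftrightarrow>
     (\<exists>g xs ys. encodes_graph (graph_of I) g \<and>
        list_all2 (encodes_set enc_nat) (fixed_X I) xs \<and>
        list_all2 (encodes_set enc_edge) (fixed_Y I) ys \<and>
        x = enc_list [g, enc_list xs, enc_list ys, enc_list (map enc_int (params I))])"

definition encodes_tree_decomp :: "tree_decomp \<Rightarrow> data \<Rightarrow> bool" where
  "encodes_tree_decomp D x \<longleftrightarrow>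
     (\<exists>t bs. encodes_graph (tree D) t \<and>
        list_all2 (encodes_set enc_nat) (map (bag D) [0..<card (verts (tree D))]) bs \<and>
        x = Cell t (enc_list bs))"

fun bit_length :: "nat \<Rightarrow> nat" where
  "bit_length n = (if n = 0 then 0 else Suc (bit_length (n div 2)))"

declare bit_length.simps [simp del]

text \<open>
  The size measure in which the running time may depend polynomially: besides \<open>|G|\<close> it accounts for
  the parts of the input whose length is not bounded in terms of \<open>|G|\<close>, namely the number of nodes
  of the tree decomposition and the numbers of bits of the parameters.
\<close>

definition input_size :: "ecml_instance \<Rightarrow> tree_decomp \<Rightarrow> nat" where
  "input_size I D = graph_size (graph_of I) + card (verts (tree D)) +
     (\<Sum>k\<leftarrow>params I. bit_length (nat \<bar>k\<bar>))"

end

theory Submission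
  imports Defs
begin

text \<open>
  The algorithm eliminates the vertices one at a time. Listing the nodes of the tree so that every
  node after the first has a unique earlier neighbour, and the vertices by their topmost node,
  yields an order such that the tables met when eliminating backwards never involve vertices from
  more than one bag. A vertex state consists of the memberships of the vertex in the sets
  \<open>X\<^sub>i\<close>, guessed truth values of the modal subformulas there, and for each of these subformulas the
  number of neighbours satisfying its body, reduced modulo the period of the recognizable set.
  A table maps states of its vertices, together with cardinality vectors, to multiplicities; it has
  at most \<open>c\<^sup>t\<close> times polynomially many keys. The guesses are determined by the sets, so
  the accepted choices are in bijection with the solutions. Running times are derived
  compositionally: functions realizable in time polynomial in the size of the argument and a bound
  on the table sizes are closed under the list operations used.
\<close>

class encodable =
  fixes enc :: "'a \<Rightarrow> data"
  assumes enc_inject: "enc x = enc y \<Longrightarrow> x = y"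
begin

definition sz :: "'a \<Rightarrow> nat" where "sz x = size (enc x)"

lemma enc_eq_iff: "enc x = enc y \<longleftrightarrow> x = y"
  using enc_inject by blast

end

instantiation data :: encodable
begin
definition enc_data :: "data \<Rightarrow> data" where "enc_data x = x"
instance by standard (simp add: enc_data_def)
end

instantiation unit :: encodable
begin
definition enc_unit :: "unit \<Rightarrow> data" where "enc_unit x = Nul"
instance by standard simp
end

instantiation bool :: encodable
begin
definition enc_bool' : "enc = enc_bool"
instance by standard (auto simp: enc_bool' enc_bool_def split: if_splits)
end

lemma enc_nat_inject: "enc_nat m = enc_nat n \<Longrightarrow> m = n"
proof (induction m arbitrary: n rule: less_induct)
  case (less m)
  show ?case
  proof (cases "m = 0 \<or> n = 0")
    case True
    then show ?thesis using less.prems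
      by (auto simp: enc_nat.simps[of m] enc_nat.simps[of n] split: if_splits)
  next
    case False
    then have "enc_bool (odd m) = enc_bool (odd n)" "enc_nat (m div 2) = enc_nat (n div 2)"
      using less.prems by (auto simp: enc_nat.simps[of m] enc_nat.simps[of n])
    with less.IH[of "m div 2" "n div 2"] False have "m div 2 = n div 2" "odd m = odd n"
      by (auto simp: enc_bool_def split: if_splits)
    then show ?thesis by (metis odd_two_times_div_two_succ even_two_times_div_two)
  qed
qed

instantiation nat :: encodable
begin
definition enc_nat' : "enc = enc_nat"
instance by standard (auto simp: enc_nat' dest: enc_nat_inject)
end

instantiation prod :: (encodable, encodable) encodable
begin
definition enc_prod :: "'a \<times> 'b \<Rightarrow> data" where "enc_prod p = Cell (enc (fst p)) (enc (snd p))"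
instance by standard (auto simp: enc_prod_def enc_eq_iff prod_eq_iff)
end

instantiation list :: (encodable) encodable
begin
definition enc_list' : "enc xs = enc_list (map enc xs)"
instance
proof
  fix x y :: "'a list"
  show "enc x = enc y \<Longrightarrow> x = y"
    unfolding enc_list'
  proof (induction x arbitrary: y)
    case Nil
    then show ?case by (cases y) auto
  next
    case (Cons a x)
    then show ?case by (cases y) (auto simp: enc_eq_iff)
  qed
qed
end

lemma enc_simps [simp]:
  "enc () = Nul" "enc (a, b) = Cell (enc a) (enc b)"
  "enc [] = Nul" "enc (x # xs) = Cell (enc x) (enc xs)"
  by (simp_all add: enc_unit_def enc_prod_def enc_list')

lemma sz_simps [simp]:
  "sz () = 0" "sz (a, b) = Suc (sz a + sz b)"
  "sz [] = 0" "sz (x # xs) = Suc (sz x + sz xs)"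
  by (simp_all add: sz_def)

lemma sz_pair: "sz p = Suc (sz (fst p) + sz (snd p))"
  by (cases p) simp

lemma sz_bool: "sz (b::bool) \<le> 1"
  by (simp add: sz_def enc_bool' enc_bool_def)

lemma sz_fst_le: "sz (fst p) \<le> sz p" and sz_snd_le: "sz (snd p) \<le> sz p"
  by (simp_all add: sz_pair)

lemma sz_mem: "x \<in> set xs \<Longrightarrow> sz x < sz xs"
  by (induction xs) auto

lemma length_le_sz: "length xs \<le> sz xs"
  by (induction xs) auto

lemma sz_list_le: "(\<And>x. x \<in> set xs \<Longrightarrow> sz x \<le> B) \<Longrightarrow> sz xs \<le> length xs * Suc B"
proof (induction xs)
  case (Cons x xs)
  have "sz x \<le> B" "sz xs \<le> length xs * Suc B" using Cons by auto
  then show ?case by simp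
qed simp

lemma sz_append [simp]: "sz (xs @ ys) = sz xs + sz ys"
  by (induction xs) auto

lemma sz_rev [simp]: "sz (rev xs) = sz xs"
  by (induction xs) auto


section \<open>Polynomial bounds\<close>

definition pb :: "'a::encodable set \<Rightarrow> ('a \<Rightarrow> nat) \<Rightarrow> ('a \<Rightarrow> nat) \<Rightarrow> bool" where
  "pb D m f \<longleftrightarrow> (\<exists>k. \<forall>s\<in>D. f s \<le> (m s + sz s + 2) ^ k)"

lemma pbI: "(\<And>s. s \<in> D \<Longrightarrow> f s \<le> (m s + sz s + 2) ^ k) \<Longrightarrow> pb D m f"
  unfolding pb_def by blast

lemma pb_mono: "pb D m g \<Longrightarrow> (\<And>s. s \<in> D \<Longrightarrow> f s \<le> g s) \<Longrightarrow> pb D m f"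
  unfolding pb_def by (meson order_trans)

lemma pb_subset: "pb D m f \<Longrightarrow> D' \<subseteq> D \<Longrightarrow> pb D' m f"
  unfolding pb_def by blast

lemma pb_add [intro]: assumes "pb D m f" "pb D m g" shows "pb D m (\<lambda>s. f s + g s)"
proof -
  from assms obtain k l where *: "\<forall>s\<in>D. f s \<le> (m s + sz s + 2) ^ k" "\<forall>s\<in>D. g s \<le> (m s + sz s + 2) ^ l"
    unfolding pb_def by blast
  show ?thesis
  proof (rule pbI)
    fix s assume s: "s \<in> D"
    let ?x = "m s + sz s + 2"
    have "f s + g s \<le> ?x ^ (k + l) + ?x ^ (k + l)"
      by (intro add_mono order_trans[OF *(1)[rule_format, OF s]] order_trans[OF *(2)[rule_format, OF s]]
          power_increasing) auto
    also have "\<dots> \<le> ?x * ?x ^ (k + l)" by simp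
    finally show "f s + g s \<le> ?x ^ Suc (k + l)" by simp
  qed
qed

lemma pb_mult [intro]: assumes "pb D m f" "pb D m g" shows "pb D m (\<lambda>s. f s * g s)"
proof -
  from assms obtain k l where *: "\<forall>s\<in>D. f s \<le> (m s + sz s + 2) ^ k" "\<forall>s\<in>D. g s \<le> (m s + sz s + 2) ^ l"
    unfolding pb_def by blast
  show ?thesis
    by (rule pbI[of _ _ _ "k + l"]) (use * in \<open>auto simp: power_add intro!: mult_mono\<close>)
qed

lemma pb_const [intro]: "pb D m (\<lambda>s. c)"
proof (rule pbI)
  fix s :: 'a
  have "c \<le> 2 ^ c" by (simp add: less_imp_le)
  also have "\<dots> \<le> (m s + sz s + 2) ^ c" by (rule power_mono) auto
  finally show "c \<le> (m s + sz s + 2) ^ c" .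
qed

lemma pb_Suc [intro]: "pb D m f \<Longrightarrow> pb D m (\<lambda>s. Suc (f s))"
  using pb_add[OF _ pb_const, of D m f 1] by simp

lemma pb_power [intro]: "pb D m f \<Longrightarrow> pb D m (\<lambda>s. f s ^ k)"
  by (induction k) auto

lemma pb_self [intro]: "pb D m (\<lambda>s. m s + sz s + 2)"
  by (rule pbI[of _ _ _ 1]) simp

lemma pb_sz [intro]: "pb D m sz"
  by (rule pb_mono[OF pb_self]) simp

lemma pb_measure [intro]: "pb D m m"
  by (rule pb_mono[OF pb_self]) simp

lemma pb_comp:
  assumes "pb D' m' g" "pb D m (\<lambda>s. m' (f s))" "pb D m (\<lambda>s. sz (f s))" "\<And>s. s \<in> D \<Longrightarrow> f s \<in> D'"
  shows "pb D m (\<lambda>s. g (f s))"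
proof -
  from assms(1) obtain k where k: "\<And>s. s \<in> D' \<Longrightarrow> g s \<le> (m' s + sz s + 2) ^ k"
    unfolding pb_def by blast
  show ?thesis
    proof (rule pb_mono)
    show "pb D m (\<lambda>s. (m' (f s) + sz (f s) + 2) ^ k)"
      by (intro pb_power pb_add pb_const assms)
  qed (use assms(4) k in blast)
qed


section \<open>Polynomial-time functions\<close>

declare One_nat_def [simp del]

lemma eval_weaken:
  "eval P env e v n \<Longrightarrow> eval P (env @ rest) e v n"
  "evals P env es vs n \<Longrightarrow> evals P (env @ rest) es vs n"
proof (induction rule: eval_evals.inducts)
  case (var i env)
  then show ?case using eval_evals.var[of i "env @ rest" P] by (simp add: nth_append del: One_nat_def)
qed (auto simp del: One_nat_def intro: eval_evals.intros)

lemma eval_weaken1: "eval P [x] e v n \<Longrightarrow> eval P (x # rest) e v n"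
  using eval_weaken(1)[of P "[x]" e v n rest] by simp

lemma ex_eval_le:
  "eval P env e v t \<Longrightarrow> v = v' \<Longrightarrow> t \<le> B \<Longrightarrow> \<exists>t\<le>B. eval P env e v' t"
  by blast

lemma eval_var: "i < length env \<Longrightarrow> v = env ! i \<Longrightarrow> eval P env (Var i) v 1"
  using eval_evals.var by blast

definition realizes ::
  "'a::encodable set \<Rightarrow> ('a \<Rightarrow> 'b::encodable) \<Rightarrow> ('a \<Rightarrow> nat) \<Rightarrow> nat \<Rightarrow> program \<Rightarrow> exp \<Rightarrow> bool" where
  "realizes D f T n Q e \<longleftrightarrow> (\<forall>P R s. length P = n \<longrightarrow> s \<in> D \<longrightarrow>
     (\<exists>t\<le>T s. eval (P @ Q @ R) [enc s] e (enc (f s)) t))"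

text \<open>
  The program text of \<open>f\<close> may be placed at any position \<open>n\<close> of a larger program, so that
  programs can be combined without renumbering the functions they call. The time is bounded by a
  polynomial in the size of the argument and in \<open>m\<close>, which serves for accumulators of
  size \<open>c ^ width\<close>.
\<close>

definition pt :: "'a::encodable set \<Rightarrow> ('a \<Rightarrow> nat) \<Rightarrow> ('a \<Rightarrow> 'b::encodable) \<Rightarrow> bool" where
  "pt D m f \<longleftrightarrow> pb D m (\<lambda>s. sz (f s)) \<and> (\<exists>T. pb D m T \<and> (\<forall>n. \<exists>Q e. realizes D f T n Q e))"

lemma ptI: "pb D m (\<lambda>s. sz (f s)) \<Longrightarrow> pb D m T \<Longrightarrow> (\<And>n. \<exists>Q e. realizes D f T n Q e) \<Longrightarrow> pt D m f"
  unfolding pt_def by blast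

lemma pt_sz: "pt D m f \<Longrightarrow> pb D m (\<lambda>s. sz (f s))"
  unfolding pt_def by blast

lemma ptE:
  assumes "pt D m f"
  obtains T where "pb D m T" "\<And>n. \<exists>Q e. realizes D f T n Q e"
  using assms unfolding pt_def by blast

lemma realizesD:
  "realizes D f T n Q e \<Longrightarrow> length P = n \<Longrightarrow> s \<in> D \<Longrightarrow>
    \<exists>t\<le>T s. eval (P @ Q @ R) [enc s] e (enc (f s)) t"
  unfolding realizes_def by blast

lemma pt_coerce:
  assumes "pt D m f" "\<And>s. s \<in> D \<Longrightarrow> enc (g s) = enc (f s)"
  shows "pt D m g"
proof -
  obtain T where T: "pb D m T" "\<And>n. \<exists>Q e. realizes D f T n Q e" using assms(1) by (rule ptE) blast
  show ?thesis
  proof (rule ptI[OF _ T(1)])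
    show "pb D m (\<lambda>s. sz (g s))" by (rule pb_mono[OF pt_sz[OF assms(1)]]) (simp add: sz_def assms(2))
    show "\<exists>Q e. realizes D g T n Q e" for n
      using T(2)[of n] assms(2) unfolding realizes_def by simp
  qed
qed

lemma pt_cong: "pt D m f \<Longrightarrow> (\<And>s. s \<in> D \<Longrightarrow> g s = f s) \<Longrightarrow> pt D m g"
  by (rule pt_coerce) auto

lemma pt_subset: "pt D m f \<Longrightarrow> D' \<subseteq> D \<Longrightarrow> pt D' m f"
  unfolding pt_def realizes_def using pb_subset[of D m _ D'] by (meson subsetD)

lemma pt_id: "pt D m (\<lambda>s. s)"
proof (rule ptI[where T = "\<lambda>_. 1"])
  show "\<exists>Q e. realizes D (\<lambda>s. s) (\<lambda>_. 1) n Q e" for n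
    by (rule exI[of _ "[]"], rule exI[of _ "Var 0"])
      (auto simp: realizes_def simp del: One_nat_def intro!: exI[of _ 1] eval_var)
qed auto

lemma pt_comp:
  assumes f: "pt D m f" and g: "pt D' m' g" and D: "\<And>s. s \<in> D \<Longrightarrow> f s \<in> D'"
    and m: "pb D m (\<lambda>s. m' (f s))"
  shows "pt D m (\<lambda>s. g (f s))"
proof -
  from f obtain Tf where Tf: "pb D m Tf" "\<And>n. \<exists>Q e. realizes D f Tf n Q e" by (rule ptE) blast
  from g obtain Tg where Tg: "pb D' m' Tg" "\<And>n. \<exists>Q e. realizes D' g Tg n Q e" by (rule ptE) blast
  show ?thesis
  proof (rule ptI[where T = "\<lambda>s. Suc (Tf s + Tg (f s))"])
    show "pb D m (\<lambda>s. sz (g (f s)))"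
      by (rule pb_comp[OF pt_sz[OF g] m pt_sz[OF f] D])
    show "pb D m (\<lambda>s. Suc (Tf s + Tg (f s)))"
      by (intro pb_Suc pb_add Tf pb_comp[OF Tg(1) m pt_sz[OF f] D])
    fix n
    obtain Q1 e1 where 1: "realizes D f Tf n Q1 e1" using Tf by blast
    obtain Q2 e2 where 2: "realizes D' g Tg (n + length Q1) Q2 e2" using Tg by blast
    have "realizes D (\<lambda>s. g (f s)) (\<lambda>s. Suc (Tf s + Tg (f s))) n (Q1 @ Q2) (Let e1 e2)"
      unfolding realizes_def
    proof (intro allI impI)
      fix P R :: program and s assume *: "length P = n" "s \<in> D"
      from realizesD[OF 1 *, of "Q2 @ R"] obtain t1 where
        t1: "t1 \<le> Tf s" "eval (P @ (Q1 @ Q2) @ R) [enc s] e1 (enc (f s)) t1" by auto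
      from realizesD[OF 2, of "P @ Q1" "f s" R] * D obtain t2 where
        t2: "t2 \<le> Tg (f s)" "eval (P @ (Q1 @ Q2) @ R) [enc (f s)] e2 (enc (g (f s))) t2" by auto
      from eval_evals.let_in[OF t1(2) eval_weaken1[OF t2(2)]] t1(1) t2(1)
      show "\<exists>t\<le>Suc (Tf s + Tg (f s)). eval (P @ (Q1 @ Q2) @ R) [enc s] (Let e1 e2) (enc (g (f s))) t"
        by (intro exI[of _ "Suc (t1 + t2)"]) auto
    qed
    then show "\<exists>Q e. realizes D (\<lambda>s. g (f s)) (\<lambda>s. Suc (Tf s + Tg (f s))) n Q e" by blast
  qed
qed

abbreviation poly_time :: "('a::encodable \<Rightarrow> 'b::encodable) \<Rightarrow> bool" where
  "poly_time \<equiv> pt UNIV (\<lambda>_. 0)"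

lemma pt_app: "poly_time g \<Longrightarrow> pt D m f \<Longrightarrow> pt D m (\<lambda>s. g (f s))"
  by (rule pt_comp) auto

lemma pt_Pair:
  assumes f: "pt D m f" and g: "pt D m g"
  shows "pt D m (\<lambda>s. (f s, g s))"
proof -
  from f obtain Tf where Tf: "pb D m Tf" "\<And>n. \<exists>Q e. realizes D f Tf n Q e" by (rule ptE) blast
  from g obtain Tg where Tg: "pb D m Tg" "\<And>n. \<exists>Q e. realizes D g Tg n Q e" by (rule ptE) blast
  show ?thesis
  proof (rule ptI[where T = "\<lambda>s. Suc (Tf s + Tg s)"])
    show "pb D m (\<lambda>s. sz (f s, g s))"
      unfolding sz_simps by (intro pb_Suc pb_add pt_sz assms)
    show "pb D m (\<lambda>s. Suc (Tf s + Tg s))"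
      by (intro pb_Suc pb_add Tf Tg)
    fix n
    obtain Q1 e1 where 1: "realizes D f Tf n Q1 e1" using Tf by blast
    obtain Q2 e2 where 2: "realizes D g Tg (n + length Q1) Q2 e2" using Tg by blast
    have "realizes D (\<lambda>s. (f s, g s)) (\<lambda>s. Suc (Tf s + Tg s)) n (Q1 @ Q2) (MkCell e1 e2)"
      unfolding realizes_def
    proof (intro allI impI)
      fix P R :: program and s assume *: "length P = n" "s \<in> D"
      from realizesD[OF 1 *, of "Q2 @ R"] obtain t1 where
        t1: "t1 \<le> Tf s" "eval (P @ (Q1 @ Q2) @ R) [enc s] e1 (enc (f s)) t1" by auto
      from realizesD[OF 2, of "P @ Q1" "s" R] * obtain t2 where
        t2: "t2 \<le> Tg s" "eval (P @ (Q1 @ Q2) @ R) [enc s] e2 (enc (g s)) t2" by auto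
      from eval_evals.mkcell[OF t1(2) t2(2)] t1(1) t2(1)
      show "\<exists>t\<le>Suc (Tf s + Tg s). eval (P @ (Q1 @ Q2) @ R) [enc s] (MkCell e1 e2) (enc (f s, g s)) t"
        by (intro exI[of _ "Suc (t1 + t2)"]) auto
    qed
    then show "\<exists>Q e. realizes D (\<lambda>s. (f s, g s)) (\<lambda>s. Suc (Tf s + Tg s)) n Q e" by blast
  qed
qed

lemma pt_Cons: "pt D m f \<Longrightarrow> pt D m g \<Longrightarrow> pt D m (\<lambda>s. f s # g s)"
  by (rule pt_coerce[OF pt_Pair]) auto

lemma poly_time_fst: "poly_time (fst :: 'a::encodable \<times> 'b::encodable \<Rightarrow> 'a)"
  and poly_time_snd: "poly_time (snd :: 'a \<times> 'b \<Rightarrow> 'b)"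
proof -
  have v: "eval P [enc p] (Var 0) (Cell (enc (fst p)) (enc (snd p))) 1" for P and p :: "'a \<times> 'b"
    by (auto intro!: eval_var simp: enc_prod_def)
  have "eval P [enc p] (Match (Var 0) MkNul (Var 0)) (enc (fst p)) (Suc (1 + 1))"
    "eval P [enc p] (Match (Var 0) MkNul (Var 1)) (enc (snd p)) (Suc (1 + 1))" for P and p :: "'a \<times> 'b"
    by (rule eval_evals.match_cell[OF v], rule eval_var, simp, simp)+
  note e = this
  from e(1) have 1: "realizes UNIV (fst :: 'a \<times> 'b \<Rightarrow> 'a) (\<lambda>_. Suc (1 + 1)) n [] (Match (Var 0) MkNul (Var 0))"
    for n
    unfolding realizes_def append_Nil by blast
  from e(2) have 2: "realizes UNIV (snd :: 'a \<times> 'b \<Rightarrow> 'b) (\<lambda>_. Suc (1 + 1)) n [] (Match (Var 0) MkNul (Var 1))" for n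
    unfolding realizes_def append_Nil by blast
  have "pb UNIV (\<lambda>_. 0) (\<lambda>p::'a \<times> 'b. sz (fst p))" "pb UNIV (\<lambda>_. 0) (\<lambda>p::'a \<times> 'b. sz (snd p))"
    by (rule pb_mono[OF pb_sz], simp add: sz_fst_le sz_snd_le)+
  with 1 2 show "poly_time (fst :: 'a \<times> 'b \<Rightarrow> 'a)" "poly_time (snd :: 'a \<times> 'b \<Rightarrow> 'b)"
    by - (rule ptI[where T = "\<lambda>_. Suc (1 + 1)"], assumption, rule pb_const, blast)+
qed

lemmas pt_fst = pt_app[OF poly_time_fst] and pt_snd = pt_app[OF poly_time_snd]

primrec const_exp :: "data \<Rightarrow> exp" where
  "const_exp Nul = MkNul"
| "const_exp (Cell a b) = MkCell (const_exp a) (const_exp b)"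

lemma eval_const_exp: "\<exists>t. \<forall>P env. eval P env (const_exp d) d t"
proof (induction d)
  case Nul
  show ?case by (rule exI[of _ 1]) (auto intro: eval_evals.mknul[simplified])
next
  case (Cell a b)
  then obtain ta tb where "\<forall>P env. eval P env (const_exp a) a ta" "\<forall>P env. eval P env (const_exp b) b tb"
    by blast
  then show ?case by (intro exI[of _ "Suc (ta + tb)"]) (auto intro: eval_evals.mkcell)
qed

lemma pt_const: "pt D m (\<lambda>_. c)"
proof -
  obtain t where t: "\<And>P env. eval P env (const_exp (enc c)) (enc c) t" using eval_const_exp by blast
  show ?thesis
    by (rule ptI[where T = "\<lambda>_. t"])
      (auto simp: realizes_def intro!: exI[of _ "[]"] exI[of _ "const_exp (enc c)"] t)
qed

lemma pt_case_list:
  assumes xs: "pt D m xs" and f: "pt {s\<in>D. xs s = []} m f"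
    and g: "pt {p. fst p \<in> D \<and> xs (fst p) = fst (snd p) # snd (snd p)} (\<lambda>p. m (fst p))
              (\<lambda>p. g (fst p) (fst (snd p)) (snd (snd p)))"
  shows "pt D m (\<lambda>s. case xs s of [] \<Rightarrow> f s | y # ys \<Rightarrow> g s y ys)"
proof -
  let ?DN = "{s\<in>D. xs s = []}"
  let ?DC = "{p. fst p \<in> D \<and> xs (fst p) = fst (snd p) # snd (snd p)}"
  let ?mC = "\<lambda>p. m (fst p)" and ?g = "\<lambda>p. g (fst p) (fst (snd p)) (snd (snd p))"
  let ?f = "\<lambda>s. case xs s of [] \<Rightarrow> f s | y # ys \<Rightarrow> g s y ys"
  let ?c = "\<lambda>s. (s, hd (xs s), tl (xs s))"
  from xs obtain T0 where T0: "pb D m T0" "\<And>n. \<exists>Q e. realizes D xs T0 n Q e" by (rule ptE) blast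
  from f obtain Tf where Tf: "pb ?DN m Tf" "\<And>n. \<exists>Q e. realizes ?DN f Tf n Q e" by (rule ptE) blast
  from g obtain Tg where Tg: "pb ?DC ?mC Tg" "\<And>n. \<exists>Q e. realizes ?DC ?g Tg n Q e" by (rule ptE) blast
  have restrict: "pb D m (\<lambda>s. if s \<in> X then h s else 0)" if "pb (X \<inter> D) m h" for X h
  proof -
    from that obtain k where "\<And>s. s \<in> X \<inter> D \<Longrightarrow> h s \<le> (m s + sz s + 2) ^ k"
      unfolding pb_def by blast
    then show ?thesis by (intro pbI[where k = k]) auto
  qed
  have C: "pb D m (\<lambda>s. if s \<in> {s. xs s \<noteq> []} then h (?c s) else 0)" if "pb ?DC ?mC h" for h
  proof (rule restrict, rule pb_comp[OF that])
    show "pb ({s. xs s \<noteq> []} \<inter> D) m (\<lambda>s. sz (?c s))"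
      by (rule pb_mono[where g = "\<lambda>s. Suc (sz s + sz (xs s))"])
        (auto intro!: pb_Suc pb_add pb_subset[OF pt_sz[OF xs]] simp: neq_Nil_conv)
  qed auto
  have N: "pb D m (\<lambda>s. if s \<in> {s. xs s = []} then h s else 0)" if "pb ?DN m h" for h
    by (rule restrict, rule pb_subset[OF that]) auto
  define T where "T = (\<lambda>s. T0 s + (if s \<in> {s. xs s = []} then Tf s else 0) +
    (if s \<in> {s. xs s \<noteq> []} then Tg (?c s) else 0) + 7)"
  show ?thesis
  proof (rule ptI[where T = T])
    show "pb D m T" unfolding T_def by (intro pb_add pb_const N C Tf Tg T0)
    show "pb D m (\<lambda>s. sz (?f s))"
      by (rule pb_mono[OF pb_add[OF N[OF pt_sz[OF f]] C[OF pt_sz[OF g]]]]) (auto split: list.split)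
    fix n
    obtain Q0 e0 where 0: "realizes D xs T0 n Q0 e0" using T0 by blast
    obtain Q1 e1 where 1: "realizes ?DN f Tf (n + length Q0) Q1 e1" using Tf by blast
    obtain Q2 e2 where 2: "realizes ?DC ?g Tg (n + length Q0 + length Q1) Q2 e2" using Tg by blast
    let ?k = "n + length Q0 + length Q1 + length Q2"
    let ?e = "Match e0 e1 (Call ?k [MkCell (Var 2) (MkCell (Var 0) (Var 1))])"
    let ?Q = "Q0 @ Q1 @ Q2 @ [e2]"
    have "realizes D ?f T n ?Q ?e"
      unfolding realizes_def
    proof (intro allI impI)
      fix P R :: program and s assume *: "length P = n" "s \<in> D"
      let ?P = "P @ ?Q @ R"
      from realizesD[OF 0 *, of "Q1 @ Q2 @ [e2] @ R"] obtain t0 where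
        t0: "t0 \<le> T0 s" "eval ?P [enc s] e0 (enc (xs s)) t0" by auto
      show "\<exists>t\<le>T s. eval ?P [enc s] ?e (enc (?f s)) t"
      proof (cases "xs s")
        case Nil
        from realizesD[OF 1, of "P @ Q0" s "Q2 @ [e2] @ R"] * Nil obtain t1 where
          t1: "t1 \<le> Tf s" "eval ?P [enc s] e1 (enc (f s)) t1" by auto
        show ?thesis
          by (rule exI[of _ "Suc (t0 + t1)"])
            (use t0 t1 Nil in \<open>auto simp: T_def intro!: eval_evals.match_nul\<close>)
      next
        case (Cons y ys)
        from realizesD[OF 2, of "P @ Q0 @ Q1" "(s, y, ys)" "[e2] @ R"] * Cons obtain t2 where
          t2: "t2 \<le> Tg (s, y, ys)" "eval ?P [Cell (enc s) (Cell (enc y) (enc ys))] e2 (enc (g s y ys)) t2"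
          by auto
        have a: "eval ?P [enc y, enc ys, enc s] (MkCell (Var 2) (MkCell (Var 0) (Var 1)))
          (Cell (enc s) (Cell (enc y) (enc ys))) (Suc (1 + Suc (1 + 1)))"
          by (intro eval_evals.mkcell eval_var) auto
        have "evals ?P [enc y, enc ys, enc s] [MkCell (Var 2) (MkCell (Var 0) (Var 1))]
          [Cell (enc s) (Cell (enc y) (enc ys))] (Suc (1 + Suc (1 + 1)) + 0)"
          by (intro eval_evals.cons[OF a] eval_evals.nil)
        moreover have "?k < length ?P" "?P ! ?k = e2" using * by (auto simp: nth_append)
        ultimately have "eval ?P [enc y, enc ys, enc s] (Call ?k [MkCell (Var 2) (MkCell (Var 0) (Var 1))])
           (enc (g s y ys)) (Suc (Suc (1 + Suc (1 + 1)) + 0 + t2))"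
          using t2 by (intro eval_evals.call) auto
        from eval_evals.match_cell[OF t0(2)[unfolded Cons enc_simps] this, of e1] t0(1) t2(1) Cons
        show ?thesis by (intro exI conjI) (auto simp: T_def)
      qed
    qed
    then show "\<exists>Q e. realizes D ?f T n Q e" by blast
  qed
qed

definition reach :: "'a set \<Rightarrow> ('a \<Rightarrow> 'x list) \<Rightarrow> ('a \<Rightarrow> 'b) \<Rightarrow> ('a \<Rightarrow> 'b \<Rightarrow> 'x \<Rightarrow> 'b) \<Rightarrow> ('a \<times> 'x \<times> 'b) set" where
  "reach D xs i b = {(s, x, a). s \<in> D \<and> (\<exists>ys zs. xs s = ys @ x # zs \<and> a = foldl (b s) (i s) ys)}"

lemma pt_foldl:
  assumes xs: "pt D m xs" and i: "pt D m i"
    and b: "pt (reach D xs i b) (\<lambda>p. m (fst p)) (\<lambda>p. b (fst p) (snd (snd p)) (fst (snd p)))"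
    and A: "pb D m A" and sz: "\<And>s ys zs. s \<in> D \<Longrightarrow> xs s = ys @ zs \<Longrightarrow> sz (foldl (b s) (i s) ys) \<le> A s"
  shows "pt D m (\<lambda>s. foldl (b s) (i s) (xs s))"
proof -
  let ?D = "reach D xs i b" and ?b = "\<lambda>p. b (fst p) (snd (snd p)) (fst (snd p))"
  from xs obtain T0 where T0: "pb D m T0" "\<And>n. \<exists>Q e. realizes D xs T0 n Q e" by (rule ptE) blast
  from i obtain T1 where T1: "pb D m T1" "\<And>n. \<exists>Q e. realizes D i T1 n Q e" by (rule ptE) blast
  from b obtain Tb where Tb: "pb ?D (\<lambda>p. m (fst p)) Tb" "\<And>n. \<exists>Q e. realizes ?D ?b Tb n Q e"
    by (rule ptE) blast
  then obtain k where k: "\<And>p. p \<in> ?D \<Longrightarrow> Tb p \<le> (m (fst p) + sz p + 2) ^ k" unfolding pb_def by blast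
  define B where "B = (\<lambda>s. (m s + Suc (sz s + Suc (sz (xs s) + A s)) + 2) ^ k)"
  have B: "Tb (s, x, foldl (b s) (i s) ys) \<le> B s" if "s \<in> D" "xs s = ys @ x # zs" for s x ys zs
  proof -
    have "sz x \<le> sz (xs s)" using that by simp
    moreover have "sz (foldl (b s) (i s) ys) \<le> A s" using sz that by blast
    ultimately have "(m s + sz (s, x, foldl (b s) (i s) ys) + 2) ^ k \<le> B s"
      unfolding B_def by (intro power_mono) auto
    moreover have "Tb (s, x, foldl (b s) (i s) ys) \<le> (m s + sz (s, x, foldl (b s) (i s) ys) + 2) ^ k"
      using k[of "(s, x, foldl (b s) (i s) ys)"] that by (auto simp: reach_def)
    ultimately show ?thesis by linarith
  qed
  have pbB: "pb D m B"
    unfolding B_def by (intro pb_power pb_add pb_Suc pb_const pb_measure pb_sz pt_sz[OF xs] A)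
  define T where "T = (\<lambda>s. T0 s + T1 s + (sz (xs s) * (B s + 20)) + 20)"
  show ?thesis
  proof (rule ptI[where T = T])
    show "pb D m T" unfolding T_def by (intro pb_add pb_mult pb_const pbB T0 T1 pt_sz[OF xs])
    show "pb D m (\<lambda>s. sz (foldl (b s) (i s) (xs s)))"
      by (rule pb_mono[OF A]) (use sz in force)
    fix n
    obtain Q0 e0 where 0: "realizes D xs T0 n Q0 e0" using T0 by blast
    obtain Q1 e1 where 1: "realizes D i T1 (n + length Q0) Q1 e1" using T1 by blast
    obtain Q2 e2 where 2: "realizes ?D ?b Tb (n + length Q0 + length Q1) Q2 e2" using Tb by blast
    let ?k = "n + length Q0 + length Q1 + length Q2"
    let ?arg = "MkCell (Var 2) (MkCell (Var 0) (Var 4))"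
    let ?loop = "Match (Var 1) (Var 2) (Call (Suc ?k) [Var 2, Var 1, Call ?k [?arg]])"
    let ?Q = "Q0 @ Q1 @ Q2 @ [e2, ?loop]"
    let ?e = "Call (Suc ?k) [Var 0, e0, e1]"
    have "realizes D (\<lambda>s. foldl (b s) (i s) (xs s)) T n ?Q ?e"
      unfolding realizes_def
    proof (intro allI impI)
      fix P R :: program and s assume *: "length P = n" "s \<in> D"
      let ?P = "P @ ?Q @ R"
      have k: "?k < length ?P" "?P ! ?k = e2" "Suc ?k < length ?P" "?P ! (Suc ?k) = ?loop"
        using * by (auto simp: nth_append)
      from realizesD[OF 0 *, of "Q1 @ Q2 @ [e2, ?loop] @ R"] obtain t0 where
        t0: "t0 \<le> T0 s" "eval ?P [enc s] e0 (enc (xs s)) t0" by auto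
      from realizesD[OF 1, of "P @ Q0" s "Q2 @ [e2, ?loop] @ R"] * obtain t1 where
        t1: "t1 \<le> T1 s" "eval ?P [enc s] e1 (enc (i s)) t1" by auto
      have loop: "\<exists>t\<le>length zs * (B s + 20) + 3.
          eval ?P [enc s, enc zs, enc (foldl (b s) (i s) ys)] ?loop (enc (foldl (b s) (i s) (xs s))) t"
        if "xs s = ys @ zs" for ys zs
        using that
      proof (induction zs arbitrary: ys)
        case Nil
        have "eval ?P [enc s, enc [], enc (foldl (b s) (i s) ys)] (Var 1) Nul 1"
          "eval ?P [enc s, enc [], enc (foldl (b s) (i s) ys)] (Var 2) (enc (foldl (b s) (i s) ys)) 1"
          by (auto intro!: eval_var)
        from eval_evals.match_nul[OF this] show ?case
          using Nil by (intro exI[of _ "Suc (1 + 1)"]) auto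
      next
        case (Cons z zs)
        let ?a = "foldl (b s) (i s) ys"
        have D: "(s, z, ?a) \<in> ?D" using * Cons.prems by (auto simp: reach_def)
        from realizesD[OF 2 _ D, of "P @ Q0 @ Q1" "[e2, ?loop] @ R"] *
        obtain t2 where t2: "t2 \<le> Tb (s, z, ?a)"
          "eval ?P [Cell (enc s) (Cell (enc z) (enc ?a))] e2 (enc (b s ?a z)) t2" by auto
        have t2': "t2 \<le> B s" using B[OF *(2) Cons.prems] t2(1) by simp
        let ?env = "[enc z, enc zs, enc s, Cell (enc z) (enc zs), enc ?a]"
        have "evals ?P ?env [?arg] [Cell (enc s) (Cell (enc z) (enc ?a))] (Suc (1 + Suc (1 + 1)) + 0)"
          by (intro eval_evals.cons eval_evals.mkcell eval_evals.nil eval_var) auto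
        from eval_evals.call[OF k(1) this, unfolded k(2), OF t2(2)]
        have c: "eval ?P ?env (Call ?k [?arg]) (enc (b s ?a z)) (t2 + 6)" by (simp add: add.commute)
        have "evals ?P ?env [Var 2, Var 1, Call ?k [?arg]] [enc s, enc zs, enc (b s ?a z)] (1 + (1 + (t2 + 6 + 0)))"
          by (intro eval_evals.cons c eval_evals.nil eval_var) auto
        note E = this
        from Cons.IH[of "ys @ [z]"] Cons.prems obtain t3 where
          "t3 \<le> length zs * (B s + 20) + 3"
          "eval ?P [enc s, enc zs, enc (b s ?a z)] ?loop (enc (foldl (b s) (i s) (xs s))) t3" by auto
        note t3 = this
        note l = eval_evals.call[OF k(3) E, unfolded k(4), OF t3(2)]
        have v: "eval ?P [enc s, enc (z # zs), enc ?a] (Var 1) (Cell (enc z) (enc zs)) 1"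
          by (intro eval_var) auto
        have l': "eval ?P (enc z # enc zs # [enc s, enc (z # zs), enc ?a]) (Call (Suc ?k) [Var 2, Var 1, Call ?k [?arg]])
            (enc (foldl (b s) (i s) (xs s))) (Suc (1 + (1 + (t2 + 6 + 0)) + t3))"
          using l by simp
        show ?case
          by (rule ex_eval_le, rule eval_evals.match_cell[OF v l']) (use t3 t2' in simp_all)
      qed
      from loop[of "[]" "xs s"] obtain t3 where t3: "t3 \<le> length (xs s) * (B s + 20) + 3"
        "eval ?P [enc s, enc (xs s), enc (i s)] ?loop (enc (foldl (b s) (i s) (xs s))) t3" by auto
      have "evals ?P [enc s] [Var 0, e0, e1] [enc s, enc (xs s), enc (i s)] (1 + (t0 + (t1 + 0)))"
        using t0 t1 by (intro eval_evals.cons eval_evals.nil eval_var) auto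
      from eval_evals.call[OF k(3) this, unfolded k(4), OF t3(2)]
      have E: "eval ?P [enc s] ?e (enc (foldl (b s) (i s) (xs s))) (Suc (1 + (t0 + (t1 + 0)) + t3))" .
      have "length (xs s) * (B s + 20) \<le> sz (xs s) * (B s + 20)"
        using length_le_sz by (intro mult_right_mono) auto
      then have "Suc (1 + (t0 + (t1 + 0)) + t3) \<le> T s"
        unfolding T_def using t0(1) t1(1) t3(1) by linarith
      with E show "\<exists>t\<le>T s. eval ?P [enc s] ?e (enc (foldl (b s) (i s) (xs s))) t" by blast
    qed
    then show "\<exists>Q e. realizes D (\<lambda>s. foldl (b s) (i s) (xs s)) T n Q e" by blast
  qed
qed

lemma poly_time_data_eq: "poly_time (\<lambda>p. fst p = (snd p :: data))"
proof (rule ptI[where T = "\<lambda>p. 40 * sz p + 40"])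
  show "pb UNIV (\<lambda>_. 0) (\<lambda>p::data\<times>data. sz (fst p = snd p))"
    by (rule pb_mono[OF pb_const[where c = 1]]) (rule sz_bool)
  show "pb UNIV (\<lambda>_. 0) (\<lambda>p::data\<times>data. 40 * sz p + 40)" by (intro pb_add pb_mult pb_const pb_sz)
  fix n
  let ?T = "MkCell MkNul MkNul"
  let ?body = "Match (Var 0) (Match (Var 1) ?T MkNul)
     (Match (Var 3) MkNul (Match (Call n [Var 2, Var 0]) MkNul (Call n [Var 5, Var 3])))"
  let ?e = "Match (Var 0) MkNul (Call n [Var 0, Var 1])"
  have "realizes UNIV (\<lambda>p. fst p = (snd p :: data)) (\<lambda>p. 40 * sz p + 40) n [?body] ?e"
    unfolding realizes_def
  proof (intro allI impI)
    fix P R :: program and s :: "data \<times> data" assume *: "length P = n"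
    let ?P = "P @ [?body] @ R"
    have n: "n < length ?P" "?P ! n = ?body" using * by auto
    have "\<exists>t\<le>40 * size x + 20. eval ?P [x, y] ?body (enc (x = y)) t" for x y
    proof (induction x arbitrary: y)
      case Nul
      have v: "eval ?P [Nul, y] (Var 0) Nul 1" by (auto intro!: eval_var)
      show ?case
      proof (cases y)
        case 1: Nul
        have "eval ?P [Nul, y] (Var 1) Nul 1" using 1 by (auto intro!: eval_var)
        note c = eval_evals.match_nul[OF this eval_evals.mkcell[OF eval_evals.mknul eval_evals.mknul]]
        show ?thesis
          by (rule ex_eval_le, rule eval_evals.match_nul[OF v c]) (auto simp: 1 enc_bool' enc_bool_def)
      next
        case 2: (Cell a b)
        have "eval ?P [Nul, y] (Var 1) (Cell a b) 1" using 2 by (auto intro!: eval_var)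
        note c = eval_evals.match_cell[OF this eval_evals.mknul]
        show ?thesis
          by (rule ex_eval_le, rule eval_evals.match_nul[OF v c]) (auto simp: 2 enc_bool' enc_bool_def)
      qed
    next
      case (Cell x1 x2)
      have v: "eval ?P [Cell x1 x2, y] (Var 0) (Cell x1 x2) 1" by (auto intro!: eval_var)
      let ?env = "[x1, x2, Cell x1 x2, y]"
      show ?case
      proof (cases y)
        case Nul
        have "eval ?P (x1 # x2 # [Cell x1 x2, y]) (Var 3) Nul 1" using Nul by (auto intro!: eval_var)
        note c = eval_evals.match_nul[OF this eval_evals.mknul]
        show ?thesis
          by (rule ex_eval_le, rule eval_evals.match_cell[OF v c]) (auto simp: Nul enc_bool' enc_bool_def)
      next
        case (Cell y1 y2)
        have v3: "eval ?P (x1 # x2 # [Cell x1 x2, y]) (Var 3) (Cell y1 y2) 1" using Cell by (auto intro!: eval_var)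
        let ?env2 = "[y1, y2, x1, x2, Cell x1 x2, y]"
        obtain t1 where t1: "t1 \<le> 40 * size x1 + 20" "eval ?P [x1, y1] ?body (enc (x1 = y1)) t1"
          using Cell.IH(1) by blast
        obtain t2 where t2: "t2 \<le> 40 * size x2 + 20" "eval ?P [x2, y2] ?body (enc (x2 = y2)) t2"
          using Cell.IH(2) by blast
        have "evals ?P ?env2 [Var 2, Var 0] [x1, y1] (1 + (1 + 0))"
          by (intro eval_evals.cons eval_evals.nil eval_var) auto
        from eval_evals.call[OF n(1) this, unfolded n(2), OF t1(2)]
        have c1: "eval ?P ?env2 (Call n [Var 2, Var 0]) (enc (x1 = y1)) (t1 + 3)" by (simp add: numeral_3_eq_3)
        have "\<exists>t \<le> t1 + t2 + 10. eval ?P ?env2 (Match (Call n [Var 2, Var 0]) MkNul (Call n [Var 5, Var 3]))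
          (enc (Cell x1 x2 = y)) t"
        proof (cases "x1 = y1")
          case True
          have "evals ?P (Nul # Nul # ?env2) [Var 5, Var 3] [x2, y2] (1 + (1 + 0))"
            by (intro eval_evals.cons eval_evals.nil eval_var) auto
          from eval_evals.call[OF n(1) this, unfolded n(2), OF t2(2)]
          have c2: "eval ?P (Nul # Nul # ?env2) (Call n [Var 5, Var 3]) (enc (x2 = y2)) (t2 + 3)"
            by (simp add: numeral_3_eq_3)
          have c3: "eval ?P ?env2 (Call n [Var 2, Var 0]) (Cell Nul Nul) (t1 + 3)"
            using c1 True by (simp add: enc_bool' enc_bool_def)
          show ?thesis
            by (rule ex_eval_le, rule eval_evals.match_cell[OF c3 c2]) (use True Cell in auto)
        next
          case False
          have c3: "eval ?P ?env2 (Call n [Var 2, Var 0]) Nul (t1 + 3)"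
            using c1 False by (simp add: enc_bool' enc_bool_def)
          show ?thesis
            by (rule ex_eval_le, rule eval_evals.match_nul[OF c3 eval_evals.mknul])
              (use False Cell in \<open>auto simp: enc_bool' enc_bool_def\<close>)
        qed
        then obtain t where t: "t \<le> t1 + t2 + 10" "eval ?P (y1 # y2 # ?env)
           (Match (Call n [Var 2, Var 0]) MkNul (Call n [Var 5, Var 3])) (enc (Cell x1 x2 = y)) t" by auto
        show ?thesis
          by (rule ex_eval_le, rule eval_evals.match_cell[OF v eval_evals.match_cell[OF v3 t(2)]])
            (use t t1 t2 in auto)
      qed
    qed
    from this[of "fst s" "snd s"] obtain t where
      t: "t \<le> 40 * size (fst s) + 20" "eval ?P [fst s, snd s] ?body (enc (fst s = snd s)) t" by blast
    have v: "eval ?P [enc s] (Var 0) (Cell (fst s) (snd s)) 1"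
      by (auto intro!: eval_var simp: enc_prod_def enc_data_def)
    have "evals ?P [fst s, snd s, enc s] [Var 0, Var 1] [fst s, snd s] (1 + (1 + 0))"
      by (intro eval_evals.cons eval_evals.nil eval_var) auto
    from eval_evals.call[OF n(1) this, unfolded n(2), OF t(2)]
    have c: "eval ?P (fst s # snd s # [enc s]) (Call n [Var 0, Var 1]) (enc (fst s = snd s)) (Suc (1 + (1 + 0) + t))" .
    show "\<exists>t\<le>40 * sz s + 40. eval ?P [enc s] ?e (enc (fst s = snd s)) t"
      by (rule ex_eval_le, rule eval_evals.match_cell[OF v c]) (use t in \<open>auto simp: sz_pair sz_def enc_data_def\<close>)
  qed
  then show "\<exists>Q e. realizes UNIV (\<lambda>p. fst p = (snd p::data)) (\<lambda>p. 40 * sz p + 40) n Q e" by blast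
qed

lemma pt_eq: assumes "pt D m f" "pt D m g" shows "pt D m (\<lambda>s. f s = g s)"
proof -
  have "pt D m (\<lambda>s. enc (f s))" "pt D m (\<lambda>s. enc (g s))"
    by (rule pt_coerce[OF assms(1)], simp add: enc_data_def)
       (rule pt_coerce[OF assms(2)], simp add: enc_data_def)
  from pt_app[OF poly_time_data_eq pt_Pair[OF this]] show ?thesis
    by (simp add: enc_eq_iff)
qed

lemma pt_program:
  assumes "pt D m f"
  shows "\<exists>P T. pb D m T \<and> (\<forall>s\<in>D. \<exists>t\<le>T s. computes_in P (enc s) (enc (f s)) t)"
proof -
  obtain T where T: "pb D m T" "\<And>n. \<exists>Q e. realizes D f T n Q e" using assms by (rule ptE) blast
  obtain Q e where Q: "realizes D f T 1 Q e" using T(2) by blast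
  have "\<exists>t\<le>T s. computes_in (e # Q) (enc s) (enc (f s)) t" if "s \<in> D" for s
    using realizesD[OF Q _ that, of "[e]" "[]"] by (auto simp: computes_in_def)
  with T(1) show ?thesis by blast
qed

declare One_nat_def [simp]

section \<open>Polynomial-time list and number functions\<close>

lemma pt_lift_fst: "pt D m f \<Longrightarrow> (\<And>p. p \<in> D' \<Longrightarrow> fst p \<in> D) \<Longrightarrow> pt D' (\<lambda>p. m (fst p)) (\<lambda>p. f (fst p))"
  by (rule pt_comp[OF pt_fst[OF pt_id]]) auto

lemma pt_if:
  assumes b: "pt D m b" and f: "pt {s\<in>D. b s} m f" and g: "pt {s\<in>D. \<not> b s} m g"
  shows "pt D m (\<lambda>s. if b s then f s else g s)"
proof -
  have "pt D m (\<lambda>s. if b s then [()] else [])"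
    by (rule pt_coerce[OF b]) (simp add: enc_bool' enc_bool_def)
  then have "pt D m (\<lambda>s. case (if b s then [()] else []) of [] \<Rightarrow> g s | y # ys \<Rightarrow> f s)"
    by (rule pt_case_list) (rule pt_subset[OF g], auto intro!: pt_lift_fst[OF f] split: if_splits)
  then show ?thesis by (rule pt_cong) auto
qed

lemma pt_if': "pt D m b \<Longrightarrow> pt D m f \<Longrightarrow> pt D m g \<Longrightarrow> pt D m (\<lambda>s. if b s then f s else g s)"
  by (rule pt_if) (auto intro: pt_subset)

lemma pt_not: "pt D m b \<Longrightarrow> pt D m (\<lambda>s. \<not> b s)"
  by (rule pt_cong[OF pt_if'[OF _ pt_const pt_const]]) auto

lemma pt_conj: "pt D m b \<Longrightarrow> pt {s\<in>D. b s} m c \<Longrightarrow> pt D m (\<lambda>s. b s \<and> c s)"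
  by (rule pt_cong[OF pt_if[OF _ _ pt_const]]) auto

lemma pt_conj': "pt D m b \<Longrightarrow> pt D m c \<Longrightarrow> pt D m (\<lambda>s. b s \<and> c s)"
  by (rule pt_conj) (auto intro: pt_subset)

lemma pt_disj: "pt D m b \<Longrightarrow> pt D m c \<Longrightarrow> pt D m (\<lambda>s. b s \<or> c s)"
  using pt_if'[OF _ pt_const[where c = True], of D m b c] by (rule pt_cong) auto

lemma pt_finite:
  assumes "finite A" "pt D m f" "\<And>s. s \<in> D \<Longrightarrow> f s \<in> A"
  shows "pt D m (\<lambda>s. g (f s))"
  using assms
proof (induction A arbitrary: D rule: finite_induct)
  case empty
  then have "D = {}" by auto
  then show ?case by (intro pt_cong[OF pt_const[of D m undefined]]) auto
next
  case (insert a A)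
  have "pt D m (\<lambda>s. if f s = a then g a else g (f s))"
    by (rule pt_if[OF pt_eq[OF insert.prems(1) pt_const] pt_const insert.IH])
       (use insert.prems in \<open>auto intro: pt_subset\<close>)
  then show ?case by (rule pt_cong) auto
qed

lemma pt_tl: assumes "pt D m xs" shows "pt D m (\<lambda>s. tl (xs s))"
  unfolding tl_def by (rule pt_case_list[OF assms pt_const pt_snd[OF pt_snd[OF pt_id]]])

definition hd_or :: "'a \<Rightarrow> 'a list \<Rightarrow> 'a" where
  "hd_or d xs = (case xs of [] \<Rightarrow> d | x # _ \<Rightarrow> x)"

lemma hd_or_simps [simp]: "hd_or d [] = d" "hd_or d (x # xs) = x"
  by (simp_all add: hd_or_def)

lemma pt_hd_or: assumes "pt D m d" "pt D m xs" shows "pt D m (\<lambda>s. hd_or (d s) (xs s))"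
  unfolding hd_or_def
  by (rule pt_case_list[OF assms(2) pt_subset[OF assms(1)] pt_fst[OF pt_snd[OF pt_id]]]) auto

lemma foldl_rev_append: "foldl (\<lambda>a x. x # a) ys xs = rev xs @ ys"
  by (induction xs arbitrary: ys) auto

lemma pt_rev_append:
  assumes xs: "pt D m xs" and ys: "pt D m ys" shows "pt D m (\<lambda>s. rev (xs s) @ ys s)"
proof -
  have "pt D m (\<lambda>s. foldl (\<lambda>a x. x # a) (ys s) (xs s))"
    by (rule pt_foldl[OF xs ys, where A = "\<lambda>s. sz (xs s) + sz (ys s)"])
      (auto intro!: pt_Cons pt_fst pt_snd pt_id pb_add pt_sz xs ys simp: foldl_rev_append)
  then show ?thesis by (simp add: foldl_rev_append)
qed

lemma pt_rev: "pt D m xs \<Longrightarrow> pt D m (\<lambda>s. rev (xs s))"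
  using pt_rev_append[OF _ pt_const[of D m "[]"]] by simp

lemma pt_append: "pt D m xs \<Longrightarrow> pt D m ys \<Longrightarrow> pt D m (\<lambda>s. xs s @ ys s)"
  using pt_rev_append[OF pt_rev] by fastforce

lemma foldl_Cons_map: "foldl (\<lambda>a x. h x # a) ys zs = rev (map h zs) @ ys"
  by (induction zs arbitrary: ys) auto

lemma pt_map:
  assumes xs: "pt D m xs"
    and g: "pt {p. fst p \<in> D \<and> snd p \<in> set (xs (fst p))} (\<lambda>p. m (fst p)) (\<lambda>p. g (fst p) (snd p))"
  shows "pt D m (\<lambda>s. map (g s) (xs s))"
proof -
  let ?D = "{p. fst p \<in> D \<and> snd p \<in> set (xs (fst p))}"
  obtain k where k: "\<And>p. p \<in> ?D \<Longrightarrow> sz (g (fst p) (snd p)) \<le> (m (fst p) + sz p + 2) ^ k"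
    using pt_sz[OF g] unfolding pb_def by blast
  define G where "G s = (m s + Suc (sz s + sz (xs s)) + 2) ^ k" for s
  have G: "sz (g s x) \<le> G s" if "s \<in> D" "x \<in> set (xs s)" for s x
  proof -
    have "sz (g s x) \<le> (m s + sz (s, x) + 2) ^ k" using k[of "(s, x)"] that by simp
    also have "\<dots> \<le> G s" unfolding G_def using sz_mem[OF that(2)] by (intro power_mono) auto
    finally show ?thesis .
  qed
  have "pt D m (\<lambda>s. foldl (\<lambda>a x. g s x # a) [] (xs s))"
  proof (rule pt_foldl[OF xs pt_const, where A = "\<lambda>s. sz (xs s) * Suc (G s)"])
    show "pb D m (\<lambda>s. sz (xs s) * Suc (G s))"
      unfolding G_def by (intro pb_mult pb_Suc pb_power pb_add pb_const pb_measure pb_sz pt_sz[OF xs])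
    show "pt (reach D xs (\<lambda>s. []) (\<lambda>s a x. g s x # a)) (\<lambda>p. m (fst p))
      (\<lambda>p. g (fst p) (fst (snd p)) # snd (snd p))"
    proof (rule pt_Cons)
      have "pt (reach D xs (\<lambda>s. []) (\<lambda>s a x. g s x # a)) (\<lambda>p. m (fst p))
        (\<lambda>p. (\<lambda>q. g (fst q) (snd q)) (fst p, fst (snd p)))"
        by (rule pt_comp[OF _ g]) (auto intro!: pt_Pair pt_fst pt_snd pt_id simp: reach_def)
      then show "pt (reach D xs (\<lambda>s. []) (\<lambda>s a x. g s x # a)) (\<lambda>p. m (fst p))
        (\<lambda>p. g (fst p) (fst (snd p)))" by simp
    qed (intro pt_snd pt_id)
    fix s ys zs assume *: "s \<in> D" "xs s = ys @ zs"
    have "sz (foldl (\<lambda>a x. g s x # a) [] ys) \<le> length ys * Suc (G s)"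
      unfolding foldl_Cons_map using sz_list_le[of "map (g s) ys" "G s"] G[OF *(1)] * by fastforce
    also have "\<dots> \<le> sz (xs s) * Suc (G s)"
      using length_le_sz[of "xs s"] * by (intro mult_right_mono) auto
    finally show "sz (foldl (\<lambda>a x. g s x # a) [] ys) \<le> sz (xs s) * Suc (G s)" .
  qed
  then have "pt D m (\<lambda>s. rev (map (g s) (xs s)))" by (simp add: foldl_Cons_map)
  from pt_rev[OF this] show ?thesis by simp
qed

lemma foldl_concat: "foldl (@) a xss = a @ concat xss"
  by (induction xss arbitrary: a) auto

lemma sz_concat: "sz (concat xss) \<le> sz xss"
  by (induction xss) auto

lemma pt_concat: assumes "pt D m xss" shows "pt D m (\<lambda>s. concat (xss s))"
proof -
  have "pt D m (\<lambda>s. foldl (@) [] (xss s))"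
  proof (rule pt_foldl[OF assms pt_const, where A = "\<lambda>s. sz (xss s)"])
    fix s ys zs assume "xss s = ys @ zs"
    then show "sz (foldl (@) [] ys) \<le> sz (xss s)"
      using sz_concat[of ys] by (simp add: foldl_concat)
  qed (intro pt_append pt_fst pt_snd pt_id pt_sz[OF assms])+
  then show ?thesis by (simp add: foldl_concat)
qed

lemma filter_conv_concat: "filter P xs = concat (map (\<lambda>x. if P x then [x] else []) xs)"
  by (induction xs) auto

lemma pt_filter:
  assumes xs: "pt D m xs"
    and g: "pt {p. fst p \<in> D \<and> snd p \<in> set (xs (fst p))} (\<lambda>p. m (fst p)) (\<lambda>p. g (fst p) (snd p))"
  shows "pt D m (\<lambda>s. filter (g s) (xs s))"
  unfolding filter_conv_concat
  by (intro pt_concat pt_map[OF xs] pt_if'[OF g] pt_Cons pt_const pt_snd pt_id)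

lemma pt_list_ex:
  assumes xs: "pt D m xs"
    and g: "pt {p. fst p \<in> D \<and> snd p \<in> set (xs (fst p))} (\<lambda>p. m (fst p)) (\<lambda>p. g (fst p) (snd p))"
  shows "pt D m (\<lambda>s. list_ex (g s) (xs s))"
proof -
  have "list_ex (g s) (xs s) \<longleftrightarrow> filter (g s) (xs s) \<noteq> []" for s
    by (auto simp: list_ex_iff filter_empty_conv)
  then show ?thesis using pt_not[OF pt_eq[OF pt_filter[OF xs g] pt_const[of _ _ "[]"]]] by simp
qed

lemma pt_member:
  assumes "pt D m x" "pt D m xs" shows "pt D m (\<lambda>s. x s \<in> set (xs s))"
proof -
  have "pt D m (\<lambda>s. list_ex (\<lambda>y. y = x s) (xs s))"
    by (intro pt_list_ex[OF assms(2)] pt_eq pt_snd pt_id pt_lift_fst[OF assms(1)]) auto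
  then show ?thesis by (simp add: list_ex_iff)
qed

definition dedup :: "'a list \<Rightarrow> 'a list" where
  "dedup xs = foldl (\<lambda>a x. if x \<in> set a then a else x # a) [] xs"

lemma dedup_snoc: "dedup (xs @ [x]) = (if x \<in> set (dedup xs) then dedup xs else x # dedup xs)"
  by (simp add: dedup_def)

lemma set_dedup [simp]: "set (dedup xs) = set xs"
  by (induction xs rule: rev_induct) (auto simp: dedup_snoc, simp add: dedup_def)

lemma distinct_dedup [simp]: "distinct (dedup xs)"
  by (induction xs rule: rev_induct) (auto simp: dedup_snoc, simp add: dedup_def)

lemma sz_dedup: "sz (dedup xs) \<le> sz xs"
  by (induction xs rule: rev_induct) (auto simp: dedup_snoc, simp add: dedup_def)

lemma pt_dedup: assumes "pt D m xs" shows "pt D m (\<lambda>s. dedup (xs s))"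
  unfolding dedup_def
proof (rule pt_foldl[OF assms pt_const, where A = "\<lambda>s. sz (xs s)"])
  fix s ys zs assume "xs s = ys @ zs"
  then show "sz (foldl (\<lambda>a x. if x \<in> set a then a else x # a) [] ys) \<le> sz (xs s)"
    using sz_dedup[of ys] by (simp add: dedup_def)
qed (intro pt_if' pt_member pt_Cons pt_fst pt_snd pt_id pt_sz[OF assms])+

lemma le_bit_length_iff: "bit_length n \<le> k \<longleftrightarrow> n < 2 ^ k"
proof (induction k arbitrary: n)
  case 0
  show ?case by (subst bit_length.simps) auto
next
  case (Suc k)
  show ?case using Suc[of "n div 2"] by (subst bit_length.simps) (auto simp: less_mult_imp_div_less mult.commute)
qed

lemma bit_length_mono: "m \<le> n \<Longrightarrow> bit_length m \<le> bit_length n"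
  using le_bit_length_iff[of m "bit_length n"] le_bit_length_iff[of n "bit_length n"] by simp

lemma less_power_bit_length: "n < 2 ^ bit_length n"
  using le_bit_length_iff[of n "bit_length n"] by simp

function bits :: "nat \<Rightarrow> bool list" where
  "bits n = (if n = 0 then [] else odd n # bits (n div 2))"
  by auto
termination by (relation "measure id") auto

declare bits.simps [simp del]

lemma bits_0 [simp]: "bits 0 = []" by (simp add: bits.simps)

lemma enc_bits: "enc (bits n) = enc n"
proof (induction n rule: less_induct)
  case (less n)
  then show ?case
    by (subst bits.simps) (subst enc_nat', subst enc_nat.simps, auto simp: enc_nat' enc_bool')
qed

lemma enc_0 [simp]: "enc (0::nat) = Nul" and sz_0 [simp]: "sz (0::nat) = 0"
  using enc_bits[of 0] by (simp_all add: sz_def)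

lemma length_bits: "length (bits n) = bit_length n"
proof (induction n rule: less_induct)
  case (less n)
  then show ?case by (subst bits.simps, subst bit_length.simps) auto
qed

lemma bit_length_le_sz: "bit_length n \<le> sz (n::nat)"
  using length_le_sz[of "bits n"] by (simp add: sz_def enc_bits length_bits)

lemma sz_nat_le: "sz (n::nat) \<le> 2 * bit_length n"
  using sz_list_le[of "bits n" 1, OF sz_bool] by (simp add: sz_def enc_bits length_bits)

lemma bit_length_le: "bit_length n \<le> n"
  by (simp add: le_bit_length_iff)

lemma sz_nat_le_self: "sz (n::nat) \<le> 2 * n"
  using sz_nat_le[of n] bit_length_le[of n] by linarith

lemma less_power_sz: "n < 2 ^ sz (n::nat)"
  using less_power_bit_length[of n] power_increasing[OF bit_length_le_sz[of n], of "2::nat"] by linarith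

lemma pt_bits: "pt D m f \<Longrightarrow> pt D m (\<lambda>s. bits (f s))"
  by (rule pt_coerce) (simp_all add: enc_bits)

lemma pt_div2: assumes "pt D m f" shows "pt D m (\<lambda>s. f s div 2 :: nat)"
proof (rule pt_coerce[OF pt_tl[OF pt_bits[OF assms]]])
  fix s
  show "enc (f s div 2) = enc (tl (bits (f s)))"
    by (subst bits.simps) (auto simp: enc_bits)
qed

lemma pt_odd: assumes "pt D m f" shows "pt D m (\<lambda>s. odd (f s :: nat))"
proof (rule pt_cong[OF pt_hd_or[OF pt_const[where c = False] pt_bits[OF assms]]])
  fix s
  show "odd (f s) = hd_or False (bits (f s))"
    by (subst bits.simps) auto
qed

definition app_bit :: "nat \<Rightarrow> bool \<Rightarrow> nat" where "app_bit n b = 2 * n + of_bool b"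

lemma bits_app_bit: "bits (app_bit n b) = (if n = 0 \<and> \<not> b then [] else b # bits n)"
  by (subst bits.simps) (auto simp: app_bit_def)

lemma pt_app_bit: assumes "pt D m f" "pt D m b" shows "pt D m (\<lambda>s. app_bit (f s) (b s))"
proof (rule pt_coerce)
  show "pt D m (\<lambda>s. if f s = 0 \<and> \<not> b s then [] else b s # bits (f s))"
    by (intro pt_if' pt_conj' pt_eq pt_const pt_not pt_Cons pt_bits assms)
  show "enc (app_bit (f s) (b s)) = enc (if f s = 0 \<and> \<not> b s then [] else b s # bits (f s))" for s
    unfolding bits_app_bit[symmetric] by (rule enc_bits[symmetric])
qed

lemma foldl_app_bit: "foldl app_bit v bs = v * 2 ^ length bs + foldl app_bit 0 bs"
proof (induction bs arbitrary: v)
  case (Cons b bs)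
  show ?case by (simp only: foldl.simps Cons[of "app_bit v b"] Cons[of "app_bit 0 b"])
      (simp add: app_bit_def algebra_simps)
qed simp

lemma foldl_app_bit_less: "foldl app_bit v bs < (v + 1) * 2 ^ length bs"
proof (induction bs arbitrary: v)
  case (Cons b bs)
  have "foldl app_bit v (b # bs) < (app_bit v b + 1) * 2 ^ length bs" using Cons by simp
  also have "\<dots> \<le> (2 * (v + 1)) * 2 ^ length bs" by (intro mult_right_mono) (auto simp: app_bit_def)
  finally show ?case by (simp add: algebra_simps)
qed simp

lemma pt_foldl_app_bit: assumes "pt D m v" "pt D m bs" shows "pt D m (\<lambda>s. foldl app_bit (v s) (bs s))"
proof (rule pt_foldl[OF assms(2,1), where A = "\<lambda>s. 2 * (sz (v s) + 1 + sz (bs s))"])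
  show "pb D m (\<lambda>s. 2 * (sz (v s) + 1 + sz (bs s)))"
    by (intro pb_mult pb_add pb_const pt_sz assms)
  fix s ys zs assume *: "bs s = ys @ zs"
  have "foldl app_bit (v s) ys < (v s + 1) * 2 ^ length ys" by (rule foldl_app_bit_less)
  also have "\<dots> \<le> 2 ^ (sz (v s)) * 2 ^ sz (bs s)"
    using less_power_sz[of "v s"] length_le_sz[of "bs s"] * by (intro mult_mono) auto
  also have "\<dots> \<le> 2 ^ (sz (v s) + 1 + sz (bs s))" by (simp add: power_add)
  finally have "bit_length (foldl app_bit (v s) ys) \<le> sz (v s) + 1 + sz (bs s)"
    using le_bit_length_iff by blast
  then show "sz (foldl app_bit (v s) ys) \<le> 2 * (sz (v s) + 1 + sz (bs s))"
    by (intro order_trans[OF sz_nat_le] mult_left_mono) auto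
qed (intro pt_app_bit pt_fst pt_snd pt_id)

text \<open>
  Binary addition: the state holds the remaining bits of the summands, the carry and the bits of
  the sum produced so far, most significant first.
\<close>

definition add_step :: "nat \<times> nat \<times> bool \<times> bool list \<Rightarrow> nat \<times> nat \<times> bool \<times> bool list" where
  "add_step q = (fst q div 2, fst (snd q) div 2,
     if odd (fst q) then odd (fst (snd q)) \<or> fst (snd (snd q)) else odd (fst (snd q)) \<and> fst (snd (snd q)),
     ((odd (fst q) = odd (fst (snd q))) = fst (snd (snd q))) # snd (snd (snd q)))"

definition add_val :: "nat \<times> nat \<times> bool \<times> bool list \<Rightarrow> nat" where
  "add_val q = (fst q + fst (snd q) + of_bool (fst (snd (snd q)))) * 2 ^ length (snd (snd (snd q)))
     + foldl app_bit 0 (snd (snd (snd q)))"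

lemma nat_bitE: obtains a' x where "(a::nat) = 2 * a' + of_bool x"
proof
  show "a = 2 * (a div 2) + of_bool (odd a)" by (simp add: odd_two_times_div_two_nat)
qed

lemma bit_div2 [simp]: "(2 * a + of_bool x) div 2 = (a::nat)" and odd_bit [simp]: "odd (2 * a + of_bool x) = x"
  by (cases x; simp)+

lemma app_bit_0: "app_bit 0 b = of_bool b"
  by (simp add: app_bit_def)

lemma add_val_step: "add_val (add_step q) = add_val q"
proof -
  obtain a b c out where q: "q = (a, b, c, out)" by (metis prod_cases4)
  obtain a' x where a: "a = 2 * a' + of_bool x" by (rule nat_bitE)
  obtain b' y where b: "b = 2 * b' + of_bool y" by (rule nat_bitE)
  show ?thesis
    unfolding q a b add_val_def add_step_def fst_conv snd_conv foldl.simps length_Cons power_Suc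
      bit_div2 odd_bit app_bit_0 foldl_app_bit[of "of_bool _"]
    by (cases x; cases y; cases c) (simp_all add: algebra_simps)
qed

lemma foldl_add_step:
  fixes u :: "'a list" and a b :: nat
  defines "r \<equiv> foldl (\<lambda>q _. add_step q) (a, b, False, []) u"
  shows "add_val r = a + b" "fst r = a div 2 ^ length u" "fst (snd r) = b div 2 ^ length u"
    "length (snd (snd (snd r))) = length u"
  unfolding r_def
proof (induction u rule: rev_induct)
  case Nil
  { case 1 show ?case by (simp add: add_val_def) next
    case 2 show ?case by simp next case 3 show ?case by simp next case 4 show ?case by simp }
next
  case (snoc x xs)
  { case 1 show ?case using snoc(1) by (simp add: add_val_step) next
    case 2 show ?case using snoc(2) by (simp add: add_step_def div_mult2_eq[symmetric] mult.commute) next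
    case 3 show ?case using snoc(3) by (simp add: add_step_def div_mult2_eq[symmetric] mult.commute) next
    case 4 show ?case using snoc(4) by (simp add: add_step_def) }
qed

lemma bits_fuel: "a div 2 ^ length (bits a @ bits b) = 0" "b div 2 ^ length (bits a @ bits b) = 0"
  using less_power_bit_length[of a] less_power_bit_length[of b]
  by (auto simp: length_bits power_add intro!: div_less)
    (metis less_le_trans mult_le_mono nat_mult_1_right nat_mult_1 one_le_numeral one_le_power order_refl)+

lemma pt_add: assumes f: "pt D m f" and g: "pt D m g" shows "pt D m (\<lambda>s. f s + g s :: nat)"
proof -
  define r where "r s = foldl (\<lambda>q _. add_step q) (f s, g s, False, []) (bits (f s) @ bits (g s))" for s
  have r: "pt D m r"
    unfolding r_def
  proof (rule pt_foldl[where A = "\<lambda>s. 10 * (sz (f s) + sz (g s)) + 10"])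
    show "pt D m (\<lambda>s. bits (f s) @ bits (g s))" by (intro pt_append pt_bits f g)
    show "pt D m (\<lambda>s. (f s, g s, False, []))" by (intro pt_Pair pt_const f g)
    show "pb D m (\<lambda>s. 10 * (sz (f s) + sz (g s)) + 10)"
      by (intro pb_add pb_mult pb_const pt_sz f g)
    fix s ys zs assume *: "bits (f s) @ bits (g s) = ys @ zs"
    let ?r = "foldl (\<lambda>q _. add_step q) (f s, g s, False, []) ys"
    have "length ys \<le> sz (f s) + sz (g s)"
      using arg_cong[OF *, of length] bit_length_le_sz[of "f s"] bit_length_le_sz[of "g s"]
      by (simp add: length_bits)
    moreover have "sz (fst ?r) \<le> 2 * sz (f s)" "sz (fst (snd ?r)) \<le> 2 * sz (g s)"
      using sz_nat_le[of "fst ?r"] bit_length_mono[of "fst ?r" "f s"] bit_length_le_sz[of "f s"]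
        sz_nat_le[of "fst (snd ?r)"] bit_length_mono[of "fst (snd ?r)" "g s"] bit_length_le_sz[of "g s"]
      by (simp_all add: foldl_add_step)
    moreover have "sz (snd (snd (snd ?r))) \<le> length ys * 2"
      using sz_list_le[of "snd (snd (snd ?r))" 1, OF sz_bool] foldl_add_step(4)[of "f s" "g s" ys] by simp
    moreover have "sz (fst (snd (snd ?r))) \<le> 1" by (rule sz_bool)
    ultimately show "sz ?r \<le> 10 * (sz (f s) + sz (g s)) + 10"
      by (simp add: sz_pair)
  qed (unfold add_step_def, intro pt_if' pt_conj' pt_disj pt_eq pt_Pair pt_Cons pt_odd pt_div2 pt_fst pt_snd pt_id)
  have "pt D m (\<lambda>s. foldl app_bit (app_bit 0 (fst (snd (snd (r s))))) (snd (snd (snd (r s)))))"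
    by (intro pt_foldl_app_bit pt_app_bit pt_fst pt_snd pt_const r)
  then show ?thesis
  proof (rule pt_cong)
    fix s
    have "fst (r s) = 0" "fst (snd (r s)) = 0" "add_val (r s) = f s + g s"
      unfolding r_def by (simp_all only: foldl_add_step bits_fuel)
    then show "f s + g s = foldl app_bit (app_bit 0 (fst (snd (snd (r s))))) (snd (snd (snd (r s))))"
      by (subst foldl_app_bit) (auto simp: add_val_def app_bit_def)
  qed
qed

definition less_step :: "nat \<times> nat \<times> bool \<Rightarrow> nat \<times> nat \<times> bool" where
  "less_step q = (fst q div 2, fst (snd q) div 2,
     if odd (fst q) = odd (fst (snd q)) then snd (snd q) else odd (fst (snd q)))"

definition less_val :: "nat \<times> nat \<times> bool \<Rightarrow> bool" where
  "less_val q \<longleftrightarrow> fst q < fst (snd q) \<or> fst q = fst (snd q) \<and> snd (snd q)"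

lemma less_val_step: "less_val (less_step q) = less_val q"
proof -
  obtain a b c where q: "q = (a, b, c)" by (metis prod_cases3)
  obtain a' x where a: "a = 2 * a' + of_bool x" by (rule nat_bitE)
  obtain b' y where b: "b = 2 * b' + of_bool y" by (rule nat_bitE)
  show ?thesis
    unfolding q a b less_val_def less_step_def fst_conv snd_conv bit_div2 odd_bit
    by (cases x; cases y; cases c; simp; arith)
qed

lemma foldl_less_step:
  fixes u :: "'a list" and a b :: nat
  defines "r \<equiv> foldl (\<lambda>q _. less_step q) (a, b, False) u"
  shows "less_val r = (a < b)" "fst r = a div 2 ^ length u" "fst (snd r) = b div 2 ^ length u"
  unfolding r_def
proof (induction u rule: rev_induct)
  case Nil
  { case 1 show ?case by (simp add: less_val_def) next
    case 2 show ?case by simp next case 3 show ?case by simp }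
next
  case (snoc x xs)
  { case 1 show ?case using snoc(1) by (simp add: less_val_step) next
    case 2 show ?case using snoc(2) by (simp add: less_step_def div_mult2_eq[symmetric] mult.commute) next
    case 3 show ?case using snoc(3) by (simp add: less_step_def div_mult2_eq[symmetric] mult.commute) }
qed

lemma pt_less: assumes f: "pt D m f" and g: "pt D m g" shows "pt D m (\<lambda>s. f s < (g s :: nat))"
proof -
  define r where "r s = foldl (\<lambda>q _. less_step q) (f s, g s, False) (bits (f s) @ bits (g s))" for s
  have r: "pt D m r"
    unfolding r_def
  proof (rule pt_foldl[where A = "\<lambda>s. 10 * (sz (f s) + sz (g s)) + 10"])
    show "pt D m (\<lambda>s. bits (f s) @ bits (g s))" by (intro pt_append pt_bits f g)
    show "pt D m (\<lambda>s. (f s, g s, False))" by (intro pt_Pair pt_const f g)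
    show "pb D m (\<lambda>s. 10 * (sz (f s) + sz (g s)) + 10)"
      by (intro pb_add pb_mult pb_const pt_sz f g)
    fix s ys zs assume *: "bits (f s) @ bits (g s) = ys @ zs"
    let ?r = "foldl (\<lambda>q _. less_step q) (f s, g s, False) ys"
    have "sz (fst ?r) \<le> 2 * sz (f s)" "sz (fst (snd ?r)) \<le> 2 * sz (g s)"
      using sz_nat_le[of "fst ?r"] bit_length_mono[of "fst ?r" "f s"] bit_length_le_sz[of "f s"]
        sz_nat_le[of "fst (snd ?r)"] bit_length_mono[of "fst (snd ?r)" "g s"] bit_length_le_sz[of "g s"]
      by (simp_all add: foldl_less_step)
    moreover have "sz (snd (snd ?r)) \<le> 1" by (rule sz_bool)
    ultimately show "sz ?r \<le> 10 * (sz (f s) + sz (g s)) + 10"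
      by (simp add: sz_pair)
  qed (unfold less_step_def, intro pt_if' pt_conj' pt_disj pt_eq pt_Pair pt_odd pt_div2 pt_fst pt_snd pt_id)
  from pt_snd[OF pt_snd[OF r]] show ?thesis
  proof (rule pt_cong)
    fix s
    have "fst (r s) = 0" "fst (snd (r s)) = 0" "less_val (r s) = (f s < g s)"
      unfolding r_def by (simp_all only: foldl_less_step bits_fuel)
    then show "(f s < g s) = snd (snd (r s))" by (auto simp: less_val_def)
  qed
qed

lemma foldl_mult:
  "foldl (\<lambda>a c. app_bit a False + (if c then b else 0)) 0 bs = b * foldl app_bit 0 bs"
  by (induction bs rule: rev_induct) (auto simp: app_bit_def algebra_simps)

lemma foldl_app_bit_bits: "foldl app_bit 0 (rev (bits a)) = a"
proof (induction a rule: less_induct)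
  case (less a)
  have "app_bit (a div 2) (odd a) = a" by (simp add: app_bit_def odd_two_times_div_two_nat)
  then show ?case
    using less[of "a div 2"] by (subst bits.simps) (cases "a = 0", simp_all)
qed

lemma pt_mult: assumes f: "pt D m f" and g: "pt D m g" shows "pt D m (\<lambda>s. f s * g s :: nat)"
proof -
  have "pt D m (\<lambda>s. foldl (\<lambda>a c. app_bit a False + (if c then g s else 0)) 0 (rev (bits (f s))))"
  proof (rule pt_foldl[where A = "\<lambda>s. 2 * (sz (g s) + sz (f s))"])
    show "pt D m (\<lambda>s. rev (bits (f s)))" by (intro pt_rev pt_bits f)
    show "pb D m (\<lambda>s. 2 * (sz (g s) + sz (f s)))" by (intro pb_add pb_mult pb_const pt_sz f g)
    fix s ys zs assume *: "s \<in> D" "rev (bits (f s)) = ys @ zs"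
    show "sz (foldl (\<lambda>a c. app_bit a False + (if c then g s else 0)) 0 ys) \<le> 2 * (sz (g s) + sz (f s))"
      unfolding foldl_mult
    proof (rule order_trans[OF sz_nat_le], rule mult_left_mono)
      have "g s * foldl app_bit 0 ys < 2 ^ sz (g s) * 2 ^ length ys"
        using less_power_sz[of "g s"] foldl_app_bit_less[of 0 ys] by (intro mult_strict_mono) auto
      also have "\<dots> \<le> 2 ^ sz (g s) * 2 ^ sz (f s)"
        using arg_cong[OF *(2), of length] bit_length_le_sz[of "f s"] by (simp add: length_bits)
      finally show "bit_length (g s * foldl app_bit 0 ys) \<le> sz (g s) + sz (f s)"
        by (simp add: le_bit_length_iff power_add)
    qed simp
  next
    show "pt D m (\<lambda>s. 0::nat)" by (rule pt_const)
  qed (intro pt_add pt_app_bit pt_if' pt_const pt_fst pt_snd pt_id pt_lift_fst[OF g], auto simp: reach_def)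
  then show ?thesis by (rule pt_cong) (simp add: foldl_mult foldl_app_bit_bits)
qed

lemma pt_Suc: "pt D m f \<Longrightarrow> pt D m (\<lambda>s. Suc (f s))"
  using pt_add[OF _ pt_const[of D m 1]] by simp

lemma sum_list_less: "sum_list ns < 2 ^ sz (ns :: nat list)"
proof (induction ns)
  case (Cons n ns)
  have "n + sum_list ns + 2 \<le> 2 ^ sz n + 2 ^ sz ns" using Cons less_power_sz[of n] by simp
  also have "\<dots> \<le> 2 ^ (sz n + sz ns) + 2 ^ (sz n + sz ns)"
    by (intro add_mono power_increasing) auto
  finally show ?case by simp
qed simp

lemma pt_sum_list: assumes "pt D m ns" shows "pt D m (\<lambda>s. sum_list (ns s) :: nat)"
proof -
  have f: "foldl (+) 0 ys = sum_list ys" for ys :: "nat list"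
    by (induction ys rule: rev_induct) auto
  have "pt D m (\<lambda>s. foldl (+) 0 (ns s))"
  proof (rule pt_foldl[OF assms pt_const, where A = "\<lambda>s. 2 * sz (ns s)"])
    show "pb D m (\<lambda>s. 2 * sz (ns s))" by (intro pb_mult pb_const pt_sz assms)
    fix s ys zs assume "ns s = ys @ zs"
    then have "sz ys \<le> sz (ns s)" by simp
    moreover have "bit_length (sum_list ys) \<le> sz ys" by (simp add: le_bit_length_iff sum_list_less)
    ultimately show "sz (foldl (+) 0 ys) \<le> 2 * sz (ns s)"
      using sz_nat_le[of "sum_list ys"] unfolding f by linarith
  qed (intro pt_add pt_fst pt_snd pt_id)
  then show ?thesis by (simp add: f)
qed

lemma pt_length: assumes "pt D m xs" shows "pt D m (\<lambda>s. length (xs s))"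
proof -
  have "pt D m (\<lambda>s. sum_list (map (\<lambda>_. 1::nat) (xs s)))"
    by (intro pt_sum_list pt_map[OF assms] pt_const)
  then show ?thesis by (rule pt_cong) (simp add: sum_list_triv)
qed

primrec index_from :: "nat \<Rightarrow> 'a list \<Rightarrow> (nat \<times> 'a) list" where
  "index_from n [] = []"
| "index_from n (x # xs) = (n, x) # index_from (Suc n) xs"

lemma map_Suc_index_from: "map (\<lambda>p. (Suc (fst p), snd p)) (index_from n xs) = index_from (Suc n) xs"
  by (induction xs arbitrary: n) auto

lemma sz_index_from: "sz (index_from n xs) \<le> length xs * (Suc (2 * (n + length xs))) + sz xs"
proof (induction xs arbitrary: n)
  case (Cons x xs)
  have "sz (index_from n (x # xs)) \<le> Suc (Suc (2 * n + sz x)) + sz (index_from (Suc n) xs)"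
    using sz_nat_le_self[of n] by simp
  then show ?case using Cons[of "Suc n"] by (simp add: algebra_simps)
qed simp

lemma pt_index_from: assumes "pt D m xs" shows "pt D m (\<lambda>s. index_from 0 (xs s))"
proof -
  let ?b = "\<lambda>a x. (0, x) # map (\<lambda>p. (Suc (fst p), snd p)) a"
  have f: "foldl ?b [] ys = index_from 0 (rev ys)" for ys :: "'c list"
    by (induction ys rule: rev_induct) (auto simp: map_Suc_index_from)
  have "pt D m (\<lambda>s. foldl ?b [] (rev (xs s)))"
  proof (rule pt_foldl[OF pt_rev[OF assms] pt_const,
        where A = "\<lambda>s. sz (xs s) * (Suc (2 * sz (xs s))) + sz (xs s)"])
    show "pb D m (\<lambda>s. sz (xs s) * (Suc (2 * sz (xs s))) + sz (xs s))"
      by (intro pb_add pb_mult pb_Suc pb_const pt_sz assms)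
    fix s ys zs assume "rev (xs s) = ys @ zs"
    then have "sz ys \<le> sz (xs s)" by (metis sz_append sz_rev le_add1)
    moreover have "length ys \<le> sz ys" by (rule length_le_sz)
    ultimately have "length ys * (Suc (2 * (0 + length ys))) + sz ys \<le> sz (xs s) * (Suc (2 * sz (xs s))) + sz (xs s)"
      by (intro add_mono mult_mono) auto
    then show "sz (foldl ?b [] ys) \<le> sz (xs s) * (Suc (2 * sz (xs s))) + sz (xs s)"
      using sz_index_from[of 0 "rev ys"] unfolding f by simp
  qed (intro pt_Cons pt_Pair pt_const pt_map pt_Suc pt_fst pt_snd pt_id)
  then show ?thesis by (rule pt_cong) (simp add: f)
qed

fun padzip :: "('a \<Rightarrow> 'a \<Rightarrow> 'a) \<Rightarrow> 'a list \<Rightarrow> 'a list \<Rightarrow> 'a list" where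
  "padzip f [] ys = ys"
| "padzip f xs [] = xs"
| "padzip f (x # xs) (y # ys) = f x y # padzip f xs ys"

lemma padzip_Nil2 [simp]: "padzip f xs [] = xs"
  by (cases xs) auto

lemma padzip_commute: "(\<And>a b. f a b = f b a) \<Longrightarrow> padzip f xs ys = padzip f ys xs"
  by (induction f xs ys rule: padzip.induct) auto

lemma padzip_assoc:
  "(\<And>a b c. f (f a b) c = f a (f b c)) \<Longrightarrow> padzip f (padzip f xs ys) zs = padzip f xs (padzip f ys zs)"
proof (induction f xs ys arbitrary: zs rule: padzip.induct)
  case (3 f x xs y ys)
  then show ?case by (cases zs) auto
qed auto

lemma padzip_foldl:
  "(\<lambda>r. rev (snd r) @ fst r) (foldl (\<lambda>a x. (tl (fst a), (if fst a = [] then x else f x (hd_or d (fst a))) # snd a)) (ys, zs) xs)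
     = rev zs @ padzip f xs ys"
proof (induction xs arbitrary: ys zs)
  case (Cons x xs)
  show ?case
    using Cons[of "tl ys" "(if ys = [] then x else f x (hd_or d ys)) # zs"] by (cases ys) auto
qed auto

lemma pt_padzip:
  assumes xs: "pt D m xs" and ys: "pt D m ys"
    and f: "pt {p. fst p \<in> D \<and> fst (snd p) \<in> set (xs (fst p)) \<and> snd (snd p) \<in> set (ys (fst p))}
        (\<lambda>p. m (fst p)) (\<lambda>p. f (fst p) (fst (snd p)) (snd (snd p)))"
    (is "pt ?Df _ _")
  shows "pt D m (\<lambda>s. padzip (f s) (xs s) (ys s))"
proof -
  let ?b = "\<lambda>s a x. (tl (fst a), (if fst a = [] then x else f s x (hd_or undefined (fst a))) # snd a)"
  obtain k where k: "\<And>p. p \<in> ?Df \<Longrightarrow> sz (f (fst p) (fst (snd p)) (snd (snd p))) \<le> (m (fst p) + sz p + 2) ^ k"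
    using pt_sz[OF f] unfolding pb_def by blast
  define G where "G s = (m s + Suc (sz s + Suc (sz (xs s) + sz (ys s))) + 2) ^ k + sz (xs s)" for s
  have G: "sz (f s x y) \<le> G s" if "s \<in> D" "x \<in> set (xs s)" "y \<in> set (ys s)" for s x y
  proof -
    have "sz (f s x y) \<le> (m s + sz (s, x, y) + 2) ^ k" using k[of "(s, x, y)"] that by simp
    also have "\<dots> \<le> (m s + Suc (sz s + Suc (sz (xs s) + sz (ys s))) + 2) ^ k"
      using sz_mem[OF that(2)] sz_mem[OF that(3)] by (intro power_mono) auto
    finally show ?thesis unfolding G_def by simp
  qed
  have inv: "\<exists>us. ys s = us @ fst (foldl (?b s) (ys s, []) ws) \<and>
      (\<forall>z\<in>set (snd (foldl (?b s) (ys s, []) ws)). sz z \<le> G s) \<and>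
      length (snd (foldl (?b s) (ys s, []) ws)) = length ws"
    if "s \<in> D" "set ws \<subseteq> set (xs s)" for s ws
    using that(2)
  proof (induction ws rule: rev_induct)
    case (snoc w ws)
    define r where "r = foldl (?b s) (ys s, []) ws"
    from snoc obtain us where us: "ys s = us @ fst r" "\<forall>z\<in>set (snd r). sz z \<le> G s" "length (snd r) = length ws"
      by (auto simp: r_def)
    have w: "w \<in> set (xs s)" using snoc.prems by auto
    then have w': "sz w \<le> G s" using sz_mem[OF w] by (simp add: G_def)
    have e: "foldl (?b s) (ys s, []) (ws @ [w]) = ?b s r w" by (simp add: r_def)
    have "\<exists>us. ys s = us @ fst (?b s r w) \<and> (\<forall>z\<in>set (snd (?b s r w)). sz z \<le> G s) \<and>
      length (snd (?b s r w)) = length (ws @ [w])"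
    proof (cases "fst r")
      case Nil
      then show ?thesis using us w' by auto
    next
      case (Cons y yr)
      then show ?thesis using us G[OF that(1) w, of y]
        by (auto intro!: exI[of _ "us @ [y]"])
    qed
    then show ?case by (simp only: e)
  qed simp
  have r: "pt D m (\<lambda>s. foldl (?b s) (ys s, []) (xs s))"
  proof (rule pt_foldl[OF xs, where A = "\<lambda>s. Suc (sz (ys s) + sz (xs s) * Suc (G s))"])
    show "pt D m (\<lambda>s. (ys s, []))" by (intro pt_Pair ys pt_const)
    show "pb D m (\<lambda>s. Suc (sz (ys s) + sz (xs s) * Suc (G s)))"
      unfolding G_def by (intro pb_Suc pb_add pb_mult pb_power pb_const pb_measure pb_sz pt_sz xs ys)
    show "pt (reach D xs (\<lambda>s. (ys s, [])) ?b) (\<lambda>p. m (fst p)) (\<lambda>p. ?b (fst p) (snd (snd p)) (fst (snd p)))"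
    proof (intro pt_Pair pt_tl pt_fst pt_snd pt_id pt_Cons pt_if pt_eq pt_const)
      let ?R = "{s \<in> reach D xs (\<lambda>s. (ys s, [])) ?b. fst (snd (snd s)) \<noteq> []}"
      have "pt ?R (\<lambda>p. m (fst p))
         (\<lambda>p. (\<lambda>q. f (fst q) (fst (snd q)) (snd (snd q))) (fst p, fst (snd p), hd_or undefined (fst (snd (snd p)))))"
      proof (rule pt_comp[OF _ f])
        fix p assume "p \<in> ?R"
        then obtain s w a ws zs where p: "p = (s, w, a)" "s \<in> D" "xs s = ws @ w # zs"
          "a = foldl (?b s) (ys s, []) ws" "fst a \<noteq> []" by (auto simp: reach_def)
        from inv[of s ws] p obtain us where "ys s = us @ fst a" by auto
        then show "(fst p, fst (snd p), hd_or undefined (fst (snd (snd p)))) \<in> ?Df"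
          using p by (cases "fst a") auto
      qed (auto intro!: pt_Pair pt_hd_or pt_fst pt_snd pt_const pt_id)
      then show "pt ?R (\<lambda>p. m (fst p))
         (\<lambda>p. f (fst p) (fst (snd p)) (hd_or undefined (fst (snd (snd p)))))" by simp
    qed
    fix s ws zs assume *: "s \<in> D" "xs s = ws @ zs"
    let ?r = "foldl (?b s) (ys s, []) ws"
    from inv[of s ws] * obtain us where us: "ys s = us @ fst ?r" "\<forall>z\<in>set (snd ?r). sz z \<le> G s"
      "length (snd ?r) = length ws" by auto
    have "sz (fst ?r) \<le> sz (ys s)" using arg_cong[OF us(1), of sz] by simp
    moreover have "sz (snd ?r) \<le> length ws * Suc (G s)"
      using sz_list_le[of "snd ?r" "G s"] us by simp
    moreover have "length ws * Suc (G s) \<le> sz (xs s) * Suc (G s)"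
      using length_le_sz[of "xs s"] * by (intro mult_right_mono) auto
    ultimately show "sz ?r \<le> Suc (sz (ys s) + sz (xs s) * Suc (G s))"
      by (simp add: sz_pair)
  qed
  show ?thesis
    by (rule pt_cong[OF pt_rev_append[OF pt_snd[OF r] pt_fst[OF r]]])
      (simp only: padzip_foldl[where d = undefined and zs = "[]", simplified])
qed

section \<open>Bucket elimination\<close>

lemma tl_padzip: "tl (padzip f xs ys) = padzip f (tl xs) (tl ys)"
  by (cases xs; cases ys) auto

lemma length_padzip [simp]: "length (padzip f xs ys) = max (length xs) (length ys)"
  by (induction f xs ys rule: padzip.induct) auto

lemma set_padzip:
  "set (padzip f xs ys) \<subseteq> set xs \<union> set ys \<union> {f x y | x y. x \<in> set xs \<and> y \<in> set ys}"
proof (induction f xs ys rule: padzip.induct)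
  case (3 f x xs y ys)
  then show ?case by simp blast
qed auto

type_synonym 'q key = "'q list \<times> nat list"
type_synonym 'q table = "('q key \<times> nat) list"

definition collect :: "('k \<times> nat) list \<Rightarrow> ('k \<times> nat) list" where
  "collect F = map (\<lambda>k. (k, sum_list (map snd (filter (\<lambda>a. fst a = k) F)))) (dedup (map fst F))"

definition weight :: "('k \<times> nat) list \<Rightarrow> ('k \<Rightarrow> nat) \<Rightarrow> nat" where
  "weight F h = sum_list (map (\<lambda>a. snd a * h (fst a)) F)"

lemma weight_simps [simp]: "weight [] h = 0" "weight (a # F) h = snd a * h (fst a) + weight F h"
  by (simp_all add: weight_def)

lemma weight_append [simp]: "weight (F @ G) h = weight F h + weight G h"
  by (simp add: weight_def)

lemma weight_cong: "(\<And>a. a \<in> set F \<Longrightarrow> h (fst a) = h' (fst a)) \<Longrightarrow> weight F h = weight F h'"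
  unfolding weight_def by (intro arg_cong[of _ _ sum_list] map_cong) auto

lemma weight_add: "weight F (\<lambda>k. h k + h' k) = weight F h + weight F h'"
  by (induction F) (auto simp: algebra_simps)

lemma weight_mult: "weight F (\<lambda>k. c * h k) = c * weight F h"
  by (induction F) (auto simp: algebra_simps)

lemma weight_0 [simp]: "weight F (\<lambda>k. 0) = 0"
  by (induction F) auto

lemma weight_swap: "weight F (\<lambda>k. weight G (h k)) = weight G (\<lambda>k'. weight F (\<lambda>k. h k k'))"
  by (induction G) (auto simp: weight_add weight_mult)

lemma weight_mono: "(\<And>a. a \<in> set F \<Longrightarrow> h (fst a) \<le> h' (fst a)) \<Longrightarrow> weight F h \<le> weight F h'"
proof (induction F)
  case (Cons a F)
  have "h (fst a) \<le> h' (fst a)" using Cons.prems by auto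
  moreover have "weight F h \<le> weight F h'" using Cons by auto
  ultimately show ?case by (auto intro!: add_mono mult_left_mono)
qed simp

lemma weight_by_key:
  assumes "finite S" "fst ` set F \<subseteq> S"
  shows "weight F h = (\<Sum>k\<in>S. sum_list (map snd (filter (\<lambda>a. fst a = k) F)) * h k)"
  using assms(2)
proof (induction F)
  case (Cons a F)
  have "(\<Sum>k\<in>S. sum_list (map snd (filter (\<lambda>b. fst b = k) (a # F))) * h k) =
    (\<Sum>k\<in>S. (if fst a = k then snd a * h k else 0) + sum_list (map snd (filter (\<lambda>b. fst b = k) F)) * h k)"
    by (intro sum.cong) (auto simp: algebra_simps)
  also have "\<dots> = snd a * h (fst a) + weight F h"
    using Cons assms(1) by (simp add: sum.distrib)
  finally show ?case by simp
qed simp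

lemma map_fst_collect: "map fst (collect F) = dedup (map fst F)"
  by (simp add: collect_def comp_def)

lemma fst_collect: "fst ` set (collect F) = fst ` set F"
proof -
  have "fst ` set (collect F) = set (map fst (collect F))" by simp
  also have "\<dots> = fst ` set F" unfolding map_fst_collect by simp
  finally show ?thesis .
qed

lemma weight_collect: "weight (collect F) h = weight F h"
proof -
  have "weight (collect F) h = (\<Sum>k\<in>set (dedup (map fst F)). sum_list (map snd (filter (\<lambda>a. fst a = k) F)) * h k)"
    unfolding weight_def collect_def map_map comp_def fst_conv snd_conv
    by (rule sum_list_distinct_conv_sum_set) simp
  also have "\<dots> = weight F h" by (rule weight_by_key[symmetric]) auto
  finally show ?thesis .
qed

definition elim_order :: "'v set set \<Rightarrow> 'v list \<Rightarrow> bool" where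
  "elim_order BB us \<longleftrightarrow> (\<forall>ps v vs. us = ps @ v # vs \<longrightarrow>
     (\<exists>Bv\<in>BB. \<forall>B\<in>BB. v \<in> B \<longrightarrow> B \<inter> set (v # vs) \<subseteq> Bv))"

lemma elim_orderD:
  assumes "elim_order BB (v # us)"
  obtains Bv where "Bv \<in> BB" "\<And>B. B \<in> BB \<Longrightarrow> v \<in> B \<Longrightarrow> B \<inter> set (v # us) \<subseteq> Bv"
proof -
  from assms[unfolded elim_order_def, rule_format, of "[]" v us]
  have "\<exists>Bv\<in>BB. \<forall>B\<in>BB. v \<in> B \<longrightarrow> B \<inter> set (v # us) \<subseteq> Bv" by simp
  then show thesis using that by blast
qed

lemma elim_order_append:
  assumes "elim_order BB (ps @ us)" shows "elim_order BB us"
  unfolding elim_order_def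
proof (intro allI impI)
  fix qs v vs assume "us = qs @ v # vs"
  then show "\<exists>Bv\<in>BB. \<forall>B\<in>BB. v \<in> B \<longrightarrow> B \<inter> set (v # vs) \<subseteq> Bv"
    using assms[unfolded elim_order_def, rule_format, of "ps @ qs" v vs] by simp
qed

lemma list_all2_filter_sum:
  "list_all2 R ws fs \<Longrightarrow> \<exists>us vs. list_all2 R us (filter P fs) \<and>
     list_all2 R vs (filter (\<lambda>F. \<not> P F) fs) \<and> sum_list us + sum_list vs = (sum_list ws :: nat)"
proof (induction rule: list_all2_induct)
  case (Cons w ws F fs)
  then obtain us vs where *: "list_all2 R us (filter P fs)" "list_all2 R vs (filter (\<lambda>F. \<not> P F) fs)"
    "sum_list us + sum_list vs = sum_list ws" by blast
  show ?case
  proof (cases "P F")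
    case True
    then show ?thesis using * Cons(1) by (intro exI[of _ "w # us"] exI[of _ vs]) simp
  next
    case False
    then show ?thesis using * Cons(1) by (intro exI[of _ us] exI[of _ "w # vs"]) simp
  qed
qed simp

locale elimination =
  fixes op :: "'q::encodable \<Rightarrow> 'q \<Rightarrow> 'q" and absent :: 'q and Q :: "'q set"
    and xc :: "'q \<Rightarrow> nat list" and r :: nat and C :: nat
  assumes op_assoc: "op (op x y) z = op x (op y z)"
    and op_commute: "op x y = op y x"
    and op_absent [simp]: "op absent x = x"
    and finite_Q: "finite Q" and absent_Q: "absent \<in> Q"
    and op_Q: "x \<in> Q \<Longrightarrow> y \<in> Q \<Longrightarrow> op x y \<in> Q"
    and xc_bound: "q \<in> Q \<Longrightarrow> length (xc q) \<le> r" "q \<in> Q \<Longrightarrow> n \<in> set (xc q) \<Longrightarrow> n \<le> 1"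
    and C_pos: "C > 0"
begin

lemma op_absent2 [simp]: "op x absent = x"
  using op_commute[of x absent] by simp

lemma hd_or_padzip: "hd_or absent (padzip op xs ys) = op (hd_or absent xs) (hd_or absent ys)"
  by (cases xs; cases ys) auto

definition comb :: "'q key \<Rightarrow> 'q key \<Rightarrow> 'q key" where
  "comb k k' = (padzip op (fst k) (fst k'), padzip (+) (snd k) (snd k'))"

lemma comb_assoc: "comb (comb a b) c = comb a (comb b c)"
  by (simp add: comb_def padzip_assoc op_assoc)

lemma comb_commute: "comb a b = comb b a"
  unfolding comb_def by (simp add: padzip_commute[of op] op_commute padzip_commute[of "(+)"] add.commute)

lemma comb_left_commute: "comb a (comb b c) = comb b (comb a c)"
  by (metis comb_assoc comb_commute)

lemma comb_Nil [simp]: "comb ([], []) a = a" "comb a ([], []) = a"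
  by (simp_all add: comb_def)

definition join :: "'q table \<Rightarrow> 'q table \<Rightarrow> 'q table" where
  "join F G = collect (concat (map (\<lambda>a. map (\<lambda>b. (comb (fst a) (fst b), snd a * snd b)) G) F))"

definition joins :: "'q table list \<Rightarrow> 'q table" where
  "joins fs = foldl join [(([], []), 1)] fs"

definition headof :: "'q key \<Rightarrow> 'q" where "headof k = hd_or absent (fst k)"

definition tail_key :: "'q key \<Rightarrow> 'q key" where "tail_key k = (tl (fst k), snd k)"

definition drop_key :: "'q key \<Rightarrow> 'q key" where
  "drop_key k = (tl (fst k), padzip (+) (snd k) (xc (headof k)))"

definition forget :: "('q \<Rightarrow> bool) \<Rightarrow> 'q table \<Rightarrow> 'q table" where
  "forget g J = collect (map (\<lambda>a. (drop_key (fst a), snd a)) (filter (\<lambda>a. g (headof (fst a))) J))"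

definition uses :: "'q table \<Rightarrow> bool" where
  "uses F = list_ex (\<lambda>a. headof (fst a) \<noteq> absent) F"

definition shift :: "'q table \<Rightarrow> 'q table" where
  "shift F = collect (map (\<lambda>a. (tail_key (fst a), snd a)) F)"

definition step :: "('q \<Rightarrow> bool) \<Rightarrow> 'q table list \<Rightarrow> 'q table list" where
  "step g fs = forget g (joins (filter uses fs)) # map shift (filter (\<lambda>F. \<not> uses F) fs)"

definition elim :: "('v \<Rightarrow> 'q \<Rightarrow> bool) \<Rightarrow> 'q table list \<Rightarrow> 'v list \<Rightarrow> 'q table list" where
  "elim good fs us = foldl (\<lambda>fs v. step (good v) fs) fs us"

definition count :: "(nat list \<Rightarrow> bool) \<Rightarrow> 'q table \<Rightarrow> nat" where
  "count \<phi> J = sum_list (map snd (filter (\<lambda>a. \<phi> (snd (fst a))) J))"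

primrec val :: "'q table list \<Rightarrow> ('q key \<Rightarrow> nat) \<Rightarrow> nat" where
  "val [] h = h ([], [])"
| "val (F # fs) h = weight F (\<lambda>k. val fs (\<lambda>k'. h (comb k k')))"

lemma weight_join: "weight (join F G) h = weight F (\<lambda>k. weight G (\<lambda>k'. h (comb k k')))"
proof -
  have a: "weight (map (\<lambda>b. (comb (fst a) (fst b), snd a * snd b)) G) h
    = snd a * weight G (\<lambda>k'. h (comb (fst a) k'))" for a
    by (induction G) (auto simp: algebra_simps)
  show ?thesis unfolding join_def weight_collect by (induction F) (auto simp: a)
qed

lemma weight_joins: "weight (foldl join A fs) h = weight A (\<lambda>k. val fs (\<lambda>k'. h (comb k k')))"
  by (induction fs arbitrary: A) (auto simp: weight_join comb_assoc)

lemma val_joins: "val fs h = weight (joins fs) h"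
  by (simp add: joins_def weight_joins)

lemma val_weight_swap: "val fs (\<lambda>k. weight G (h k)) = weight G (\<lambda>k'. val fs (\<lambda>k. h k k'))"
  unfolding val_joins by (rule weight_swap)

lemma val_partition:
  "val fs h = val (filter P fs) (\<lambda>k. val (filter (\<lambda>F. \<not> P F) fs) (\<lambda>k'. h (comb k k')))"
proof (induction fs arbitrary: h)
  case (Cons F fs)
  show ?case
    by (auto simp: Cons comb_assoc val_weight_swap comb_left_commute)
qed simp

definition ext :: "('q \<Rightarrow> bool) \<Rightarrow> ('q key \<Rightarrow> nat) \<Rightarrow> 'q key \<Rightarrow> nat" where
  "ext g h k = (if g (headof k) then h (drop_key k) else 0)"

lemma weight_forget: "weight (forget g J) h = weight J (ext g h)"
  unfolding forget_def weight_collect by (induction J) (auto simp: ext_def)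

lemma weight_shift: "weight (shift F) h = weight F (\<lambda>k. h (tail_key k))"
  unfolding shift_def weight_collect by (induction F) auto

lemma headof_comb: "headof (comb k k') = op (headof k) (headof k')"
  by (simp add: headof_def comb_def hd_or_padzip)

lemma tail_key_comb: "tail_key (comb k k') = comb (tail_key k) (tail_key k')"
  by (simp add: tail_key_def comb_def tl_padzip)

lemma drop_key_comb: "headof k' = absent \<Longrightarrow> drop_key (comb k k') = comb (drop_key k) (tail_key k')"
proof -
  assume "headof k' = absent"
  then have "headof (comb k k') = headof k" by (simp add: headof_comb)
  then show ?thesis
    unfolding drop_key_def tail_key_def
    by (simp add: comb_def tl_padzip padzip_assoc padzip_commute[of "(+)" "snd k'"] add.commute)
qed

lemma val_shift:
  assumes "\<forall>F\<in>set fs. \<not> uses F" "\<And>k. headof k = absent \<Longrightarrow> h k = h' (tail_key k)"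
  shows "val fs h = val (map shift fs) h'"
  using assms
proof (induction fs arbitrary: h h')
  case Nil
  then show ?case by (simp add: headof_def tail_key_def)
next
  case (Cons F fs)
  show ?case
    unfolding list.map val.simps weight_shift
  proof (rule weight_cong)
    fix a assume "a \<in> set F"
    then have a: "headof (fst a) = absent" using Cons.prems(1) by (auto simp: uses_def list_ex_iff)
    show "val fs (\<lambda>k'. h (comb (fst a) k')) = val (map shift fs) (\<lambda>k'. h' (comb (tail_key (fst a)) k'))"
      by (rule Cons.IH) (use Cons.prems a in \<open>auto simp: headof_comb tail_key_comb\<close>)
  qed
qed

lemma val_step: "val (step g fs) h = val fs (ext g h)"
proof -
  let ?A = "filter uses fs" and ?B = "filter (\<lambda>F. \<not> uses F) fs"
  have "val ?B (\<lambda>k'. ext g h (comb k k')) =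
      ext g (\<lambda>k. val (map shift ?B) (\<lambda>k'. h (comb k k'))) k" for k
  proof (cases "g (headof k)")
    case True
    then show ?thesis
      by (simp add: ext_def) (rule val_shift, auto simp: headof_comb drop_key_comb ext_def)
  next
    case False
    have "val ?B (\<lambda>k'. ext g h (comb k k')) = val (map shift ?B) (\<lambda>_. 0)"
      by (rule val_shift) (use False in \<open>auto simp: headof_comb ext_def\<close>)
    then show ?thesis using False by (simp add: ext_def val_joins)
  qed
  then have "val fs (ext g h) = val ?A (ext g (\<lambda>k. val (map shift ?B) (\<lambda>k'. h (comb k k'))))"
    by (subst val_partition[where P = uses]) simp
  then show ?thesis by (simp add: step_def weight_forget val_joins[of ?A])
qed

primrec accept :: "('v \<Rightarrow> 'q \<Rightarrow> bool) \<Rightarrow> (nat list \<Rightarrow> bool) \<Rightarrow> 'v list \<Rightarrow> 'q key \<Rightarrow> nat" where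
  "accept good \<phi> [] k = of_bool (\<phi> (snd k))"
| "accept good \<phi> (v # us) k = ext (good v) (accept good \<phi> us) k"

lemma val_elim: "val (elim good fs us) (accept good \<phi> []) = val fs (accept good \<phi> us)"
proof (induction us arbitrary: fs)
  case (Cons v us)
  show ?case using Cons[of "step (good v) fs"] val_step[of "good v" fs "accept good \<phi> us"]
    by (simp add: elim_def fun_eq_iff[symmetric])
qed (simp add: elim_def)

lemma count_joins: "count \<phi> (joins fs) = val fs (accept good \<phi> [])"
proof -
  have "sum_list (map snd (filter (\<lambda>a. \<phi> (snd (fst a))) J)) = weight J (\<lambda>k. of_bool (\<phi> (snd k)))" for J :: "'q table"
    by (induction J) auto
  then show ?thesis unfolding val_joins count_def by (simp cong: weight_cong)
qed

theorem count_elim: "count \<phi> (joins (elim good fs us)) = val fs (accept good \<phi> us)"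
  unfolding count_joins[where good = good] by (rule val_elim)

lemma val_choices:
  "val (map (\<lambda>i. map (\<lambda>x. (ent i x, 1)) (ch i)) is) h =
     sum_list (map (\<lambda>xs. h (foldr comb (map2 ent is xs) ([], []))) (product_lists (map ch is)))"
proof (induction "is" arbitrary: h)
  case (Cons i "is")
  let ?c = "\<lambda>xs. foldr comb (map2 ent is xs) ([], [])"
  have 1: "weight (map (\<lambda>x. (ent i x, 1)) xs) h' = sum_list (map (\<lambda>x. h' (ent i x)) xs)" for xs h'
    by (induction xs) auto
  have 2: "sum_list (map h' (concat (map (\<lambda>x. map (Cons x) yss) xs))) =
    sum_list (map (\<lambda>x. sum_list (map (\<lambda>ys. h' (x # ys)) yss)) xs)" for h' :: "'c list \<Rightarrow> nat" and yss xs
    by (induction xs) (auto simp: comp_def)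
  show ?case by (simp only: list.map val.simps 1 Cons product_lists.simps 2) simp
qed simp


subsection \<open>Table sizes\<close>

primrec keys :: "'v list \<Rightarrow> 'v set \<Rightarrow> 'q list set" where
  "keys [] B = {[]}"
| "keys (u # us) B = insert [] {q # ks | q ks. q \<in> Q \<and> ks \<in> keys us B \<and> (q \<noteq> absent \<longrightarrow> u \<in> B)}"

lemma Nil_keys [simp]: "[] \<in> keys us B"
  by (cases us) auto

lemma keys_mono: "B \<inter> set us \<subseteq> B' \<Longrightarrow> keys us B \<subseteq> keys us B'"
proof (induction us)
  case (Cons u us)
  then have "keys us B \<subseteq> keys us B'" by auto
  with Cons.prems show ?case by auto
qed simp

lemma keys_padzip: "ks \<in> keys us B \<Longrightarrow> ks' \<in> keys us B \<Longrightarrow> padzip op ks ks' \<in> keys us B"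
proof (induction us arbitrary: ks ks')
  case (Cons u us)
  then show ?case by (auto simp: op_Q)
qed simp

lemma keys_tl: "ks \<in> keys (u # us) B \<Longrightarrow> tl ks \<in> keys us B"
  by auto

lemma keys_hd: "ks \<in> keys (u # us) B \<Longrightarrow> hd_or absent ks \<in> Q \<and> (hd_or absent ks \<noteq> absent \<longrightarrow> u \<in> B)"
  using absent_Q by auto

lemma keys_set: "ks \<in> keys us B \<Longrightarrow> set ks \<subseteq> Q \<and> length ks \<le> length us"
proof (induction us arbitrary: ks)
  case (Cons u us)
  then show ?case using absent_Q by fastforce
qed simp

lemma card_Q_pos: "card Q > 0"
  using finite_Q absent_Q card_gt_0_iff by blast

lemma card_keys:
  "finite B \<Longrightarrow> distinct us \<Longrightarrow> finite (keys us B) \<and> card (keys us B) \<le> (length us + 1) * card Q ^ card (B \<inter> set us)"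
proof (induction us)
  case (Cons u us)
  define S where "S = (if u \<in> B then Q else {absent})"
  have fin: "finite S" "finite (keys us B)" using Cons finite_Q by (auto simp: S_def)
  have k: "keys (u # us) B = insert [] ((\<lambda>(q, ks). q # ks) ` (S \<times> keys us B))"
    using absent_Q by (auto simp: S_def split: if_splits)
  have "card ((\<lambda>(q, ks). q # ks) ` (S \<times> keys us B)) = card S * card (keys us B)"
    by (subst card_image) (auto simp: inj_on_def card_cartesian_product)
  then have "card (keys (u # us) B) \<le> Suc (card S * card (keys us B))"
    unfolding k using card_insert_le_m1 fin by (simp add: card_insert_if)
  also have "\<dots> \<le> Suc (card S * ((length us + 1) * card Q ^ card (B \<inter> set us)))"
    using Cons by simp
  also have "card S * ((length us + 1) * card Q ^ card (B \<inter> set us)) = (length us + 1) * card Q ^ card (B \<inter> set (u # us))"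
    using Cons.prems by (auto simp: S_def card_insert_if algebra_simps)
  also have "Suc ((length us + 1) * card Q ^ card (B \<inter> set (u # us))) \<le>
     (length (u # us) + 1) * card Q ^ card (B \<inter> set (u # us))"
    using card_Q_pos by simp
  finally show ?case using k fin by simp
qed simp

definition tab_ok :: "'v list \<Rightarrow> 'v set \<Rightarrow> nat \<Rightarrow> 'q table \<Rightarrow> bool" where
  "tab_ok us B w F \<longleftrightarrow> distinct (map fst F) \<and> weight F (\<lambda>_. 1) \<le> C ^ w \<and>
     (\<forall>k\<in>fst ` set F. fst k \<in> keys us B \<and> length (snd k) \<le> r \<and> (\<forall>n\<in>set (snd k). n \<le> 2 * w))"

lemma tab_ok_mono: "tab_ok us B w F \<Longrightarrow> B \<inter> set us \<subseteq> B' \<Longrightarrow> tab_ok us B' w F"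
  unfolding tab_ok_def using keys_mono by blast

lemma tab_ok_collect:
  assumes "weight F (\<lambda>_. 1) \<le> C ^ w"
    "\<And>a. a \<in> set F \<Longrightarrow> fst (fst a) \<in> keys us B \<and> length (snd (fst a)) \<le> r \<and> (\<forall>n\<in>set (snd (fst a)). n \<le> 2 * w)"
  shows "tab_ok us B w (collect F)"
  unfolding tab_ok_def weight_collect fst_collect map_fst_collect using assms by auto

lemma tab_ok_unit: "tab_ok us B 0 [(([], []), 1)]"
  by (simp add: tab_ok_def)

lemma padzip_add_bound:
  "\<forall>n\<in>set xs. n \<le> a \<Longrightarrow> \<forall>n\<in>set ys. n \<le> b \<Longrightarrow> n \<in> set (padzip (+) xs ys) \<Longrightarrow> n \<le> a + (b::nat)"
  using set_padzip[of "(+)" xs ys] by (fastforce intro: add_mono)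

lemma tab_ok_join:
  assumes F: "tab_ok us B w F" and G: "tab_ok us B w' G"
  shows "tab_ok us B (w + w') (join F G)"
  unfolding join_def
proof (rule tab_ok_collect)
  have "weight (join F G) (\<lambda>_. 1) = weight F (\<lambda>_. 1) * weight G (\<lambda>_. 1)"
    unfolding weight_join using weight_mult[of F "weight G (\<lambda>_. 1)" "\<lambda>_. 1"] by (simp add: mult.commute)
  also have "\<dots> \<le> C ^ (w + w')"
    using F G unfolding tab_ok_def power_add by (intro mult_le_mono) auto
  finally show "weight (concat (map (\<lambda>a. map (\<lambda>b. (comb (fst a) (fst b), snd a * snd b)) G) F)) (\<lambda>_. 1) \<le> C ^ (w + w')"
    unfolding join_def weight_collect .
  fix x assume "x \<in> set (concat (map (\<lambda>a. map (\<lambda>b. (comb (fst a) (fst b), snd a * snd b)) G) F))"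
  then obtain a b where "a \<in> set F" "b \<in> set G" and x: "fst x = comb (fst a) (fst b)" by auto
  then have a: "fst (fst a) \<in> keys us B" "length (snd (fst a)) \<le> r" "\<forall>n\<in>set (snd (fst a)). n \<le> 2 * w"
    and b: "fst (fst b) \<in> keys us B" "length (snd (fst b)) \<le> r" "\<forall>n\<in>set (snd (fst b)). n \<le> 2 * w'"
    using F G unfolding tab_ok_def by auto
  show "fst (fst x) \<in> keys us B \<and> length (snd (fst x)) \<le> r \<and> (\<forall>n\<in>set (snd (fst x)). n \<le> 2 * (w + w'))"
    using padzip_add_bound[OF a(3) b(3)] a b unfolding x comb_def by (auto intro: keys_padzip)
qed

lemma tab_ok_joins:
  assumes "list_all2 (tab_ok us B) ws fs"
  shows "tab_ok us B (sum_list ws) (joins fs)"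
proof -
  have "list_all2 (tab_ok us B) ws fs \<Longrightarrow> tab_ok us B w A \<Longrightarrow> tab_ok us B (w + sum_list ws) (foldl join A fs)" for w A
  proof (induction arbitrary: w A rule: list_all2_induct)
    case (Cons w' ws F fs)
    then show ?case using Cons.IH[OF tab_ok_join[OF Cons.prems Cons.hyps(1)]] by (simp add: add.assoc)
  qed simp
  from this[OF assms tab_ok_unit] show ?thesis
    unfolding joins_def by simp
qed

lemma tab_ok_forget:
  assumes "tab_ok (v # us) B w J" shows "tab_ok us B (w + 1) (forget g J)"
  unfolding forget_def
proof (rule tab_ok_collect)
  have "weight (forget g J) (\<lambda>_. 1) \<le> weight J (\<lambda>_. 1)"
    unfolding weight_forget by (rule weight_mono) (simp add: ext_def)
  also have "\<dots> \<le> C ^ w" using assms by (simp add: tab_ok_def)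
  also have "\<dots> \<le> C ^ w * C" using C_pos by simp
  finally show "weight (map (\<lambda>a. (drop_key (fst a), snd a)) (filter (\<lambda>a. g (headof (fst a))) J)) (\<lambda>_. 1) \<le> C ^ (w + 1)"
    unfolding forget_def weight_collect power_add power_one_right .
  fix x assume "x \<in> set (map (\<lambda>a. (drop_key (fst a), snd a)) (filter (\<lambda>a. g (headof (fst a))) J))"
  then obtain a where "a \<in> set J" and x: "fst x = drop_key (fst a)" by auto
  then have a: "fst (fst a) \<in> keys (v # us) B" "length (snd (fst a)) \<le> r" "\<forall>n\<in>set (snd (fst a)). n \<le> 2 * w"
    using assms unfolding tab_ok_def by auto
  have h: "headof (fst a) \<in> Q" using keys_hd[OF a(1)] by (simp add: headof_def)
  have "\<forall>n\<in>set (xc (headof (fst a))). n \<le> 1" using xc_bound(2)[OF h] by blast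
  note n = padzip_add_bound[OF a(3) this]
  have "tl (fst (fst a)) \<in> keys us B" by (rule keys_tl[OF a(1)])
  then show "fst (fst x) \<in> keys us B \<and> length (snd (fst x)) \<le> r \<and> (\<forall>n\<in>set (snd (fst x)). n \<le> 2 * (w + 1))"
    using a(2) xc_bound(1)[OF h] unfolding x drop_key_def by (auto dest: n)
qed

lemma tab_ok_shift:
  assumes "tab_ok (v # us) B w F" shows "tab_ok us B w (shift F)"
  unfolding shift_def
proof (rule tab_ok_collect)
  have "weight (shift F) (\<lambda>_. 1) \<le> C ^ w"
    unfolding weight_shift using assms by (simp add: tab_ok_def)
  then show "weight (map (\<lambda>a. (tail_key (fst a), snd a)) F) (\<lambda>_. 1) \<le> C ^ w"
    unfolding shift_def weight_collect .
  fix x assume "x \<in> set (map (\<lambda>a. (tail_key (fst a), snd a)) F)"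
  then obtain a where "a \<in> set F" and x: "fst x = tail_key (fst a)" by auto
  then show "fst (fst x) \<in> keys us B \<and> length (snd (fst x)) \<le> r \<and> (\<forall>n\<in>set (snd (fst x)). n \<le> 2 * w)"
    using assms keys_tl[of "fst (fst a)" v us B] unfolding x tail_key_def tab_ok_def by auto
qed

lemma uses_bag: "tab_ok (v # us) B w F \<Longrightarrow> uses F \<Longrightarrow> v \<in> B"
proof -
  assume F: "tab_ok (v # us) B w F" and "uses F"
  then obtain a where a: "a \<in> set F" "headof (fst a) \<noteq> absent" by (auto simp: uses_def list_ex_iff)
  with F have "fst (fst a) \<in> keys (v # us) B" unfolding tab_ok_def by blast
  from keys_hd[OF this] a(2) show "v \<in> B" by (simp add: headof_def)
qed

definition Q_size :: nat where "Q_size = Max (sz ` Q)"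

definition table_size :: "nat \<Rightarrow> nat \<Rightarrow> nat \<Rightarrow> nat" where
  "table_size L K w = (L + 1) * K * (2 * w + 2) ^ r *
     Suc (Suc (Suc (L * Suc Q_size + r * Suc (4 * w)) + 2 * (C * w + 1)))"

lemma table_size_mono: "L \<le> L' \<Longrightarrow> K \<le> K' \<Longrightarrow> w \<le> w' \<Longrightarrow> table_size L K w \<le> table_size L' K' w'"
  unfolding table_size_def by (intro mult_le_mono add_mono power_mono) (auto intro!: add_mono mult_le_mono)

lemma sum_powers_le: "(\<Sum>i\<le>n. a ^ i) \<le> (a + 1) ^ n" for a :: nat
proof (induction n)
  case (Suc n)
  have "a ^ Suc n \<le> a * (a + 1) ^ n" unfolding power_Suc by (intro mult_left_mono power_mono) auto
  with Suc have "(\<Sum>i\<le>n. a ^ i) + a ^ Suc n \<le> (a + 1) ^ n + a * (a + 1) ^ n" by (rule add_mono)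
  then show ?case by simp
qed simp

lemma sz_table:
  assumes ok: "tab_ok us B w F" and B: "finite B" "distinct us"
  shows "sz F \<le> table_size (length us) (card Q ^ card B) w"
proof -
  let ?N = "{cs. set cs \<subseteq> {..2 * w} \<and> length cs \<le> r}"
  have "length F = card (fst ` set F)"
    using ok distinct_card[of "map fst F"] by (simp add: tab_ok_def)
  also have "fst ` set F \<subseteq> keys us B \<times> ?N"
    using ok unfolding tab_ok_def by (auto simp: prod_eq_iff)
  then have "card (fst ` set F) \<le> card (keys us B \<times> ?N)"
    using card_keys[OF B] by (intro card_mono) (auto intro: finite_lists_length_le)
  also have "\<dots> = card (keys us B) * card ?N" by (rule card_cartesian_product)
  also have "\<dots> \<le> ((length us + 1) * card Q ^ card B) * (2 * w + 2) ^ r"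
  proof (rule mult_le_mono)
    have "card Q ^ card (B \<inter> set us) \<le> card Q ^ card B"
      using card_Q_pos B by (intro power_increasing card_mono) auto
    then show "card (keys us B) \<le> (length us + 1) * card Q ^ card B"
      using card_keys[OF B] by (meson le_trans mult_le_mono2)
    show "card ?N \<le> (2 * w + 2) ^ r"
      using sum_powers_le[of "2 * w + 1" r] by (simp add: card_lists_length_le)
  qed
  finally have len: "length F \<le> ((length us + 1) * card Q ^ card B) * (2 * w + 2) ^ r" .
  have "sz a \<le> Suc (Suc (length us * Suc Q_size + r * Suc (4 * w)) + 2 * (C * w + 1))" if a: "a \<in> set F" for a
  proof -
    have *: "fst (fst a) \<in> keys us B" "length (snd (fst a)) \<le> r" "\<forall>n\<in>set (snd (fst a)). n \<le> 2 * w"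
      using ok a unfolding tab_ok_def by auto
    have "sz (fst (fst a)) \<le> length (fst (fst a)) * Suc Q_size"
      using keys_set[OF *(1)] finite_Q by (intro sz_list_le) (auto simp: Q_size_def)
    also have "\<dots> \<le> length us * Suc Q_size" using keys_set[OF *(1)] by (intro mult_right_mono) auto
    finally have 1: "sz (fst (fst a)) \<le> length us * Suc Q_size" .
    have "sz (snd (fst a)) \<le> length (snd (fst a)) * Suc (4 * w)"
      using *(3) order_trans[OF sz_nat_le_self] by (intro sz_list_le) fastforce
    also have "\<dots> \<le> r * Suc (4 * w)" using *(2) by (intro mult_right_mono) auto
    finally have 2: "sz (snd (fst a)) \<le> r * Suc (4 * w)" .
    have "snd a \<le> weight F (\<lambda>_. 1)" unfolding weight_def using a by (intro member_le_sum_list) auto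
    also have "\<dots> \<le> C ^ w" using ok by (simp add: tab_ok_def)
    also have "\<dots> \<le> (2 ^ C) ^ w" by (intro power_mono) (auto simp: less_imp_le)
    also have "\<dots> < 2 ^ (C * w + 1)" by (simp add: power_mult)
    finally have "bit_length (snd a) \<le> C * w + 1" by (simp only: le_bit_length_iff)
    then have 3: "sz (snd a) \<le> 2 * (C * w + 1)" by (intro order_trans[OF sz_nat_le] mult_left_mono) auto
    show ?thesis using 1 2 3 by (simp add: sz_pair)
  qed
  then have "sz F \<le> length F * Suc (Suc (Suc (length us * Suc Q_size + r * Suc (4 * w)) + 2 * (C * w + 1)))"
    by (rule sz_list_le)
  also have "\<dots> \<le> table_size (length us) (card Q ^ card B) w"
    unfolding table_size_def by (rule mult_right_mono[OF len]) simp
  finally show ?thesis .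
qed

text \<open>
  The multiplicities and cardinalities in a table are bounded in terms of a weight; the sum of the
  weights of the tables and the number of remaining vertices does not increase.
\<close>

definition state_ok :: "'v set set \<Rightarrow> 'v list \<Rightarrow> nat \<Rightarrow> 'q table list \<Rightarrow> bool" where
  "state_ok BB us N fs \<longleftrightarrow> length fs + length us \<le> N \<and>
     (\<exists>ws. list_all2 (\<lambda>w F. \<exists>B\<in>BB. tab_ok us B w F) ws fs \<and> sum_list ws + length us \<le> N)"

lemma tab_ok_bucket:
  assumes "list_all2 (\<lambda>w F. \<exists>B\<in>BB. tab_ok (v # us) B w F) ws (filter uses fs)"
    and "\<And>B. B \<in> BB \<Longrightarrow> v \<in> B \<Longrightarrow> B \<inter> set (v # us) \<subseteq> Bv"
  shows "list_all2 (tab_ok (v # us) Bv) ws (filter uses fs)"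
proof -
  have "tab_ok (v # us) Bv w F" if "B \<in> BB" "tab_ok (v # us) B w F" "F \<in> set (filter uses fs)" for B w F
  proof (rule tab_ok_mono[OF that(2)])
    have "uses F" using that(3) by simp
    from assms(2)[OF that(1) uses_bag[OF that(2) this]] show "B \<inter> set (v # us) \<subseteq> Bv" .
  qed
  note R = this
  show ?thesis
    unfolding list_all2_conv_all_nth
  proof (intro conjI allI impI)
    show "length ws = length (filter uses fs)" using assms(1) by (rule list_all2_lengthD)
    fix i assume i: "i < length ws"
    from list_all2_nthD[OF assms(1) i] obtain B where B: "B \<in> BB" "tab_ok (v # us) B (ws ! i) (filter uses fs ! i)"
      by blast
    have "i < length (filter uses fs)" using i list_all2_lengthD[OF assms(1)] by simp
    from R[OF B nth_mem[OF this]]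
    show "tab_ok (v # us) Bv (ws ! i) (filter uses fs ! i)" .
  qed
qed

lemma state_ok_step:
  assumes ok: "state_ok BB (v # us) N fs" and ord: "elim_order BB (v # us)"
  shows "state_ok BB us N (step g fs)"
proof -
  from ok obtain ws where ws: "list_all2 (\<lambda>w F. \<exists>B\<in>BB. tab_ok (v # us) B w F) ws fs"
    "sum_list ws + length (v # us) \<le> N" by (auto simp: state_ok_def)
  from ord obtain Bv where Bv: "Bv \<in> BB" "\<And>B. B \<in> BB \<Longrightarrow> v \<in> B \<Longrightarrow> B \<inter> set (v # us) \<subseteq> Bv"
    by (rule elim_orderD) blast
  obtain xs ys where xs: "list_all2 (\<lambda>w F. \<exists>B\<in>BB. tab_ok (v # us) B w F) xs (filter uses fs)"
    and ys: "list_all2 (\<lambda>w F. \<exists>B\<in>BB. tab_ok (v # us) B w F) ys (filter (\<lambda>F. \<not> uses F) fs)"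
    and sum: "sum_list xs + sum_list ys = sum_list ws"
    using list_all2_filter_sum[OF ws(1)] by blast
  have "tab_ok us Bv (sum_list xs + 1) (forget g (joins (filter uses fs)))"
    by (rule tab_ok_forget[OF tab_ok_joins[OF tab_ok_bucket[OF xs Bv(2)]]])
  moreover have "list_all2 (\<lambda>w F. \<exists>B\<in>BB. tab_ok us B w F) ys (map shift (filter (\<lambda>F. \<not> uses F) fs))"
    using ys unfolding list_all2_map2 by (rule list_all2_mono) (blast intro: tab_ok_shift)
  ultimately have "list_all2 (\<lambda>w F. \<exists>B\<in>BB. tab_ok us B w F) ((sum_list xs + 1) # ys) (step g fs)"
    using Bv(1) by (auto simp: step_def)
  moreover have "length (step g fs) + length us \<le> N"
    using length_filter_le[of "\<lambda>F. \<not> uses F" fs] ok by (simp add: step_def state_ok_def del: length_filter_le)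
  moreover have "sum_list ((sum_list xs + 1) # ys) + length us \<le> N" using ws(2) sum by simp
  ultimately show ?thesis unfolding state_ok_def by blast
qed

lemma state_ok_elim:
  "state_ok BB (ps @ us) N fs \<Longrightarrow> elim_order BB (ps @ us) \<Longrightarrow> state_ok BB us N (elim good fs ps)"
proof (induction ps arbitrary: fs)
  case (Cons v ps)
  then have "state_ok BB (ps @ us) N (step (good v) fs)" "elim_order BB (ps @ us)"
    using state_ok_step[of BB v "ps @ us" N fs] elim_order_append[of BB "[v]" "ps @ us"] by auto
  from Cons.IH[OF this] show ?case by (simp add: elim_def)
qed (simp add: elim_def)

lemma sz_state:
  assumes ok: "state_ok BB us N fs" and us: "distinct us" and BB: "\<And>B. B \<in> BB \<Longrightarrow> finite B \<and> card B \<le> b"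
  shows "sz fs \<le> N * Suc (table_size N (card Q ^ b) N)"
proof -
  from ok obtain ws where ws: "list_all2 (\<lambda>w F. \<exists>B\<in>BB. tab_ok us B w F) ws fs"
    "sum_list ws + length us \<le> N" and len: "length fs \<le> N" by (auto simp: state_ok_def)
  have "sz F \<le> table_size N (card Q ^ b) N" if F: "F \<in> set fs" for F
  proof -
    from F obtain i where i: "i < length fs" "F = fs ! i" by (auto simp: in_set_conv_nth)
    with ws(1) obtain B where B: "B \<in> BB" "tab_ok us B (ws ! i) F" "i < length ws"
      by (auto simp: list_all2_conv_all_nth)
    have "sz F \<le> table_size (length us) (card Q ^ card B) (ws ! i)"
      using sz_table[OF B(2) _ us] BB[OF B(1)] by blast
    also have "\<dots> \<le> table_size N (card Q ^ b) N"
      using ws(2) member_le_sum_list[of "ws ! i" ws] B(3) BB[OF B(1)] card_Q_pos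
      by (intro table_size_mono power_increasing) auto
    finally show ?thesis .
  qed
  then have "sz fs \<le> length fs * Suc (table_size N (card Q ^ b) N)" by (rule sz_list_le)
  also have "\<dots> \<le> N * Suc (table_size N (card Q ^ b) N)" using len by (rule mult_right_mono) simp
  finally show ?thesis .
qed

lemma state_ok_sets:
  assumes "state_ok BB us N fs" "F \<in> set fs" "a \<in> set F"
  shows "set (fst (fst a)) \<subseteq> Q"
proof -
  from assms(1) obtain ws where ws: "list_all2 (\<lambda>w F. \<exists>B\<in>BB. tab_ok us B w F) ws fs"
    unfolding state_ok_def by blast
  obtain i where "i < length fs" "F = fs ! i" using assms(2) by (auto simp: in_set_conv_nth)
  then obtain w B where "tab_ok us B w F"
    using list_all2_nthD2[OF ws] by blast
  then have "fst (fst a) \<in> keys us B" using assms(3) unfolding tab_ok_def by blast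
  then show ?thesis using keys_set by blast
qed

lemma sz_bucket:
  assumes ok: "state_ok BB (v # us) N fs" and us: "distinct (v # us)" and ord: "elim_order BB (v # us)"
    and BB: "\<And>B. B \<in> BB \<Longrightarrow> finite B \<and> card B \<le> b" and pre: "filter uses fs = ys @ zs"
  shows "sz (joins ys) \<le> table_size N (card Q ^ b) N" "a \<in> set (joins ys) \<Longrightarrow> set (fst (fst a)) \<subseteq> Q"
proof -
  from ok obtain ws where ws: "list_all2 (\<lambda>w F. \<exists>B\<in>BB. tab_ok (v # us) B w F) ws fs"
    "sum_list ws + length (v # us) \<le> N" by (auto simp: state_ok_def)
  from ord obtain Bv where Bv: "Bv \<in> BB" "\<And>B. B \<in> BB \<Longrightarrow> v \<in> B \<Longrightarrow> B \<inter> set (v # us) \<subseteq> Bv"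
    by (rule elim_orderD) blast
  obtain xs xs' where xs: "list_all2 (\<lambda>w F. \<exists>B\<in>BB. tab_ok (v # us) B w F) xs (filter uses fs)"
    and sum: "sum_list xs + sum_list xs' = sum_list ws"
    using list_all2_filter_sum[OF ws(1)] by blast
  from tab_ok_bucket[OF xs Bv(2)] obtain xs1 xs2 where x: "xs = xs1 @ xs2" "list_all2 (tab_ok (v # us) Bv) xs1 ys"
    unfolding pre by (auto simp: list_all2_append2)
  have ok': "tab_ok (v # us) Bv (sum_list xs1) (joins ys)" by (rule tab_ok_joins[OF x(2)])
  then show "a \<in> set (joins ys) \<Longrightarrow> set (fst (fst a)) \<subseteq> Q"
    using keys_set unfolding tab_ok_def by blast
  have "sz (joins ys) \<le> table_size (length (v # us)) (card Q ^ card Bv) (sum_list xs1)"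
    using sz_table[OF ok' _ us] BB[OF Bv(1)] by blast
  also have "\<dots> \<le> table_size N (card Q ^ b) N"
    using ws(2) sum x(1) BB[OF Bv(1)] card_Q_pos by (intro table_size_mono power_increasing) auto
  finally show "sz (joins ys) \<le> table_size N (card Q ^ b) N" .
qed

lemma sz_joins_final:
  assumes ok: "state_ok (BB :: 'v set set) [] N fs" and pre: "fs = ys @ zs"
  shows "sz (joins ys) \<le> table_size N 1 N" "a \<in> set (joins ys) \<Longrightarrow> set (fst (fst a)) \<subseteq> Q"
proof -
  from ok obtain ws where ws: "list_all2 (\<lambda>w F. \<exists>B\<in>BB. tab_ok [] B w F) ws fs" "sum_list ws \<le> N"
    by (auto simp: state_ok_def)
  have "list_all2 (tab_ok ([]::'v list) {}) ws fs"
    using ws(1) by (rule list_all2_mono) (use tab_ok_mono[of "[]::'v list" _ _ _ "{}"] in auto)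
  then obtain xs1 xs2 where x: "ws = xs1 @ xs2" "list_all2 (tab_ok ([]::'v list) {}) xs1 ys"
    unfolding pre by (auto simp: list_all2_append2)
  have ok': "tab_ok ([]::'v list) {} (sum_list xs1) (joins ys)" by (rule tab_ok_joins[OF x(2)])
  then show "a \<in> set (joins ys) \<Longrightarrow> set (fst (fst a)) \<subseteq> Q"
    using keys_set unfolding tab_ok_def by blast
  have "sz (joins ys) \<le> table_size (length ([]::'v list)) (card Q ^ card ({}::'v set)) (sum_list xs1)"
    by (rule sz_table[OF ok']) auto
  also have "\<dots> \<le> table_size N 1 N"
    using ws(2) x(1) by (intro table_size_mono) auto
  finally show "sz (joins ys) \<le> table_size N 1 N" .
qed

end

subsection \<open>Elimination in polynomial time\<close>

lemma pt_collect: assumes "pt D m F" shows "pt D m (\<lambda>s. collect (F s))"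
proof -
  have F': "pt D' (\<lambda>p. m (fst p)) (\<lambda>p. F (fst p))" if "\<And>p. p \<in> D' \<Longrightarrow> fst p \<in> D" for D'
    by (rule pt_lift_fst[OF assms that])
  show ?thesis
    unfolding collect_def
    by (intro pt_map pt_dedup assms pt_Pair pt_sum_list pt_filter pt_eq pt_fst pt_snd pt_id F') auto
qed

context elimination
begin

lemma pt_op:
  assumes "pt D m x" "pt D m y" "\<And>s. s \<in> D \<Longrightarrow> x s \<in> Q \<and> y s \<in> Q"
  shows "pt D m (\<lambda>s. op (x s) (y s))"
  using pt_finite[OF finite_cartesian_product[OF finite_Q finite_Q] pt_Pair[OF assms(1,2)],
      of "\<lambda>p. op (fst p) (snd p)"] assms(3) by simp

lemma pt_comb:
  assumes k: "pt D m k" and k': "pt D m k'"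
    and Q: "\<And>s. s \<in> D \<Longrightarrow> set (fst (k s)) \<subseteq> Q \<and> set (fst (k' s)) \<subseteq> Q"
  shows "pt D m (\<lambda>s. comb (k s) (k' s))"
  unfolding comb_def
  by (intro pt_Pair pt_padzip pt_fst[OF k] pt_fst[OF k'] pt_snd[OF k] pt_snd[OF k'] pt_op pt_add pt_fst pt_snd pt_id)
    (use Q in auto)

lemma pt_join:
  assumes F: "pt D m F" and G: "pt D m G"
    and Q: "\<And>s a. s \<in> D \<Longrightarrow> a \<in> set (F s) \<union> set (G s) \<Longrightarrow> set (fst (fst a)) \<subseteq> Q"
  shows "pt D m (\<lambda>s. join (F s) (G s))"
proof -
  have "\<forall>s\<in>D. \<forall>a\<in>set (F s). set (fst (fst a)) \<subseteq> Q" "\<forall>s\<in>D. \<forall>a\<in>set (G s). set (fst (fst a)) \<subseteq> Q"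
    using Q by blast+
  then show ?thesis
    unfolding join_def
    by (intro pt_collect pt_concat pt_map F pt_lift_fst[OF G] pt_Pair pt_comb pt_mult pt_fst pt_snd pt_id) (simp_all, blast)
qed

lemma pt_joins:
  assumes fs: "pt D m fs" and A: "pb D m A"
    and sz: "\<And>s ys zs. s \<in> D \<Longrightarrow> fs s = ys @ zs \<Longrightarrow> sz (joins ys) \<le> A s"
    and Q: "\<And>s ys zs a. s \<in> D \<Longrightarrow> fs s = ys @ zs \<Longrightarrow> a \<in> set (joins ys) \<Longrightarrow> set (fst (fst a)) \<subseteq> Q"
    and Q': "\<And>s F a. s \<in> D \<Longrightarrow> F \<in> set (fs s) \<Longrightarrow> a \<in> set F \<Longrightarrow> set (fst (fst a)) \<subseteq> Q"
  shows "pt D m (\<lambda>s. joins (fs s))"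
  unfolding joins_def
proof (rule pt_foldl[OF fs pt_const _ A])
  fix s ys zs assume "s \<in> D" "fs s = ys @ zs"
  then show "sz (foldl join [(([], []), 1)] ys) \<le> A s" using sz by (simp add: joins_def)
next
  show "pt (reach D fs (\<lambda>s. [(([], []), 1)]) (\<lambda>s. join)) (\<lambda>p. m (fst p))
     (\<lambda>p. join (snd (snd p)) (fst (snd p)))"
  proof (rule pt_join)
    fix p a assume p: "p \<in> reach D fs (\<lambda>s. [(([], []), 1)]) (\<lambda>s. join)"
      and a: "a \<in> set (snd (snd p)) \<union> set (fst (snd p))"
    from p obtain s F ys zs where "s \<in> D" "fs s = ys @ F # zs" "p = (s, F, joins ys)"
      by (auto simp: reach_def joins_def)
    then show "set (fst (fst a)) \<subseteq> Q" using a Q[of s ys "F # zs" a] Q'[of s F a] by auto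
  qed (intro pt_fst pt_snd pt_id)+
qed

lemma pt_headof: "pt D m k \<Longrightarrow> pt D m (\<lambda>s. headof (k s))"
  unfolding headof_def by (intro pt_hd_or pt_const pt_fst)

lemma headof_Q: "set (fst k) \<subseteq> Q \<Longrightarrow> headof k \<in> Q"
  unfolding headof_def using absent_Q by (cases "fst k") auto

lemma pt_tail_key: "pt D m k \<Longrightarrow> pt D m (\<lambda>s. tail_key (k s))"
  unfolding tail_key_def by (intro pt_Pair pt_tl pt_fst pt_snd)

lemma pt_drop_key:
  "pt D m k \<Longrightarrow> (\<And>s. s \<in> D \<Longrightarrow> set (fst (k s)) \<subseteq> Q) \<Longrightarrow> pt D m (\<lambda>s. drop_key (k s))"
  unfolding drop_key_def
  by (intro pt_Pair pt_tl pt_fst pt_snd pt_padzip pt_add pt_id pt_finite[OF finite_Q pt_headof, where g = xc])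
    (auto simp: headof_Q)

lemma pt_uses: "pt D m F \<Longrightarrow> pt D m (\<lambda>s. uses (F s))"
  unfolding uses_def by (intro pt_list_ex pt_not pt_eq pt_const pt_headof pt_fst pt_snd pt_id)

lemma pt_shift: "pt D m F \<Longrightarrow> pt D m (\<lambda>s. shift (F s))"
  unfolding shift_def by (intro pt_collect pt_map pt_Pair pt_tail_key pt_fst pt_snd pt_id)

lemma pt_forget:
  assumes J: "pt D m J" and Q: "\<And>s a. s \<in> D \<Longrightarrow> a \<in> set (J s) \<Longrightarrow> set (fst (fst a)) \<subseteq> Q"
    and g: "pt {p. fst p \<in> D \<and> snd p \<in> Q} (\<lambda>p. m (fst p)) (\<lambda>p. g (fst p) (snd p))"
  shows "pt D m (\<lambda>s. forget (g s) (J s))"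
proof -
  have "pt {p. fst p \<in> D \<and> snd p \<in> set (J (fst p))} (\<lambda>p. m (fst p))
     (\<lambda>p. (\<lambda>q. g (fst q) (snd q)) (fst p, headof (fst (snd p))))"
  proof (rule pt_comp[OF _ g])
    fix p assume "p \<in> {p. fst p \<in> D \<and> snd p \<in> set (J (fst p))}"
    then show "(fst p, headof (fst (snd p))) \<in> {p. fst p \<in> D \<and> snd p \<in> Q}"
      using Q[of "fst p" "snd p"] headof_Q by simp
  qed (auto intro!: pt_Pair pt_headof pt_fst pt_snd pt_id)
  then have G: "pt {p. fst p \<in> D \<and> snd p \<in> set (J (fst p))} (\<lambda>p. m (fst p))
     (\<lambda>p. g (fst p) (headof (fst (snd p))))" by simp
  have "\<forall>s\<in>D. \<forall>a\<in>set (J s). set (fst (fst a)) \<subseteq> Q" using Q by blast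
  then show ?thesis
    unfolding forget_def
    by (intro pt_collect pt_map pt_filter[OF J G] pt_Pair pt_drop_key pt_fst pt_snd pt_id) auto
qed

lemma pt_step:
  assumes fs: "pt D m fs" and A: "pb D m A"
    and sz: "\<And>s ys zs. s \<in> D \<Longrightarrow> filter uses (fs s) = ys @ zs \<Longrightarrow> sz (joins ys) \<le> A s"
    and Q: "\<And>s ys zs a. s \<in> D \<Longrightarrow> filter uses (fs s) = ys @ zs \<Longrightarrow> a \<in> set (joins ys) \<Longrightarrow> set (fst (fst a)) \<subseteq> Q"
    and Q': "\<And>s F a. s \<in> D \<Longrightarrow> F \<in> set (fs s) \<Longrightarrow> a \<in> set F \<Longrightarrow> set (fst (fst a)) \<subseteq> Q"
    and g: "pt {p. fst p \<in> D \<and> snd p \<in> Q} (\<lambda>p. m (fst p)) (\<lambda>p. g (fst p) (snd p))"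
  shows "pt D m (\<lambda>s. step (g s) (fs s))"
  unfolding step_def
proof (intro pt_Cons pt_map pt_shift pt_filter[OF fs] pt_not pt_uses pt_snd pt_id pt_forget[OF _ _ g])
  show "pt D m (\<lambda>s. joins (filter uses (fs s)))"
    by (rule pt_joins[OF pt_filter[OF fs pt_uses[OF pt_snd[OF pt_id]]] A sz Q Q']) auto
  fix s a assume "s \<in> D" "a \<in> set (joins (filter uses (fs s)))"
  then show "set (fst (fst a)) \<subseteq> Q" using Q[of s "filter uses (fs s)" "[]"] by simp
qed

theorem pt_elim:
  assumes fs: "pt D m fs" and us: "pt D m us"
    and g: "pt {p. fst p \<in> D \<and> fst (snd p) \<in> set (us (fst p)) \<and> snd (snd p) \<in> Q} (\<lambda>p. m (fst p))
        (\<lambda>p. good (fst p) (fst (snd p)) (snd (snd p)))"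
    and N: "pb D m N" and b: "pb D m (\<lambda>s. card Q ^ b s)"
    and ok: "\<And>s. s \<in> D \<Longrightarrow> state_ok (BB s) (us s) (N s) (fs s)"
    and ord: "\<And>s. s \<in> D \<Longrightarrow> elim_order (BB s) (us s)"
    and dist: "\<And>s. s \<in> D \<Longrightarrow> distinct (us s)"
    and BB: "\<And>s B. s \<in> D \<Longrightarrow> B \<in> BB s \<Longrightarrow> finite B \<and> card B \<le> b s"
  shows "pt D m (\<lambda>s. joins (elim (good s) (fs s) (us s)))"
proof -
  let ?T = "\<lambda>s. table_size (N s) (card Q ^ b s) (N s)"
  have T: "pb D m ?T" and T1: "pb D m (\<lambda>s. table_size (N s) 1 (N s))"
    unfolding table_size_def by (intro pb_mult pb_add pb_power pb_Suc pb_const N b)+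
  have st: "state_ok (BB s) zs (N s) (foldl (\<lambda>fs v. step (good s v) fs) (fs s) ys)"
    if "s \<in> D" "us s = ys @ zs" for s ys zs
    using state_ok_elim[of "BB s" ys zs "N s" "fs s" "good s"] ok ord that unfolding elim_def by metis
  let ?R = "reach D us fs (\<lambda>s fs v. step (good s v) fs)"
  have R: "\<exists>s v zs. fst p = s \<and> fst (snd p) = v \<and> s \<in> D \<and> v \<in> set (us s) \<and>
     distinct (v # zs) \<and> elim_order (BB s) (v # zs) \<and> state_ok (BB s) (v # zs) (N s) (snd (snd p))"
    if "p \<in> ?R" for p
  proof -
    from that obtain s v ys zs where p: "s \<in> D" "us s = ys @ v # zs"
      "p = (s, v, foldl (\<lambda>fs v. step (good s v) fs) (fs s) ys)" by (auto simp: reach_def)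
    then show ?thesis
      using st[OF p(1,2)] dist[OF p(1)] elim_order_append[of "BB s" ys "v # zs"] ord[OF p(1)] by auto
  qed
  have e: "pt D m (\<lambda>s. elim (good s) (fs s) (us s))"
    unfolding elim_def
  proof (rule pt_foldl[OF us fs, where A = "\<lambda>s. N s * Suc (?T s)"])
    show "pb D m (\<lambda>s. N s * Suc (?T s))" by (intro pb_mult pb_Suc N T)
    fix s ys zs assume *: "s \<in> D" "us s = ys @ zs"
    show "sz (foldl (\<lambda>fs v. step (good s v) fs) (fs s) ys) \<le> N s * Suc (?T s)"
      by (rule sz_state[OF st[OF *]]) (use dist[OF *(1)] *(2) BB[OF *(1)] in auto)
  next
    show "pt ?R (\<lambda>p. m (fst p)) (\<lambda>p. step (good (fst p) (fst (snd p))) (snd (snd p)))"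
    proof (rule pt_step[where A = "\<lambda>p. ?T (fst p)"])
      show "pb ?R (\<lambda>p. m (fst p)) (\<lambda>p. ?T (fst p))"
        by (rule pb_comp[OF T])
          (auto simp: reach_def intro!: pb_measure pb_mono[OF pb_sz] sz_fst_le)
      show "pt {p. fst p \<in> ?R \<and> snd p \<in> Q} (\<lambda>p. m (fst (fst p)))
        (\<lambda>p. good (fst (fst p)) (fst (snd (fst p))) (snd p))"
      proof -
        have "pt {p. fst p \<in> ?R \<and> snd p \<in> Q} (\<lambda>p. m (fst (fst p)))
          (\<lambda>p. (\<lambda>p. good (fst p) (fst (snd p)) (snd (snd p))) (fst (fst p), fst (snd (fst p)), snd p))"
          by (rule pt_comp[OF _ g]) (auto simp: reach_def intro!: pt_Pair pt_fst pt_snd pt_id pb_measure)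
        then show ?thesis by simp
      qed
    next
      fix p ys zs assume "p \<in> ?R" and pre: "filter uses (snd (snd p)) = ys @ zs"
      with R[OF this(1)] obtain s v vs where p: "fst p = s" "s \<in> D" "distinct (v # vs)"
        "elim_order (BB s) (v # vs)" "state_ok (BB s) (v # vs) (N s) (snd (snd p))" by blast
      note B = sz_bucket[OF p(5,3,4) BB[OF p(2)] pre]
      show "sz (joins ys) \<le> ?T (fst p)" using B(1) p(1) by simp
      show "a \<in> set (joins ys) \<Longrightarrow> set (fst (fst a)) \<subseteq> Q" for a by (rule B(2))
    next
      fix p F a assume "p \<in> ?R" "F \<in> set (snd (snd p))" "a \<in> set F"
      with R[OF this(1)] show "set (fst (fst a)) \<subseteq> Q" using state_ok_sets by blast
    qed (intro pt_fst pt_snd pt_id)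
  qed
  show ?thesis
  proof (rule pt_joins[OF e T1])
    fix s ys zs assume *: "s \<in> D" and pre: "elim (good s) (fs s) (us s) = ys @ zs"
    from st[OF *, of "us s" "[]"] have ok: "state_ok (BB s) [] (N s) (elim (good s) (fs s) (us s))"
      by (simp add: elim_def)
    note B = sz_joins_final[OF ok pre]
    show "sz (joins ys) \<le> table_size (N s) 1 (N s)" by (rule B(1))
    show "a \<in> set (joins ys) \<Longrightarrow> set (fst (fst a)) \<subseteq> Q" for a by (rule B(2))
  next
    fix s F a assume *: "s \<in> D" and F: "F \<in> set (elim (good s) (fs s) (us s))" "a \<in> set F"
    from st[OF *, of "us s" "[]"] have ok: "state_ok (BB s) [] (N s) (elim (good s) (fs s) (us s))"
      by (simp add: elim_def)
    show "set (fst (fst a)) \<subseteq> Q" by (rule state_ok_sets[OF ok F])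
  qed
qed

lemma pt_count:
  assumes J: "pt D m J" and \<phi>: "pt {p. fst p \<in> D \<and> snd p \<in> set (J (fst p))} (\<lambda>p. m (fst p)) (\<lambda>p. \<phi> (fst p) (snd (fst (snd p))))"
  shows "pt D m (\<lambda>s. count (\<phi> s) (J s))"
  unfolding count_def by (intro pt_sum_list pt_map pt_filter[OF J \<phi>] pt_snd pt_id)

end

section \<open>Vertex orders from tree decompositions\<close>

lemma adjacent_sym: "adjacent G u v \<longleftrightarrow> adjacent G v u"
  by (simp add: adjacent_def insert_commute)

lemma undirected_not_adjacent_self: "undirected_graph G \<Longrightarrow> \<not> adjacent G u u"
  unfolding undirected_graph_def adjacent_def by fastforce

definition grown :: "graph \<Rightarrow> nat list \<Rightarrow> bool" where
  "grown T xs \<longleftrightarrow> xs \<noteq> [] \<and> distinct xs \<and> set xs \<subseteq> verts T \<and>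
     (\<forall>i<length xs. 0 < i \<longrightarrow> (\<exists>j<i. adjacent T (xs ! j) (xs ! i)))"

definition is_path :: "graph \<Rightarrow> nat list \<Rightarrow> bool" where
  "is_path T p \<longleftrightarrow> p \<noteq> [] \<and> distinct p \<and> (\<forall>i. Suc i < length p \<longrightarrow> adjacent T (p ! i) (p ! Suc i))"

lemma is_path_snoc:
  assumes "is_path T p" "c \<notin> set p" "adjacent T (last p) c"
  shows "is_path T (p @ [c])"
  using assms unfolding is_path_def
  by (auto simp: nth_append last_conv_nth less_Suc_eq Suc_lessI)
     (metis diff_Suc_Suc diff_zero)

lemma is_path_Cons:
  assumes "is_path T p" "c \<notin> set p" "adjacent T c (hd p)"
  shows "is_path T (c # p)"
  using assms unfolding is_path_def
  by (auto simp: nth_Cons hd_conv_nth split: nat.split)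

lemma grown_take: "grown T xs \<Longrightarrow> 0 < k \<Longrightarrow> grown T (take k xs)"
  unfolding grown_def by (auto dest: in_set_takeD) (metis less_trans nth_take)

lemma grown_path:
  assumes "grown T xs" "u \<in> set xs" "v \<in> set xs"
  shows "\<exists>p. is_path T p \<and> set p \<subseteq> set xs \<and> hd p = u \<and> last p = v"
  using assms
proof (induction xs arbitrary: u v rule: rev_induct)
  case (snoc c xs)
  show ?case
  proof (cases "xs = []")
    case True
    then show ?thesis using snoc.prems by (intro exI[of _ "[c]"]) (auto simp: is_path_def)
  next
    case False
    then have g: "grown T xs" using grown_take[OF snoc.prems(1), of "length xs"] by simp
    have c: "c \<notin> set xs" using snoc.prems(1) by (simp add: grown_def)
    have "\<exists>j<length xs. adjacent T ((xs @ [c]) ! j) ((xs @ [c]) ! length xs)"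
      using snoc.prems(1) False unfolding grown_def by (elim conjE allE[of _ "length xs"]) simp
    then obtain j where j: "j < length xs" "adjacent T (xs ! j) c" by (auto simp: nth_append)
    let ?w = "xs ! j"
    have w: "?w \<in> set xs" using j by simp
    consider "u \<in> set xs" "v \<in> set xs" | "u \<in> set xs" "v = c" | "u = c" "v \<in> set xs" | "u = c" "v = c"
      using snoc.prems by auto
    then show ?thesis
    proof cases
      case 1
      then show ?thesis using snoc.IH[OF g 1] by auto
    next
      case 2
      from snoc.IH[OF g 2(1) w] obtain p where p: "is_path T p" "set p \<subseteq> set xs" "hd p = u" "last p = ?w" by blast
      then have "is_path T (p @ [c])" using is_path_snoc[of T p c] c j by auto
      then show ?thesis using p 2 by (intro exI[of _ "p @ [c]"]) (auto simp: is_path_def)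
    next
      case 3
      from snoc.IH[OF g w 3(2)] obtain p where p: "is_path T p" "set p \<subseteq> set xs" "hd p = ?w" "last p = v" by blast
      then have "is_path T (c # p)" using is_path_Cons[of T p c] c j adjacent_sym by auto
      then show ?thesis using p 3 by (intro exI[of _ "c # p"]) (auto simp: is_path_def)
    next
      case 4
      then show ?thesis by (intro exI[of _ "[c]"]) (auto simp: is_path_def)
    qed
  qed
qed (simp add: grown_def)

lemma cycle_from_path:
  assumes p: "is_path T p" and x: "x \<notin> set p" "adjacent T x (hd p)" "adjacent T (last p) x"
    and ne: "hd p \<noteq> last p"
  shows "is_cycle T (x # p)"
proof -
  have len: "2 \<le> length p"
    using p ne unfolding is_path_def by (cases p; cases "tl p") auto
  have px: "is_path T (x # p)" by (rule is_path_Cons[OF p x(1,2)])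
  have "adjacent T ((x # p) ! i) ((x # p) ! (Suc i mod length (x # p)))" if "i < length (x # p)" for i
  proof (cases "Suc i < length (x # p)")
    case True
    then show ?thesis using px unfolding is_path_def by simp
  next
    case False
    then have i: "i = length p" using that by simp
    then have "(x # p) ! i = last p" using len by (cases p) (auto simp: last_conv_nth)
    then show ?thesis using i x(3) by simp
  qed
  then show ?thesis unfolding is_cycle_def using len px by (simp add: is_path_def)
qed

lemma grown_unique_neighbour:
  assumes T: "\<nexists>xs. is_cycle T xs" and g: "grown T xs" and x: "x \<notin> set xs"
    and u: "u \<in> set xs" "adjacent T x u" and v: "v \<in> set xs" "adjacent T x v"
  shows "u = v"
proof (rule ccontr)
  assume "u \<noteq> v"
  obtain p where p: "is_path T p" "set p \<subseteq> set xs" "hd p = u" "last p = v"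
    using grown_path[OF g u(1) v(1)] by blast
  have "is_cycle T (x # p)"
    by (rule cycle_from_path[OF p(1)]) (use p x u v \<open>u \<noteq> v\<close> adjacent_sym in auto)
  with T show False by blast
qed

lemma connected_in_remove_leaf:
  assumes A: "connected_in T A" and p: "\<And>y. y \<in> A \<Longrightarrow> adjacent T x y \<Longrightarrow> y = p"
  shows "connected_in T (A - {x})"
  unfolding connected_in_def
proof (intro ballI)
  let ?R = "{(y, z). y \<in> A \<and> z \<in> A \<and> adjacent T y z}"
  let ?R' = "{(y, z). y \<in> A - {x} \<and> z \<in> A - {x} \<and> adjacent T y z}"
  let ?h = "\<lambda>y. if y = x then p else y"
  fix u w assume u: "u \<in> A - {x}" and w: "w \<in> A - {x}"
  have "(u, w) \<in> ?R\<^sup>*" using A u w unfolding connected_in_def by blast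
  then have "(u, ?h w) \<in> ?R'\<^sup>*"
  proof (induction rule: rtrancl_induct)
    case base
    then show ?case using u by simp
  next
    case (step y z)
    then have yz: "y \<in> A" "z \<in> A" "adjacent T y z" by auto
    consider "y = x" "z = x" | "y = x" "z \<noteq> x" | "y \<noteq> x" "z = x" | "y \<noteq> x" "z \<noteq> x" by blast
    then show ?case
    proof cases
      case 1
      then show ?thesis using step.IH by simp
    next
      case 2
      then have "z = p" using p yz by blast
      then show ?thesis using step.IH 2 by simp
    next
      case 3
      then have "y = p" using p yz adjacent_sym by blast
      then show ?thesis using step.IH 3 by simp
    next
      case 4
      then have "(y, z) \<in> ?R'" using yz by simp
      with step.IH 4 show ?thesis by (simp add: rtrancl.rtrancl_into_rtrancl)
    qed
  qed
  then show "(u, w) \<in> ?R'\<^sup>*" using w by simp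
qed

lemma grown_connected:
  assumes T: "is_tree T" and g: "grown T xs" and A: "A \<subseteq> set xs" "connected_in T A"
  shows "connected_in T (A \<inter> set (take k xs))"
proof (cases "k = 0")
  case False
  show ?thesis
    using g A False
  proof (induction xs arbitrary: A rule: rev_induct)
    case (snoc x xs)
    show ?case
    proof (cases "k \<le> length xs")
      case True
      then have "xs \<noteq> []" using snoc.prems(4) by auto
      then have g: "grown T xs" using grown_take[OF snoc.prems(1), of "length xs"] by simp
      have x: "x \<notin> set xs" using snoc.prems(1) by (simp add: grown_def)
      have irr: "\<not> adjacent T x x" using T undirected_not_adjacent_self by (auto simp: is_tree_def)
      obtain p where p: "\<And>y. y \<in> A \<Longrightarrow> adjacent T x y \<Longrightarrow> y = p"
      proof (cases "\<exists>y\<in>A. adjacent T x y")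
        case True
        then obtain y where y: "y \<in> A" "adjacent T x y" by blast
        show thesis
        proof (rule that[of y])
          fix z assume z: "z \<in> A" "adjacent T x z"
          have "z \<in> set xs" "y \<in> set xs" using snoc.prems(2) y z irr by auto
          then show "z = y"
            using grown_unique_neighbour[OF _ g x _ z(2) _ y(2)] T by (auto simp: is_tree_def)
        qed
      qed blast
      have "connected_in T (A - {x})" by (rule connected_in_remove_leaf[OF snoc.prems(3) p])
      from snoc.IH[OF g _ this snoc.prems(4)] snoc.prems(2)
      have "connected_in T ((A - {x}) \<inter> set (take k xs))" by auto
      moreover have "(A - {x}) \<inter> set (take k xs) = A \<inter> set (take k (xs @ [x]))"
        using True x by (auto dest: in_set_takeD)
      ultimately show ?thesis by simp
    next
      case False
      then show ?thesis using snoc.prems by (simp add: Int_absorb2)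
    qed
  qed (simp add: grown_def)
qed (simp add: connected_in_def)

lemma grown_parent_bag:
  assumes T: "is_tree T" and g: "grown T xs" "set xs = verts T"
    and con: "\<And>v. v \<in> V \<Longrightarrow> connected_in T {x \<in> verts T. v \<in> bg x}"
    and k: "k < length xs" and "k > 0"
  shows "\<exists>p<k. \<forall>v\<in>V. v \<in> bg (xs ! k) \<longrightarrow> (\<exists>j<k. v \<in> bg (xs ! j)) \<longrightarrow> v \<in> bg (xs ! p)"
proof -
  from g(1) k \<open>k > 0\<close> obtain p where p: "p < k" "adjacent T (xs ! p) (xs ! k)"
    unfolding grown_def by blast
  have dist: "distinct xs" using g(1) by (simp add: grown_def)
  have irr: "\<not> adjacent T x x" for x using T undirected_not_adjacent_self by (auto simp: is_tree_def)
  have xk: "xs ! k \<notin> set (take k xs)" using dist k by (auto simp: in_set_conv_nth nth_eq_iff_index_eq)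
  have "v \<in> bg (xs ! p)" if v: "v \<in> V" "v \<in> bg (xs ! k)" and j: "j < k" "v \<in> bg (xs ! j)" for v j
  proof -
    let ?A = "{x \<in> verts T. v \<in> bg x} \<inter> set (take (Suc k) xs)"
    have c: "connected_in T ?A"
      by (rule grown_connected[OF T g(1)]) (use g(2) con[OF v(1)] in auto)
    have t: "set (take (Suc k) xs) = insert (xs ! k) (set (take k xs))"
      using k by (simp add: take_Suc_conv_app_nth)
    have jt: "xs ! j \<in> set (take k xs)" using j k by (auto simp: in_set_conv_nth)
    have "xs ! k \<in> ?A" "xs ! j \<in> ?A" "xs ! j \<noteq> xs ! k"
    proof -
      show "xs ! k \<in> ?A" using v k g(2) t nth_mem by blast
      show "xs ! j \<in> ?A" using v j k g(2) t jt in_set_takeD by fast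
      show "xs ! j \<noteq> xs ! k" using jt xk by metis
    qed
    with c have "(xs ! k, xs ! j) \<in> {(x, y). x \<in> ?A \<and> y \<in> ?A \<and> adjacent T x y}\<^sup>*"
      unfolding connected_in_def by blast
    then obtain y where y: "y \<in> ?A" "adjacent T (xs ! k) y"
      using \<open>xs ! j \<noteq> xs ! k\<close> by (cases rule: converse_rtranclE) auto
    have y': "y \<in> set (take k xs)" using y t irr by auto
    have pt: "xs ! p \<in> set (take k xs)" using p k by (auto simp: in_set_conv_nth)
    have "y = xs ! p"
      by (rule grown_unique_neighbour[OF _ grown_take[OF g(1) \<open>k > 0\<close>] xk y' y(2) pt])
        (use T p adjacent_sym in \<open>auto simp: is_tree_def\<close>)
    then show ?thesis using y(1) by simp
  qed
  then show ?thesis using p(1) by blast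
qed

lemma dedup_append: "\<exists>zs. dedup (xs @ ys) = zs @ dedup xs \<and> set zs \<subseteq> set ys - set xs"
proof (induction ys rule: rev_induct)
  case (snoc y ys)
  then obtain zs where "dedup (xs @ ys) = zs @ dedup xs" "set zs \<subseteq> set ys - set xs" by blast
  note zs = this
  have s: "dedup (xs @ ys @ [y]) = (if y \<in> set xs \<union> set ys then zs @ dedup xs else (y # zs) @ dedup xs)"
    using dedup_snoc[of "xs @ ys" y] set_dedup[of "xs @ ys"] zs(1) by auto
  show ?case
  proof (cases "y \<in> set xs \<union> set ys")
    case True
    then show ?thesis using s zs(2) by (intro exI[of _ zs]) auto
  next
    case False
    then show ?thesis using s zs(2) by (intro exI[of _ "y # zs"]) auto
  qed
qed simp

lemma dedup_concat_split:
  assumes "dedup (concat yss) = ps @ v # rest"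
  shows "\<exists>i<length yss. v \<in> set (yss ! i) \<and> (\<forall>j<i. v \<notin> set (yss ! j)) \<and>
     (\<forall>u\<in>set rest. \<exists>j\<le>i. u \<in> set (yss ! j))"
  using assms
proof (induction yss arbitrary: ps rule: rev_induct)
  case Nil
  then show ?case by (simp add: dedup_def)
next
  case (snoc ys yss)
  obtain zs where zs: "dedup (concat yss @ ys) = zs @ dedup (concat yss)" "set zs \<subseteq> set ys - set (concat yss)"
    using dedup_append[of "concat yss" ys] by auto
  with snoc.prems have eq: "ps @ v # rest = zs @ dedup (concat yss)" by simp
  have old: ?case if D: "dedup (concat yss) = ps' @ v # rest" for ps'
  proof -
    from snoc.IH[OF D] obtain i where i: "i < length yss" "v \<in> set (yss ! i)"
      "\<forall>j<i. v \<notin> set (yss ! j)" "\<forall>u\<in>set rest. \<exists>j\<le>i. u \<in> set (yss ! j)" by blast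
    have n: "(yss @ [ys]) ! j = yss ! j" if "j \<le> i" for j using that i(1) by (simp add: nth_append)
    have "\<exists>j\<le>i. u \<in> set ((yss @ [ys]) ! j)" if "u \<in> set rest" for u
    proof -
      from i(4) that obtain j where "j \<le> i" "u \<in> set (yss ! j)" by blast
      then show ?thesis using n[of j] by (intro exI[of _ j]) simp
    qed
    then show ?thesis using i(1-3) n by (intro exI[of _ i]) simp
  qed
  have new: ?case if z: "zs = ps @ v # rs" "rest = rs @ dedup (concat yss)" for rs
  proof -
    have "v \<in> set zs" using z(1) by simp
    then have v: "v \<in> set ys" "v \<notin> set (concat yss)" using zs(2) by blast+
    have "\<exists>j\<le>length yss. u \<in> set ((yss @ [ys]) ! j)" if "u \<in> set rest" for u
    proof -
      from that z(2) have "u \<in> set rs \<or> u \<in> set (concat yss)" by simp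
      then have "u \<in> set ys \<or> u \<in> set (concat yss)" using z(1) zs(2) by auto
      then show ?thesis
      proof
        assume "u \<in> set ys"
        then show ?thesis by (intro exI[of _ "length yss"]) simp
      next
        assume "u \<in> set (concat yss)"
        then obtain zs where "zs \<in> set yss" "u \<in> set zs" unfolding set_concat by blast
        then obtain j where "j < length yss" "u \<in> set (yss ! j)" unfolding in_set_conv_nth[of zs] by blast
        then show ?thesis by (intro exI[of _ j]) (simp add: nth_append)
      qed
    qed
    moreover have "v \<notin> set ((yss @ [ys]) ! j)" if "j < length yss" for j
    proof -
      have "yss ! j \<in> set yss" using that by simp
      then have "v \<notin> set (yss ! j)" using v(2) unfolding set_concat by blast
      then show ?thesis using that by (simp add: nth_append)
    qed
    ultimately show ?thesis using v(1) by (intro exI[of _ "length yss"]) simp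
  qed
  from eq obtain us where "ps = zs @ us \<and> us @ v # rest = dedup (concat yss) \<or>
      ps @ us = zs \<and> v # rest = us @ dedup (concat yss)"
    unfolding append_eq_append_conv2 by blast
  then show ?case
  proof
    assume "ps = zs @ us \<and> us @ v # rest = dedup (concat yss)"
    then show ?case using old[of us] by simp
  next
    assume us: "ps @ us = zs \<and> v # rest = us @ dedup (concat yss)"
    show ?case
    proof (cases us)
      case Nil
      then show ?thesis using us old[of "[]"] by simp
    next
      case (Cons w rs)
      then show ?thesis using us new[of rs] by simp
    qed
  qed
qed

lemma elim_order_dedup:
  assumes T: "is_tree T" and g: "grown T xs" "set xs = verts T"
    and con: "\<And>v. v \<in> V \<Longrightarrow> connected_in T {x \<in> verts T. v \<in> bg x}"
    and V: "\<And>x. x \<in> verts T \<Longrightarrow> bg x \<subseteq> V"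
    and f: "\<And>x. x \<in> verts T \<Longrightarrow> set (f x) = bg x"
  shows "elim_order (bg ` verts T) (dedup (concat (map f xs)))"
  unfolding elim_order_def
proof (intro allI impI)
  fix ps v rest assume "dedup (concat (map f xs)) = ps @ v # rest"
  from dedup_concat_split[OF this] obtain i where i': "i < length xs"
    "v \<in> set (map f xs ! i)" "\<forall>j<i. v \<notin> set (map f xs ! j)"
    "\<forall>u\<in>set rest. \<exists>j\<le>i. u \<in> set (map f xs ! j)" by auto
  have fx: "set (map f xs ! j) = bg (xs ! j)" if "j \<le> i" for j
  proof -
    have "j < length xs" using that i'(1) by simp
    moreover from this have "xs ! j \<in> verts T" using g(2) nth_mem by blast
    ultimately show ?thesis using f by simp
  qed
  have i: "i < length xs" "v \<in> bg (xs ! i)" using i' fx by simp_all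
  have i3: "v \<notin> bg (xs ! j)" if "j < i" for j
    using i'(3) that unfolding fx[OF less_imp_le[OF that], symmetric] by blast
  have i4: "\<exists>j\<le>i. u \<in> bg (xs ! j)" if "u \<in> set rest" for u
  proof -
    from i'(4) that obtain j where "j \<le> i" "u \<in> set (map f xs ! j)" by blast
    then show ?thesis using fx by blast
  qed
  have main: "u \<in> bg (xs ! i)" if "k < length xs" "v \<in> bg (xs ! k)" "u \<in> bg (xs ! k)" "u \<in> set rest" for u k
    using that
  proof (induction k rule: less_induct)
    case (less k)
    have "\<not> k < i" using i3 less.prems by blast
    then consider "k = i" | "i < k" by linarith
    then show ?case
    proof cases
      case 1
      then show ?thesis using less.prems by simp
    next
      case 2
      have kV: "bg (xs ! k) \<subseteq> V" using V g(2) less.prems(1) nth_mem by blast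
      obtain p where p: "p < k" "\<And>v. v \<in> V \<Longrightarrow> v \<in> bg (xs ! k) \<Longrightarrow> (\<exists>j<k. v \<in> bg (xs ! j)) \<Longrightarrow> v \<in> bg (xs ! p)"
        using grown_parent_bag[OF T g con less.prems(1), of V] 2 by auto
      have "v \<in> bg (xs ! p)" using p(2)[of v] less.prems kV i(2) 2 by blast
      moreover from i4[OF less.prems(4)] obtain j where "j \<le> i" "u \<in> bg (xs ! j)" by blast
      then have "u \<in> bg (xs ! p)"
        using p(2)[of u] less.prems(3) kV 2 by (meson le_less_trans subsetD)
      ultimately show ?thesis using less.IH[OF p(1)] p(1) less.prems by simp
    qed
  qed
  show "\<exists>Bv\<in>bg ` verts T. \<forall>B\<in>bg ` verts T. v \<in> B \<longrightarrow> B \<inter> set (v # rest) \<subseteq> Bv"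
  proof (rule bexI[of _ "bg (xs ! i)"])
    show "bg (xs ! i) \<in> bg ` verts T" using i(1) g(2) by auto
    show "\<forall>B\<in>bg ` verts T. v \<in> B \<longrightarrow> B \<inter> set (v # rest) \<subseteq> bg (xs ! i)"
    proof (intro ballI impI subsetI)
      fix B u assume "B \<in> bg ` verts T" "v \<in> B" and u: "u \<in> B \<inter> set (v # rest)"
      then obtain x where x: "x \<in> set xs" "B = bg x" "v \<in> bg x" using g(2) by blast
      from x(1) obtain k where "k < length xs" "x = xs ! k" by (auto simp: in_set_conv_nth)
      with x have k: "k < length xs" "B = bg (xs ! k)" "v \<in> bg (xs ! k)" by simp_all
      show "u \<in> bg (xs ! i)" using k main[of k u] u i(2) by auto
    qed
  qed
qed


subsection \<open>Enumerating the nodes of the tree\<close>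

definition boundary :: "(nat \<times> nat) list \<Rightarrow> nat list \<Rightarrow> nat list" where
  "boundary te vis = concat (map (\<lambda>e. if fst e \<in> set vis \<and> snd e \<notin> set vis then [snd e]
     else if snd e \<in> set vis \<and> fst e \<notin> set vis then [fst e] else []) te)"

definition grow :: "(nat \<times> nat) list \<Rightarrow> nat list \<Rightarrow> nat list" where
  "grow te vis = (case boundary te vis of [] \<Rightarrow> vis | c # _ \<Rightarrow> vis @ [c])"

definition tree_nodes :: "(nat \<times> nat) list \<Rightarrow> 'a list \<Rightarrow> nat list" where
  "tree_nodes te bags = foldl (\<lambda>vis _. grow te vis) [0] bags"

lemma set_boundary:
  "c \<in> set (boundary te vis) \<longleftrightarrow> c \<notin> set vis \<and> (\<exists>x\<in>set vis. (x, c) \<in> set te \<or> (c, x) \<in> set te)"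
proof -
  have "c \<in> set (boundary te vis) \<longleftrightarrow> (\<exists>e\<in>set te. c \<notin> set vis \<and> (c = snd e \<and> fst e \<in> set vis \<or> c = fst e \<and> snd e \<in> set vis))"
    unfolding boundary_def set_concat set_map UN_iff bex_simps(7) by (intro bex_cong) auto
  then show ?thesis by (auto simp: Bex_def)
qed

lemma pt_grow: "pt D m te \<Longrightarrow> pt D m vis \<Longrightarrow> pt D m (\<lambda>s. grow (te s) (vis s))"
proof -
  assume te: "pt D m te" and vis: "pt D m vis"
  have v: "pt D' (\<lambda>p. m (fst p)) (\<lambda>p. vis (fst p))" if "\<And>p. p \<in> D' \<Longrightarrow> fst p \<in> D" for D' :: "('a \<times> nat \<times> nat) set"
    by (rule pt_lift_fst[OF vis that])
  have v': "pt D' (\<lambda>p. m (fst p)) (\<lambda>p. vis (fst p))" if "\<And>p. p \<in> D' \<Longrightarrow> fst p \<in> D" for D' :: "('a \<times> nat \<times> nat list) set"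
    by (rule pt_lift_fst[OF vis that])
  show ?thesis
    unfolding grow_def boundary_def
    by (rule pt_case_list)
      (auto intro!: pt_concat pt_map pt_if' pt_conj' pt_not pt_member pt_Cons pt_append pt_const v v' te
        pt_subset[OF vis] pt_fst pt_snd pt_id)
qed

lemma sz_grow: "set vis \<subseteq> insert 0 (fst ` set te \<union> snd ` set te) \<Longrightarrow>
   set (grow te vis) \<subseteq> insert 0 (fst ` set te \<union> snd ` set te) \<and> length (grow te vis) \<le> Suc (length vis)"
proof -
  assume v: "set vis \<subseteq> insert 0 (fst ` set te \<union> snd ` set te)"
  have "set (boundary te vis) \<subseteq> fst ` set te \<union> snd ` set te"
    unfolding boundary_def by (auto split: if_splits)
  with v show ?thesis by (auto simp: grow_def split: list.split)
qed

lemma pt_tree_nodes: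
  assumes te: "pt D m te" and bags: "pt D m bags"
  shows "pt D m (\<lambda>s. tree_nodes (te s) (bags s))"
  unfolding tree_nodes_def
proof (rule pt_foldl[OF bags pt_const, where A = "\<lambda>s. Suc (sz (bags s)) * Suc (sz (te s))"])
  show "pb D m (\<lambda>s. Suc (sz (bags s)) * Suc (sz (te s)))" by (intro pb_mult pb_Suc pt_sz te bags)
  show "pt (reach D bags (\<lambda>s. [0]) (\<lambda>s vis _. grow (te s) vis)) (\<lambda>p. m (fst p))
    (\<lambda>p. grow (te (fst p)) (snd (snd p)))"
    by (intro pt_grow pt_lift_fst[OF te] pt_snd pt_id) (auto simp: reach_def)
  fix s ys zs assume b: "bags s = ys @ zs"
  let ?S = "insert 0 (fst ` set (te s) \<union> snd ` set (te s))"
  let ?v = "foldl (\<lambda>vis _. grow (te s) vis) [0] ys"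
  have *: "set ?v \<subseteq> ?S \<and> length ?v \<le> Suc (length ys)"
  proof (induction ys rule: rev_induct)
    case (snoc y ys)
    then have v: "set (foldl (\<lambda>vis _. grow (te s) vis) [0] ys) \<subseteq> ?S"
      and l: "length (foldl (\<lambda>vis _. grow (te s) vis) [0] ys) \<le> Suc (length ys)" by blast+
    show ?case using sz_grow[OF v] l by simp
  qed simp
  have "sz x \<le> sz (te s)" if "x \<in> ?S" for x
  proof -
    have "x \<in> ?S" by (rule that)
    then consider "x = 0" | e where "e \<in> set (te s)" "x = fst e \<or> x = snd e" by blast
    then show ?thesis
    proof cases
      case 2
      then have "sz x \<le> sz e" using sz_fst_le[of e] sz_snd_le[of e] by blast
      with sz_mem[OF 2(1)] show ?thesis by linarith
    qed simp
  qed
  note b' = this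
  have "sz ?v \<le> length ?v * Suc (sz (te s))"
    by (rule sz_list_le, rule b') (rule subsetD[OF conjunct1[OF *]])
  also have "\<dots> \<le> Suc (sz (bags s)) * Suc (sz (te s))"
    using * length_le_sz[of "bags s"] b by (intro mult_right_mono) auto
  finally show "sz ?v \<le> Suc (sz (bags s)) * Suc (sz (te s))" .
qed

lemma tree_nodes:
  assumes T: "is_tree T" and V: "verts T = {..<length bags}"
    and te: "\<And>x y. adjacent T x y \<longleftrightarrow> (x, y) \<in> set te \<or> (y, x) \<in> set te"
  shows "grown T (tree_nodes te bags)" "set (tree_nodes te bags) = verts T"
proof -
  have adjV: "y \<in> verts T" if "adjacent T x y" for x y
  proof -
    from that obtain e where e: "e \<in> edges T" "ends e = {x, y}" unfolding adjacent_def by blast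
    with T have "ends e \<subseteq> verts T" unfolding is_tree_def undirected_graph_def by auto
    then show ?thesis using e by simp
  qed
  have g: "grown T (foldl (\<lambda>vis _. grow te vis) [0] ys) \<and>
    (set (foldl (\<lambda>vis _. grow te vis) [0] ys) = verts T \<or> length (foldl (\<lambda>vis _. grow te vis) [0] ys) = Suc (length ys))"
    for ys :: "'a list"
  proof (induction ys rule: rev_induct)
    case Nil
    have "verts T \<noteq> {}" using T by (simp add: is_tree_def)
    then have "bags \<noteq> []" unfolding V by auto
    then have "0 \<in> verts T" unfolding V by simp
    then show ?case by (simp add: grown_def)
  next
    case (snoc y ys)
    define vis where "vis = foldl (\<lambda>vis _. grow te vis) [0] ys"
    from snoc have vis: "grown T vis" "set vis = verts T \<or> length vis = Suc (length ys)" by (simp_all add: vis_def)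
    have e: "foldl (\<lambda>vis _. grow te vis) [0] (ys @ [y]) = grow te vis" by (simp add: vis_def)
    show ?case
      unfolding e
    proof (cases "boundary te vis")
      case Nil
      have closed: "y \<in> set vis" if "x \<in> set vis" "adjacent T x y" for x y
        using set_boundary[of y te vis] Nil te that by auto
      have "set vis = verts T"
      proof
        show "set vis \<subseteq> verts T" using vis by (simp add: grown_def)
        show "verts T \<subseteq> set vis"
        proof
          fix y assume y: "y \<in> verts T"
          obtain x where x: "x \<in> set vis" using vis(1) by (cases vis) (auto simp: grown_def)
          then have "x \<in> verts T" using vis by (auto simp: grown_def)
          with y T have "(x, y) \<in> {(x, y). x \<in> verts T \<and> y \<in> verts T \<and> adjacent T x y}\<^sup>*"
            unfolding is_tree_def connected_in_def by blast
          then show "y \<in> set vis"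
          proof (induction rule: rtrancl_induct)
            case base
            show ?case by (rule x)
          next
            case (step y z)
            then show ?case using closed[of y z] by simp
          qed
        qed
      qed
      then show "grown T (grow te vis) \<and> (set (grow te vis) = verts T \<or> length (grow te vis) = Suc (length (ys @ [y])))"
        using vis Nil by (simp add: grow_def)
    next
      case (Cons c cs)
      then have c: "c \<notin> set vis" "\<exists>x\<in>set vis. adjacent T x c" using set_boundary[of c te vis] te by auto
      then obtain j where j: "j < length vis" "adjacent T (vis ! j) c" by (auto simp: in_set_conv_nth)
      have cV: "c \<in> verts T" using adjV j(2) by blast
      have "\<exists>j<i. adjacent T ((vis @ [c]) ! j) ((vis @ [c]) ! i)" if i: "i < length (vis @ [c])" "0 < i" for i
      proof (cases "i < length vis")
        case True
        then obtain j' where "j' < i" "adjacent T (vis ! j') (vis ! i)"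
          using vis(1) i(2) unfolding grown_def by blast
        then show ?thesis using True by (intro exI[of _ j']) (simp add: nth_append)
      next
        case False
        then have "i = length vis" using i(1) by simp
        then show ?thesis using j by (intro exI[of _ j]) (simp add: nth_append)
      qed
      then have "grown T (vis @ [c])"
        using vis(1) c(1) cV unfolding grown_def by simp
      moreover have "set vis \<noteq> verts T" using c(1) cV by blast
      ultimately show "grown T (grow te vis) \<and> (set (grow te vis) = verts T \<or> length (grow te vis) = Suc (length (ys @ [y])))"
        using vis(2) Cons by (simp add: grow_def)
    qed
  qed
  from g[of bags] show G: "grown T (tree_nodes te bags)" by (simp add: tree_nodes_def)
  show "set (tree_nodes te bags) = verts T"
  proof (rule ccontr)
    assume "set (tree_nodes te bags) \<noteq> verts T"
    then have "length (tree_nodes te bags) = Suc (length bags)" using g[of bags] by (simp add: tree_nodes_def)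
    then have "card (set (tree_nodes te bags)) = Suc (length bags)"
      using G distinct_card by (metis grown_def)
    moreover have "card (set (tree_nodes te bags)) \<le> card (verts T)"
      using G V by (intro card_mono) (auto simp: grown_def)
    ultimately show False using V by simp
  qed
qed

section \<open>The tables of an instance\<close>

subsection \<open>Choices\<close>

definition get :: "'a \<Rightarrow> 'a list \<Rightarrow> nat \<Rightarrow> 'a" where
  "get d xs i = (if i < length xs then xs ! i else d)"

lemma get_Nil [simp]: "get d [] i = d"
  by (simp add: get_def)

lemma get_Cons_0: "get d xs 0 = hd_or d xs"
  by (cases xs) (auto simp: get_def)

lemma get_Suc: "get d xs (Suc i) = get d (tl xs) i"
  by (cases xs) (auto simp: get_def)

lemma get_padzip: "(\<And>x. f d x = x) \<Longrightarrow> (\<And>x. f x d = x) \<Longrightarrow> get d (padzip f xs ys) i = f (get d xs i) (get d ys i)"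
proof (induction f xs ys arbitrary: i rule: padzip.induct)
  case (3 f x xs y ys)
  then show ?case by (cases i) (auto simp: get_Cons_0 get_Suc)
qed auto

lemma get_map: "i < length xs \<Longrightarrow> get d (map f xs) i = f (xs ! i)"
  by (simp add: get_def)

lemma distinct_product_lists: "(\<forall>xs\<in>set xss. distinct xs) \<Longrightarrow> distinct (product_lists xss)"
proof (induction xss)
  case (Cons xs xss)
  have "distinct xs \<Longrightarrow> distinct (concat (map (\<lambda>x. map (Cons x) (product_lists xss)) xs))"
    using Cons by (induction xs) (auto simp: distinct_map)
  then show ?case using Cons.prems by simp
qed simp

lemma sum_list_of_bool: "distinct xs \<Longrightarrow> sum_list (map (\<lambda>x. of_bool (R x)) xs) = card {x \<in> set xs. R x}"
proof -
  assume d: "distinct xs"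
  have "sum_list (map (\<lambda>x. of_bool (R x)) xs) = (\<Sum>x\<in>set xs. of_bool (R x) :: nat)"
    by (rule sum_list_distinct_conv_sum_set[OF d])
  also have "\<dots> = card {x \<in> set xs. R x}" by (simp add: of_bool_def sum.If_cases Int_def)
  finally show ?thesis .
qed

context elimination
begin

lemma val_append: "val (fs @ gs) h = val fs (\<lambda>k. val gs (\<lambda>k'. h (comb k k')))"
  by (induction fs arbitrary: h) (auto simp: comb_assoc)

lemma accept_iff:
  "accept good (\<lambda>cs. \<Phi> (get 0 cs)) us k = of_bool ((\<forall>i<length us. good (us ! i) (get absent (fst k) i)) \<and>
     \<Phi> (\<lambda>j. get 0 (snd k) j + (\<Sum>i<length us. get 0 (xc (get absent (fst k) i)) j)))"
proof (induction us arbitrary: k)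
  case (Cons v us)
  have h: "get absent (fst k) 0 = headof k" by (simp add: get_Cons_0 headof_def)
  have t: "get absent (fst (drop_key k)) i = get absent (fst k) (Suc i)" for i
    by (simp add: get_Suc drop_key_def)
  have c: "get 0 (snd (drop_key k)) j = get 0 (snd k) j + get 0 (xc (get absent (fst k) 0)) j" for j
    unfolding h by (simp add: drop_key_def get_padzip)
  have "(\<forall>i<length (v # us). good ((v # us) ! i) (get absent (fst k) i)) \<longleftrightarrow>
      good v (headof k) \<and> (\<forall>i<length us. good (us ! i) (get absent (fst k) (Suc i)))"
    by (auto simp: less_Suc_eq_0_disj h)
  then show ?case
    by (simp add: Cons ext_def t c sum.lessThan_Suc_shift add.assoc comp_def del: sum.lessThan_Suc)
qed simp

lemma get_foldr_comb:
  "get absent (fst (foldr comb ks ([], []))) i = foldr op (map (\<lambda>k. get absent (fst k) i) ks) absent"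
  "get 0 (snd (foldr comb ks ([], []))) j = sum_list (map (\<lambda>k. get 0 (snd k) j) ks)"
  by (induction ks) (auto simp: comb_def get_padzip)

lemma foldr_op_absent: "op (foldr op xs absent) y = foldr op xs y"
  by (induction xs) (auto simp: op_assoc)

lemma val_two_choices:
  fixes R defines "h \<equiv> \<lambda>k. of_bool (R k)"
  assumes "\<And>i. i \<in> set is \<Longrightarrow> distinct (ch i)" "\<And>i. i \<in> set js \<Longrightarrow> distinct (ch' i)"
  shows "val (map (\<lambda>i. map (\<lambda>x. (ent i x, 1)) (ch i)) is @ map (\<lambda>i. map (\<lambda>x. (ent' i x, 1)) (ch' i)) js) h =
    card {(xs, ys). list_all2 (\<lambda>x i. x \<in> set (ch i)) xs is \<and> list_all2 (\<lambda>y j. y \<in> set (ch' j)) ys js \<and>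
       R (comb (foldr comb (map2 ent is xs) ([], [])) (foldr comb (map2 ent' js ys) ([], [])))}"
proof -
  let ?A = "product_lists (map ch is)" and ?B = "product_lists (map ch' js)"
  let ?k = "\<lambda>xs ys. comb (foldr comb (map2 ent is xs) ([], [])) (foldr comb (map2 ent' js ys) ([], []))"
  have d: "distinct ?A" "distinct ?B" using assms by (auto intro!: distinct_product_lists)
  have "val (map (\<lambda>i. map (\<lambda>x. (ent i x, 1)) (ch i)) is @ map (\<lambda>i. map (\<lambda>x. (ent' i x, 1)) (ch' i)) js) h
    = (\<Sum>xs\<leftarrow>?A. \<Sum>ys\<leftarrow>?B. of_bool (R (?k xs ys)))"
    unfolding val_append val_choices h_def ..
  also have "\<dots> = (\<Sum>xs\<leftarrow>?A. card {ys \<in> set ?B. R (?k xs ys)})"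
    by (simp add: sum_list_of_bool[OF d(2)])
  also have "\<dots> = (\<Sum>xs\<in>set ?A. card {ys \<in> set ?B. R (?k xs ys)})"
    by (rule sum_list_distinct_conv_sum_set[OF d(1)])
  also have "\<dots> = card (SIGMA xs:set ?A. {ys \<in> set ?B. R (?k xs ys)})"
    by (rule card_SigmaI[symmetric]) auto
  also have "(SIGMA xs:set ?A. {ys \<in> set ?B. R (?k xs ys)}) =
    {(xs, ys). list_all2 (\<lambda>x i. x \<in> set (ch i)) xs is \<and> list_all2 (\<lambda>y j. y \<in> set (ch' j)) ys js \<and> R (?k xs ys)}"
    by (auto simp: product_lists_set list_all2_map2)
  finally show ?thesis .
qed

end


subsection \<open>Vertex states\<close>

text \<open>
  The state of a vertex in a partial solution: absent from it, claimed with conflicting labels, or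
  present with its membership in the vertex sets, the guessed truth values of the modal subformulas,
  and the numbers of neighbours counted so far for each of them (up to the period of the
  recognizable sets).
\<close>

datatype vstate = Absent | Conflict | State "bool list" "bool list" "nat list"

instantiation vstate :: encodable
begin
primrec enc_vstate where
  "enc_vstate Absent = Nul"
| "enc_vstate Conflict = Cell Nul Nul"
| "enc_vstate (State xb tb c) = Cell (Cell Nul Nul) (enc (xb, tb, c))"
instance
proof
  fix x y :: vstate
  show "enc x = enc y \<Longrightarrow> x = y" by (cases x; cases y) (auto simp: enc_eq_iff)
qed
end

primrec body :: "cml \<Rightarrow> cml" where
  "body (Dia S \<psi>) = \<psi>"
| "body (Box S \<psi>) = CNot \<psi>"
| "body (XVar i) = XVar i" | "body (YVar i) = YVar i" | "body Down = Down" | "body Up = Up"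
| "body (CNot \<psi>) = \<psi>" | "body (CAnd \<psi> \<chi>) = \<psi>" | "body (COr \<psi> \<chi>) = \<psi>"
| "body (CImp \<psi> \<chi>) = \<psi>" | "body (CIff \<psi> \<chi>) = \<psi>"

fun accepts :: "cml \<Rightarrow> nat \<Rightarrow> bool" where
  "accepts (Dia S \<psi>) n \<longleftrightarrow> n \<in> S"
| "accepts (Box S \<psi>) n \<longleftrightarrow> n \<notin> S"
| "accepts _ n \<longleftrightarrow> False"

text \<open>Evaluation of a formula, given the truth values \<open>tr\<close> of its outermost modal subformulas.\<close>

primrec evb :: "cml \<Rightarrow> (nat \<Rightarrow> bool) \<Rightarrow> (cml \<Rightarrow> bool) \<Rightarrow> (nat \<Rightarrow> bool) \<Rightarrow> bool \<Rightarrow> bool \<Rightarrow> bool" where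
  "evb (XVar i) xs tr ys dn up \<longleftrightarrow> xs i"
| "evb (YVar j) xs tr ys dn up \<longleftrightarrow> ys j"
| "evb Down xs tr ys dn up \<longleftrightarrow> dn"
| "evb Up xs tr ys dn up \<longleftrightarrow> up"
| "evb (CNot \<psi>) xs tr ys dn up \<longleftrightarrow> \<not> evb \<psi> xs tr ys dn up"
| "evb (CAnd \<psi> \<chi>) xs tr ys dn up \<longleftrightarrow> evb \<psi> xs tr ys dn up \<and> evb \<chi> xs tr ys dn up"
| "evb (COr \<psi> \<chi>) xs tr ys dn up \<longleftrightarrow> evb \<psi> xs tr ys dn up \<or> evb \<chi> xs tr ys dn up"
| "evb (CImp \<psi> \<chi>) xs tr ys dn up \<longleftrightarrow> (evb \<psi> xs tr ys dn up \<longrightarrow> evb \<chi> xs tr ys dn up)"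
| "evb (CIff \<psi> \<chi>) xs tr ys dn up \<longleftrightarrow> (evb \<psi> xs tr ys dn up \<longleftrightarrow> evb \<chi> xs tr ys dn up)"
| "evb (Dia S \<psi>) xs tr ys dn up \<longleftrightarrow> tr (Dia S \<psi>)"
| "evb (Box S \<psi>) xs tr ys dn up \<longleftrightarrow> tr (Box S \<psi>)"

type_synonym label = "bool list \<times> bool list"
type_synonym pair_choice = "label \<times> label \<times> bool list \<times> bool list"

locale machine =
  fixes T P p q nX nY :: nat and \<psi> :: cml and ms :: "cml list"
  assumes T_pos: "T > 0" and P_pos: "P > 0" and distinct_ms: "distinct ms"
begin

abbreviation "d \<equiv> length ms"

definition red :: "nat \<Rightarrow> nat" where
  "red n = (if n < T then n else T + (n - T) mod P)"

lemma red_add: "red (red a + b) = red (a + b)"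
proof (cases "a < T")
  case False
  have "(T + (a - T) mod P + b - T) mod P = ((a - T) mod P + b) mod P" by simp
  also have "\<dots> = (a - T + b) mod P" by (rule mod_add_left_eq)
  also have "a - T + b = a + b - T" using False by simp
  finally show ?thesis using False by (simp add: red_def)
qed (simp add: red_def)

lemma red_less: "red n < T + P"
  using P_pos by (simp add: red_def trans_less_add1)

lemma red_0 [simp]: "red 0 = 0"
  using T_pos by (simp add: red_def)

fun combine :: "vstate \<Rightarrow> vstate \<Rightarrow> vstate" where
  "combine Absent y = y"
| "combine x Absent = x"
| "combine (State a b c) (State a' b' c') =
     (if a = a' \<and> b = b' then State a b (padzip (\<lambda>m n. red (m + n)) c c') else Conflict)"
| "combine _ _ = Conflict"

lemma combine_simps [simp]: "combine x Absent = x" "combine Conflict x = Conflict" "combine x Conflict = Conflict"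
  by (cases x; simp)+

lemma red_add2: "red (a + red b) = red (a + b)"
  using red_add[of b a] by (simp add: add.commute)

lemma combine_assoc: "combine (combine x y) z = combine x (combine y z)"
  by (cases x; cases y; cases z) (auto simp: padzip_assoc red_add red_add2 add.assoc)

lemma combine_commute: "combine x y = combine y x"
  by (cases x; cases y) (auto intro!: padzip_commute simp: add.commute)

definition states :: "vstate set" where
  "states = {Absent, Conflict} \<union> {State a b c | a b c. length a = p \<and> length b = d \<and> length c = d \<and> set c \<subseteq> {..<T + P}}"

lemma finite_states: "finite states"
proof (rule finite_subset)
  let ?A = "{a :: bool list. set a \<subseteq> UNIV \<and> length a = p} \<times> {b :: bool list. set b \<subseteq> UNIV \<and> length b = d} \<times>
       {c. set c \<subseteq> {..<T + P} \<and> length c = d}"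
  show "states \<subseteq> insert Absent (insert Conflict ((\<lambda>r. State (fst r) (fst (snd r)) (snd (snd r))) ` ?A))"
  proof
    fix s assume s: "s \<in> states"
    show "s \<in> insert Absent (insert Conflict ((\<lambda>r. State (fst r) (fst (snd r)) (snd (snd r))) ` ?A))"
    proof (cases s)
      case (State a b c)
      with s have "(a, b, c) \<in> ?A" by (simp add: states_def)
      then show ?thesis unfolding State by (intro insertI2 image_eqI[of _ _ "(a, b, c)"]) simp_all
    qed simp_all
  qed
  show "finite (insert Absent (insert Conflict ((\<lambda>r. State (fst r) (fst (snd r)) (snd (snd r))) ` ?A)))"
    by (intro finite.insertI finite_imageI finite_cartesian_product finite_lists_length_eq) simp_all
qed

lemma combine_states:
  assumes x: "x \<in> states" and y: "y \<in> states" shows "combine x y \<in> states"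
proof (cases "x = Absent \<or> y = Absent \<or> x = Conflict \<or> y = Conflict")
  case True
  have "Conflict \<in> states" by (simp add: states_def)
  with True x y show ?thesis by auto
next
  case False
  then obtain a b c a' b' c' where xy: "x = State a b c" "y = State a' b' c'" by (metis vstate.exhaust)
  have "n < T + P" if "n \<in> set (padzip (\<lambda>m n. red (m + n)) c c')" for n
  proof -
    have "n \<in> set c \<union> set c' \<or> (\<exists>k. n = red k)"
      using subsetD[OF set_padzip that] by blast
    then show ?thesis using x y red_less unfolding xy states_def by auto
  qed
  then have "set (padzip (\<lambda>m n. red (m + n)) c c') \<subseteq> {..<T + P}" by auto
  then show ?thesis using x y unfolding xy by (simp add: states_def)
qed

definition xcards :: "vstate \<Rightarrow> nat list" where
  "xcards s = (case s of State a b c \<Rightarrow> map of_bool a | _ \<Rightarrow> [])"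

definition branching :: nat where "branching = (2 ^ p * 2 ^ d) * ((2 ^ p * 2 ^ d) * (2 ^ q * 2 ^ q))"

sublocale elimination combine Absent states xcards "p + q" branching
proof
  show "combine (combine x y) z = combine x (combine y z)" for x y z by (rule combine_assoc)
  show "combine x y = combine y x" for x y by (rule combine_commute)
  show "combine Absent x = x" for x by simp
  show "finite states" by (rule finite_states)
  show "Absent \<in> states" by (simp add: states_def)
  show "x \<in> states \<Longrightarrow> y \<in> states \<Longrightarrow> combine x y \<in> states" for x y by (rule combine_states)
  show "x \<in> states \<Longrightarrow> length (xcards x) \<le> p + q" for x
    by (cases x) (simp_all add: xcards_def states_def)
  show "x \<in> states \<Longrightarrow> n \<in> set (xcards x) \<Longrightarrow> n \<le> 1" for x n
    by (cases x) (auto simp: xcards_def)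
  show "0 < branching" by (simp add: branching_def)
qed

definition truth :: "bool list \<Rightarrow> cml \<Rightarrow> bool" where
  "truth tb \<mu> = (map_of (zip ms tb) \<mu> = Some True)"

lemma truth_nth: "length tb = d \<Longrightarrow> j < d \<Longrightarrow> truth tb (ms ! j) = tb ! j"
  using distinct_ms by (simp add: truth_def map_of_zip_nth)

definition eval_at :: "cml \<Rightarrow> label \<Rightarrow> bool list \<Rightarrow> bool \<Rightarrow> bool \<Rightarrow> bool" where
  "eval_at \<chi> l yb dn up = evb \<chi> ((!) (fst l)) (truth (snd l)) ((!) yb) dn up"

text \<open>
  What a neighbour labelled \<open>l\<close> contributes to the counters of a vertex, if there is an arc to
  (\<open>f\<close>) or from (\<open>b\<close>) the neighbour, in the edge sets given by \<open>y\<close> and \<open>y'\<close>.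
\<close>

definition contribution :: "bool \<Rightarrow> bool list \<Rightarrow> bool \<Rightarrow> bool list \<Rightarrow> label \<Rightarrow> nat list" where
  "contribution f y b y' l = map (\<lambda>\<mu>. of_bool (f \<and> eval_at (body \<mu>) l y True False \<or>
     b \<and> eval_at (body \<mu>) l y' False True)) ms"

definition labels :: "label list" where
  "labels = List.product (List.n_lists p [True, False]) (List.n_lists d [True, False])"

lemma set_labels: "l \<in> set labels \<longleftrightarrow> length (fst l) = p \<and> length (snd l) = d"
  by (cases l) (auto simp: labels_def set_n_lists)

lemma distinct_labels: "distinct labels"
  unfolding labels_def by (intro distinct_product distinct_n_lists) auto

definition edge_labels :: "bool \<Rightarrow> bool list \<Rightarrow> bool list list" where
  "edge_labels f yb = (if f then filter (\<lambda>y. take nY y = yb) (List.n_lists q [True, False]) else [replicate q False])"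

lemma set_edge_labels: "y \<in> set (edge_labels f yb) \<longleftrightarrow>
    (if f then length y = q \<and> take nY y = yb else y = replicate q False)"
  by (auto simp: edge_labels_def set_n_lists)

lemma distinct_edge_labels: "distinct (edge_labels f yb)"
  unfolding edge_labels_def by (auto intro!: distinct_filter distinct_n_lists)

definition vertex_entry :: "nat list \<Rightarrow> nat \<Rightarrow> label \<Rightarrow> vstate key" where
  "vertex_entry us v l = (map (\<lambda>u. if u = v then State (fst l) (snd l) (replicate d 0) else Absent) us, [])"

definition pair_states :: "bool \<Rightarrow> bool \<Rightarrow> pair_choice \<Rightarrow> vstate \<times> vstate \<times> nat list" where
  "pair_states f b c = (let l = fst c; l' = fst (snd c); y = fst (snd (snd c)); y' = snd (snd (snd c)) in
     (State (fst l) (snd l) (contribution f y b y' l'), State (fst l') (snd l') (contribution b y' f y l),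
      replicate p 0 @ map2 (\<lambda>m n. of_bool m + of_bool n) y y'))"

definition pair_entry :: "nat list \<Rightarrow> nat \<times> nat \<Rightarrow> vstate \<times> vstate \<times> nat list \<Rightarrow> vstate key" where
  "pair_entry us pr r = (map (\<lambda>u. if u = fst pr then fst r else if u = snd pr then fst (snd r) else Absent) us, snd (snd r))"

definition pair_choices :: "bool \<Rightarrow> bool \<Rightarrow> bool list \<Rightarrow> bool list \<Rightarrow> pair_choice list" where
  "pair_choices f b yb yb' = List.product labels (List.product labels (List.product (edge_labels f yb) (edge_labels b yb')))"

lemma distinct_pair_choices: "distinct (pair_choices f b yb yb')"
  unfolding pair_choices_def by (intro distinct_product distinct_labels distinct_edge_labels)

definition good_state :: "bool list \<Rightarrow> vstate \<Rightarrow> bool" where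
  "good_state fb s = (case s of State xb tb c \<Rightarrow> take nX xb = fb \<and>
      (\<forall>j<d. tb ! j = accepts (ms ! j) (c ! j)) \<and> eval_at \<psi> (xb, tb) (replicate q False) False False
    | _ \<Rightarrow> False)"

fun counter :: "vstate \<Rightarrow> nat \<Rightarrow> nat" where
  "counter (State a b c) j = c ! j"
| "counter _ j = 0"

lemma foldr_combine:
  assumes "\<forall>s\<in>set ss. s = Absent \<or> (\<exists>a b c. s = State a b c \<and> length c = d)"
  shows "\<exists>c. foldr combine ss (State xb tb (replicate d 0)) =
      (if \<forall>s\<in>set ss. s = Absent \<or> (\<exists>c. s = State xb tb c) then State xb tb c else Conflict) \<and>
    length c = d \<and> (\<forall>j<d. c ! j = red (sum_list (map (\<lambda>s. counter s j) ss)))"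
  using assms
proof (induction ss)
  case Nil
  show ?case by (rule exI[of _ "replicate d 0"]) simp
next
  case (Cons s ss)
  then obtain c where c: "foldr combine ss (State xb tb (replicate d 0)) =
      (if \<forall>s\<in>set ss. s = Absent \<or> (\<exists>c. s = State xb tb c) then State xb tb c else Conflict)"
    "length c = d" "\<forall>j<d. c ! j = red (sum_list (map (\<lambda>s. counter s j) ss))" by auto
  show ?case
  proof (cases s)
    case Absent
    then show ?thesis using c by (intro exI[of _ c]) auto
  next
    case Conflict
    then show ?thesis using Cons.prems by simp
  next
    case (State a b c')
    then have l: "length c' = d" using Cons.prems by auto
    have nth: "padzip (\<lambda>m n. red (m + n)) c' c ! j = red (sum_list (map (\<lambda>s. counter s j) (s # ss)))" if "j < d" for j
    proof -
      have "padzip f xs ys ! j = f (xs ! j) (ys ! j)" if "j < length xs" "length xs = length ys" for f and xs ys :: "nat list" and j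
        using that by (induction f xs ys arbitrary: j rule: padzip.induct) (auto simp: nth_Cons split: nat.split)
      from this[of j c' c] show ?thesis using that l c(2,3) State by (simp add: red_add2)
    qed
    show ?thesis
      by (rule exI[of _ "padzip (\<lambda>m n. red (m + n)) c' c"]) (use State c l nth in auto)
  qed
qed

lemma good_foldr_combine:
  assumes ss: "\<forall>s\<in>set ss. s = Absent \<or> (\<exists>a b c. s = State a b c \<and> length c = d)"
  shows "good_state fb (foldr combine ss (State xb tb (replicate d 0))) \<longleftrightarrow>
    (\<forall>s\<in>set ss. s = Absent \<or> (\<exists>c. s = State xb tb c)) \<and> take nX xb = fb \<and>
    (\<forall>j<d. tb ! j = accepts (ms ! j) (red (sum_list (map (\<lambda>s. counter s j) ss)))) \<and>
    eval_at \<psi> (xb, tb) (replicate q False) False False"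
proof -
  obtain c where c: "foldr combine ss (State xb tb (replicate d 0)) =
      (if \<forall>s\<in>set ss. s = Absent \<or> (\<exists>c. s = State xb tb c) then State xb tb c else Conflict)"
    "\<forall>j<d. c ! j = red (sum_list (map (\<lambda>s. counter s j) ss))"
    using foldr_combine[OF ss] by blast
  show ?thesis unfolding c(1) using c(2) by (auto simp: good_state_def)
qed

lemma xcards_foldr_combine:
  assumes ss: "\<forall>s\<in>set ss. s = Absent \<or> (\<exists>a b c. s = State a b c \<and> length c = d)"
    and g: "good_state fb (foldr combine ss (State xb tb (replicate d 0)))"
  shows "xcards (foldr combine ss (State xb tb (replicate d 0))) = map of_bool xb"
proof -
  obtain c where c: "foldr combine ss (State xb tb (replicate d 0)) =
      (if \<forall>s\<in>set ss. s = Absent \<or> (\<exists>c. s = State xb tb c) then State xb tb c else Conflict)"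
    using foldr_combine[OF ss] by blast
  show ?thesis using g unfolding c by (auto simp: good_state_def xcards_def split: if_splits)
qed

end

subsection \<open>Solutions correspond to accepted choices\<close>

primrec mods :: "cml \<Rightarrow> cml list" where
  "mods (XVar i) = []" | "mods (YVar i) = []" | "mods Down = []" | "mods Up = []"
| "mods (CNot \<psi>) = mods \<psi>"
| "mods (CAnd \<psi> \<chi>) = mods \<psi> @ mods \<chi>"
| "mods (COr \<psi> \<chi>) = mods \<psi> @ mods \<chi>"
| "mods (CImp \<psi> \<chi>) = mods \<psi> @ mods \<chi>"
| "mods (CIff \<psi> \<chi>) = mods \<psi> @ mods \<chi>"
| "mods (Dia S \<psi>) = Dia S \<psi> # mods \<psi>"
| "mods (Box S \<psi>) = Box S \<psi> # mods \<psi>"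

definition modal :: "cml \<Rightarrow> bool" where
  "modal \<mu> \<longleftrightarrow> (\<exists>S \<chi>. \<mu> = Dia S \<chi> \<or> \<mu> = Box S \<chi>)"

lemma mods_body:
  "\<mu> \<in> set (mods \<chi>) \<Longrightarrow> wf_cml dr p q inner \<chi> \<Longrightarrow>
     modal \<mu> \<and> wf_cml dr p q True (body \<mu>) \<and> set (mods (body \<mu>)) \<subseteq> set (mods \<chi>)"
  by (induction \<chi> arbitrary: inner) (auto simp: modal_def)

primrec index_set :: "cml \<Rightarrow> nat set" where
  "index_set (Dia S \<psi>) = S" | "index_set (Box S \<psi>) = S"
| "index_set (XVar i) = {}" | "index_set (YVar i) = {}" | "index_set Down = {}" | "index_set Up = {}"
| "index_set (CNot \<psi>) = {}" | "index_set (CAnd \<psi> \<chi>) = {}" | "index_set (COr \<psi> \<chi>) = {}"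
| "index_set (CImp \<psi> \<chi>) = {}" | "index_set (CIff \<psi> \<chi>) = {}"

lemma mods_recognizable:
  "\<mu> \<in> set (mods \<chi>) \<Longrightarrow> wf_cml dr p q inner \<chi> \<Longrightarrow> finitely_recognizable (index_set \<mu>)"
  by (induction \<chi> arbitrary: inner) auto

fun arc :: "edge \<Rightarrow> nat \<times> nat" where
  "arc (Undirected e) = (Min e, Max e)"
| "arc (Directed u v) = (u, v)"

locale machine_instance = machine +
  fixes dr :: bool and G :: graph and FXs :: "nat set list" and FYs :: "edge set list"
    and us :: "nat list" and es prs :: "(nat \<times> nat) list" and kX kY :: nat
    and \<Phi> :: "(nat \<Rightarrow> nat) \<Rightarrow> bool" and \<phi> :: arith and ks :: "int list"
  assumes graph: "if dr then directed_graph G else undirected_graph G"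
    and us: "distinct us" "set us = verts G"
    and es: "set es = arc ` edges G"
    and prs: "distinct prs" "set prs = {pr. fst pr < snd pr \<and> (pr \<in> set es \<or> (snd pr, fst pr) \<in> set es)}"
    and FXs: "length FXs = nX" "\<forall>X\<in>set FXs. X \<subseteq> verts G"
    and FYs: "length FYs = nY" "\<forall>Y\<in>set FYs. Y \<subseteq> edges G"
    and p: "p = nX + kX" and q: "q = nY + kY"
    and wf: "wf_cml dr p q False \<psi>" and ms: "set ms = set (mods \<psi>)"
    and red: "\<mu> \<in> set ms \<Longrightarrow> accepts \<mu> (red n) = accepts \<mu> n"
    and \<Phi>: "\<lbrakk>length Xs = p; length Ys = q; \<And>i. i < p \<Longrightarrow> g i = card (Xs ! i); \<And>j. j < q \<Longrightarrow> g (p + j) = card (Ys ! j)\<rbrakk>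
         \<Longrightarrow> \<Phi> g = aholds G ks Xs Ys \<phi>"
begin

abbreviation "V \<equiv> verts G"
abbreviation "E \<equiv> edges G"

lemma edge_directed: "dr \<Longrightarrow> e \<in> E \<Longrightarrow> \<exists>u v. e = Directed u v \<and> u \<in> V \<and> v \<in> V \<and> u \<noteq> v"
  using graph by (auto simp: directed_graph_def)

lemma edge_undirected: "\<not> dr \<Longrightarrow> e \<in> E \<Longrightarrow> \<exists>s. e = Undirected s \<and> s \<subseteq> V \<and> card s = 2"
  using graph by (auto simp: undirected_graph_def)

lemma edge_cases:
  assumes "e \<in> E"
  obtains u v where "arc e = (u, v)" "ends e = {u, v}" "u \<noteq> v" "u \<in> V" "v \<in> V"
    "dr \<Longrightarrow> points_to e u = False" "dr \<Longrightarrow> points_to e v = True"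
proof (cases dr)
  case True
  then obtain u v where "e = Directed u v" "u \<in> V" "v \<in> V" "u \<noteq> v"
    using graph assms by (auto simp: directed_graph_def)
  then show thesis using that[of u v] by simp
next
  case False
  then obtain s where s: "e = Undirected s" "s \<subseteq> V" "card s = 2"
    using graph assms by (auto simp: undirected_graph_def)
  then obtain a b where ab: "s = {a, b}" "a \<noteq> b" by (meson card_2_iff)
  have "Min s \<in> s" "Max s \<in> s" using ab by (auto intro!: Min_in Max_in)
  moreover have "Min s \<noteq> Max s" "{Min s, Max s} = s" using ab by (auto simp: min_def max_def)
  ultimately show thesis using that[of "Min s" "Max s"] s False by auto
qed

lemma finite_E: "finite E"
proof -
  have V: "finite V" using us(2) by (metis List.finite_set)
  show ?thesis
  proof (cases dr)
    case True
    have "E \<subseteq> (\<lambda>a. Directed (fst a) (snd a)) ` (V \<times> V)"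
    proof
      fix e assume "e \<in> E"
      with True graph obtain u v where "e = Directed u v" "u \<in> V" "v \<in> V"
        unfolding directed_graph_def by auto
      then show "e \<in> (\<lambda>a. Directed (fst a) (snd a)) ` (V \<times> V)"
        by (intro image_eqI[of _ _ "(u, v)"]) simp_all
    qed
    then show ?thesis using V by (meson finite_SigmaI finite_imageI finite_subset)
  next
    case False
    then have "E \<subseteq> Undirected ` Pow V" using graph unfolding undirected_graph_def by auto
    then show ?thesis using V by (meson finite_Pow_iff finite_imageI finite_subset)
  qed
qed

lemma inj_arc: "inj_on arc E"
proof (rule inj_onI)
  fix e e' assume e: "e \<in> E" "e' \<in> E" "arc e = arc e'"
  obtain u v where u: "arc e = (u, v)" "ends e = {u, v}" using edge_cases[OF e(1)] by metis
  obtain u' v' where u': "arc e' = (u', v')" "ends e' = {u', v'}" using edge_cases[OF e(2)] by metis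
  have "ends e = ends e'" using u u' e(3) by simp
  show "e = e'"
  proof (cases dr)
    case True
    then obtain a b a' b' where "e = Directed a b" "e' = Directed a' b'"
      using edge_directed[OF True e(1)] edge_directed[OF True e(2)] by blast
    then show ?thesis using e(3) by simp
  next
    case False
    then obtain s s' where "e = Undirected s" "e' = Undirected s'"
      using edge_undirected[OF False e(1)] edge_undirected[OF False e(2)] by blast
    then show ?thesis using \<open>ends e = ends e'\<close> by simp
  qed
qed

lemma arc_mem: "Y \<subseteq> E \<Longrightarrow> e \<in> E \<Longrightarrow> arc e \<in> arc ` Y \<longleftrightarrow> e \<in> Y"
  using inj_arc by (auto simp: inj_on_def)

lemma es_irrefl: "(u, u) \<notin> set es"
proof
  assume "(u, u) \<in> set es"
  then obtain e where e: "e \<in> E" "arc e = (u, u)" unfolding es by auto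
  show False by (rule edge_cases[OF e(1)]) (use e(2) in simp)
qed

lemma ends_iff:
  assumes "e \<in> E" shows "ends e = {v, w} \<longleftrightarrow> arc e = (v, w) \<or> arc e = (w, v)"
proof -
  obtain a b where "arc e = (a, b)" "ends e = {a, b}" using edge_cases[OF assms] by metis
  then show ?thesis by (auto simp: doubleton_eq_iff)
qed

lemma prs_es: "pr \<in> set prs \<Longrightarrow> pr \<in> set es \<or> (snd pr, fst pr) \<in> set es"
  and prs_less: "pr \<in> set prs \<Longrightarrow> fst pr < snd pr"
  using prs(2) by auto

definition pair_info :: "(nat \<times> nat) \<Rightarrow> bool list" where
  "pair_info a = map (\<lambda>Y. a \<in> arc ` Y) FYs"

definition vertex_info :: "nat \<Rightarrow> bool list" where
  "vertex_info v = map (\<lambda>X. v \<in> X) FXs"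

abbreviation "swap pr \<equiv> (snd pr, fst pr)"

definition choices :: "(nat \<times> nat) \<Rightarrow> pair_choice list" where
  "choices pr = pair_choices (pr \<in> set es) (swap pr \<in> set es) (pair_info pr) (pair_info (swap pr))"

abbreviation "pstates \<kappa> pr \<equiv> pair_states (pr \<in> set es) (swap pr \<in> set es) (\<kappa> pr)"

definition total :: "(nat \<Rightarrow> label) \<Rightarrow> ((nat \<times> nat) \<Rightarrow> pair_choice) \<Rightarrow> vstate key" where
  "total lam \<kappa> = comb (foldr comb (map (\<lambda>v. vertex_entry us v (lam v)) us) ([], []))
     (foldr comb (map (\<lambda>pr. pair_entry us pr (pstates \<kappa> pr)) prs) ([], []))"

definition accepted :: "vstate key \<Rightarrow> bool" where
  "accepted k \<longleftrightarrow> (\<forall>i<length us. good_state (vertex_info (us ! i)) (get Absent (fst k) i)) \<and>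
     \<Phi> (\<lambda>j. get 0 (snd k) j + (\<Sum>i<length us. get 0 (xcards (get Absent (fst k) i)) j))"

definition pstate :: "((nat \<times> nat) \<Rightarrow> pair_choice) \<Rightarrow> nat \<Rightarrow> (nat \<times> nat) \<Rightarrow> vstate" where
  "pstate \<kappa> v pr = (if v = fst pr then fst (pstates \<kappa> pr) else if v = snd pr then fst (snd (pstates \<kappa> pr)) else Absent)"

definition vstate_of :: "(nat \<Rightarrow> label) \<Rightarrow> ((nat \<times> nat) \<Rightarrow> pair_choice) \<Rightarrow> nat \<Rightarrow> vstate" where
  "vstate_of lam \<kappa> v = foldr combine (map (pstate \<kappa> v) prs) (State (fst (lam v)) (snd (lam v)) (replicate d 0))"

lemma foldr_single:
  "distinct xs \<Longrightarrow> x \<in> set xs \<Longrightarrow> foldr combine (map (\<lambda>v. if x = v then f v else Absent) xs) Absent = f x"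
proof (induction xs)
  case (Cons y xs)
  have "x \<notin> set xs \<Longrightarrow> foldr combine (map (\<lambda>v. if x = v then f v else Absent) xs) Absent = Absent"
    by (induction xs) auto
  then show ?case using Cons by auto
qed simp

lemma get_comb:
  "get Absent (fst (comb k k')) i = combine (get Absent (fst k) i) (get Absent (fst k') i)"
  "get 0 (snd (comb k k')) j = get 0 (snd k) j + get 0 (snd k') j"
  by (simp_all add: comb_def get_padzip)

lemma get_total: "i < length us \<Longrightarrow> get Absent (fst (total lam \<kappa>)) i = vstate_of lam \<kappa> (us ! i)"
proof -
  assume i: "i < length us"
  have v: "(\<lambda>v. get Absent (fst (vertex_entry us v (lam v))) i) =
      (\<lambda>v. if us ! i = v then State (fst (lam v)) (snd (lam v)) (replicate d 0) else Absent)"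
    by (rule ext) (simp add: vertex_entry_def get_map[OF i])
  have p: "(\<lambda>pr. get Absent (fst (pair_entry us pr (pstates \<kappa> pr))) i) = pstate \<kappa> (us ! i)"
    by (rule ext) (simp add: pair_entry_def get_map[OF i] pstate_def)
  have "get Absent (fst (total lam \<kappa>)) i =
     combine (foldr combine (map (\<lambda>v. get Absent (fst (vertex_entry us v (lam v))) i) us) Absent)
      (foldr combine (map (\<lambda>pr. get Absent (fst (pair_entry us pr (pstates \<kappa> pr))) i) prs) Absent)"
    unfolding total_def get_comb get_foldr_comb map_map comp_def ..
  also have "\<dots> = vstate_of lam \<kappa> (us ! i)"
    unfolding v p foldr_single[OF us(1) nth_mem[OF i]] vstate_of_def
    by (subst combine_commute) (rule foldr_op_absent)
  finally show ?thesis .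
qed

lemma get_total_cards:
  "get 0 (snd (total lam \<kappa>)) j = (\<Sum>pr\<leftarrow>prs. get 0 (snd (snd (pstates \<kappa> pr))) j)"
proof -
  have "get 0 (snd (total lam \<kappa>)) j = (\<Sum>v\<leftarrow>us. get 0 (snd (vertex_entry us v (lam v))) j) +
      (\<Sum>pr\<leftarrow>prs. get 0 (snd (pair_entry us pr (pstates \<kappa> pr))) j)"
    unfolding total_def get_comb get_foldr_comb map_map comp_def ..
  then show ?thesis by (simp add: vertex_entry_def pair_entry_def)
qed

definition consistent :: "(nat \<Rightarrow> label) \<Rightarrow> ((nat \<times> nat) \<Rightarrow> pair_choice) \<Rightarrow> bool" where
  "consistent lam \<kappa> \<longleftrightarrow> (\<forall>pr\<in>set prs. fst (\<kappa> pr) = lam (fst pr) \<and> fst (snd (\<kappa> pr)) = lam (snd pr))"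

lemma es_V: "(a, b) \<in> set es \<Longrightarrow> a \<in> V \<and> b \<in> V"
proof -
  assume "(a, b) \<in> set es"
  then obtain e where e: "e \<in> E" "arc e = (a, b)" unfolding es by auto
  show ?thesis by (rule edge_cases[OF e(1)]) (use e(2) in simp)
qed

lemma prs_V: "pr \<in> set prs \<Longrightarrow> fst pr \<in> V \<and> snd pr \<in> V"
  using prs_es[of pr] es_V[of "fst pr" "snd pr"] es_V[of "snd pr" "fst pr"] by auto

lemma pstate_shape: "\<forall>s\<in>set (map (pstate \<kappa> v) prs). s = Absent \<or> (\<exists>a b c. s = State a b c \<and> length c = d)"
  by (auto simp: pstate_def pair_states_def contribution_def Let_def)

lemma pstate_consistent:
  "(\<forall>v\<in>V. \<forall>s\<in>set (map (pstate \<kappa> v) prs). s = Absent \<or> (\<exists>c. s = State (fst (lam v)) (snd (lam v)) c)) \<longleftrightarrow>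
    consistent lam \<kappa>"
proof -
  have 1: "(\<forall>v\<in>V. pstate \<kappa> v pr = Absent \<or> (\<exists>c. pstate \<kappa> v pr = State (fst (lam v)) (snd (lam v)) c)) \<longleftrightarrow>
    fst (\<kappa> pr) = lam (fst pr) \<and> fst (snd (\<kappa> pr)) = lam (snd pr)" if "pr \<in> set prs" for pr
  proof -
    obtain u w where pr: "pr = (u, w)" by fastforce
    have uw: "u \<in> V" "w \<in> V" "u \<noteq> w" using prs_V[OF that] prs_less[OF that] pr by simp_all
    have "pstate \<kappa> u pr = State (fst (fst (\<kappa> pr))) (snd (fst (\<kappa> pr))) (contribution (pr \<in> set es)
        (fst (snd (snd (\<kappa> pr)))) (swap pr \<in> set es) (snd (snd (snd (\<kappa> pr)))) (fst (snd (\<kappa> pr))))"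
      "pstate \<kappa> w pr = State (fst (fst (snd (\<kappa> pr)))) (snd (fst (snd (\<kappa> pr)))) (contribution (swap pr \<in> set es)
        (snd (snd (snd (\<kappa> pr)))) (pr \<in> set es) (fst (snd (snd (\<kappa> pr)))) (fst (\<kappa> pr)))"
      "\<And>v. v \<noteq> u \<Longrightarrow> v \<noteq> w \<Longrightarrow> pstate \<kappa> v pr = Absent"
      using uw(3) by (simp_all add: pstate_def pair_states_def Let_def pr)
    note ps = this
    show ?thesis
    proof
      assume L: "\<forall>v\<in>V. pstate \<kappa> v pr = Absent \<or> (\<exists>c. pstate \<kappa> v pr = State (fst (lam v)) (snd (lam v)) c)"
      show "fst (\<kappa> pr) = lam (fst pr) \<and> fst (snd (\<kappa> pr)) = lam (snd pr)"
        using bspec[OF L uw(1)] bspec[OF L uw(2)] unfolding ps(1,2) by (simp add: pr prod_eq_iff)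
    next
      assume R: "fst (\<kappa> pr) = lam (fst pr) \<and> fst (snd (\<kappa> pr)) = lam (snd pr)"
      show "\<forall>v\<in>V. pstate \<kappa> v pr = Absent \<or> (\<exists>c. pstate \<kappa> v pr = State (fst (lam v)) (snd (lam v)) c)"
      proof
        fix v
        show "pstate \<kappa> v pr = Absent \<or> (\<exists>c. pstate \<kappa> v pr = State (fst (lam v)) (snd (lam v)) c)"
          by (cases "v = u"; cases "v = w") (use ps R pr in auto)
      qed
    qed
  qed
  have "(\<forall>v\<in>V. \<forall>s\<in>set (map (pstate \<kappa> v) prs). s = Absent \<or> (\<exists>c. s = State (fst (lam v)) (snd (lam v)) c)) \<longleftrightarrow>
    (\<forall>pr\<in>set prs. \<forall>v\<in>V. pstate \<kappa> v pr = Absent \<or> (\<exists>c. pstate \<kappa> v pr = State (fst (lam v)) (snd (lam v)) c))"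
    unfolding set_map ball_simps by blast
  also have "\<dots> \<longleftrightarrow> consistent lam \<kappa>"
    unfolding consistent_def by (rule ball_cong[OF refl 1])
  finally show ?thesis .
qed

definition counts :: "((nat \<times> nat) \<Rightarrow> pair_choice) \<Rightarrow> nat \<Rightarrow> nat \<Rightarrow> nat" where
  "counts \<kappa> v j = (\<Sum>pr\<leftarrow>prs. counter (pstate \<kappa> v pr) j)"

definition card_vector :: "(nat \<Rightarrow> label) \<Rightarrow> ((nat \<times> nat) \<Rightarrow> pair_choice) \<Rightarrow> nat \<Rightarrow> nat" where
  "card_vector lam \<kappa> j = (\<Sum>pr\<leftarrow>prs. get 0 (snd (snd (pstates \<kappa> pr))) j) +
     (\<Sum>v\<leftarrow>us. get 0 (map of_bool (fst (lam v))) j)"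

lemma accepted_total:
  "accepted (total lam \<kappa>) \<longleftrightarrow> consistent lam \<kappa> \<and>
     (\<forall>v\<in>V. take nX (fst (lam v)) = vertex_info v \<and>
        (\<forall>j<d. snd (lam v) ! j = accepts (ms ! j) (counts \<kappa> v j)) \<and>
        eval_at \<psi> (lam v) (replicate q False) False False) \<and>
     \<Phi> (card_vector lam \<kappa>)"
proof -
  have "good_state (vertex_info v) (vstate_of lam \<kappa> v) \<longleftrightarrow>
    (\<forall>s\<in>set (map (pstate \<kappa> v) prs). s = Absent \<or> (\<exists>c. s = State (fst (lam v)) (snd (lam v)) c)) \<and>
    take nX (fst (lam v)) = vertex_info v \<and> (\<forall>j<d. snd (lam v) ! j = accepts (ms ! j) (counts \<kappa> v j)) \<and>
    eval_at \<psi> (lam v) (replicate q False) False False" for v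
    unfolding vstate_of_def good_foldr_combine[OF pstate_shape] counts_def
    using red by (simp add: comp_def)
  then have g: "(\<forall>v\<in>V. good_state (vertex_info v) (vstate_of lam \<kappa> v)) \<longleftrightarrow> consistent lam \<kappa> \<and>
     (\<forall>v\<in>V. take nX (fst (lam v)) = vertex_info v \<and>
        (\<forall>j<d. snd (lam v) ! j = accepts (ms ! j) (counts \<kappa> v j)) \<and>
        eval_at \<psi> (lam v) (replicate q False) False False)"
    unfolding pstate_consistent[symmetric] by blast
  have s: "(\<forall>i<length us. good_state (vertex_info (us ! i)) (get Absent (fst (total lam \<kappa>)) i)) \<longleftrightarrow>
     (\<forall>v\<in>V. good_state (vertex_info v) (vstate_of lam \<kappa> v))"
    unfolding us(2)[symmetric] all_set_conv_all_nth by (simp add: get_total)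
  have "(\<lambda>j. get 0 (snd (total lam \<kappa>)) j + (\<Sum>i<length us. get 0 (xcards (get Absent (fst (total lam \<kappa>)) i)) j))
     = card_vector lam \<kappa>" if good: "\<forall>v\<in>V. good_state (vertex_info v) (vstate_of lam \<kappa> v)"
  proof
    fix j
    have x: "xcards (get Absent (fst (total lam \<kappa>)) i) = map of_bool (fst (lam (us ! i)))" if i: "i < length us" for i
    proof -
      have "us ! i \<in> V" using us(2) i nth_mem by blast
      with good have "good_state (vertex_info (us ! i)) (vstate_of lam \<kappa> (us ! i))" by blast
      from xcards_foldr_combine[OF pstate_shape this[unfolded vstate_of_def]]
      show ?thesis unfolding get_total[OF i] vstate_of_def .
    qed
    have "(\<Sum>i<length us. get 0 (xcards (get Absent (fst (total lam \<kappa>)) i)) j) =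
      (\<Sum>i<length us. get 0 (map of_bool (fst (lam (us ! i)))) j)"
      by (rule sum.cong) (simp_all add: x)
    also have "\<dots> = (\<Sum>v\<leftarrow>us. get 0 (map of_bool (fst (lam v))) j)"
      by (simp add: sum_list_sum_nth atLeast0LessThan)
    finally show "get 0 (snd (total lam \<kappa>)) j + (\<Sum>i<length us. get 0 (xcards (get Absent (fst (total lam \<kappa>)) i)) j)
      = card_vector lam \<kappa> j" by (simp add: card_vector_def get_total_cards)
  qed
  then show ?thesis unfolding accepted_def s using g by auto
qed

end

lemma accepts_sat:
  "modal \<mu> \<Longrightarrow> accepts \<mu> (card {w \<in> verts G. \<exists>e\<in>edges G. ends e = {v, w} \<and> sat (body \<mu>) G Xs Ys (Some (v, e)) w})
     = sat \<mu> G Xs Ys acc v"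
  by (auto simp: modal_def)

lemma list_eq_map:
  assumes "distinct xs" "length ys = length xs" shows "\<exists>f. ys = map f xs"
proof (intro exI nth_equalityI)
  let ?f = "\<lambda>x. the (map_of (zip xs ys) x)"
  show "length ys = length (map ?f xs)" using assms by simp
  fix i assume "i < length ys"
  then show "ys ! i = map ?f xs ! i" using assms by (simp add: map_of_zip_nth)
qed

lemma map2_map: "map2 f xs (map g xs) = map (\<lambda>x. f x (g x)) xs"
  by (induction xs) auto

context machine_instance
begin

definition kap :: "(nat \<Rightarrow> label) \<Rightarrow> (nat \<times> nat \<Rightarrow> bool list) \<Rightarrow> nat \<times> nat \<Rightarrow> pair_choice" where
  "kap lam Y pr = (lam (fst pr), lam (snd pr), Y pr, Y (swap pr))"

definition nb :: "(nat \<Rightarrow> label) \<Rightarrow> (nat \<times> nat \<Rightarrow> bool list) \<Rightarrow> cml \<Rightarrow> nat \<Rightarrow> nat \<Rightarrow> bool" where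
  "nb lam Y \<mu> v w \<longleftrightarrow> (v, w) \<in> set es \<and> eval_at (body \<mu>) (lam w) (Y (v, w)) True False \<or>
     (w, v) \<in> set es \<and> eval_at (body \<mu>) (lam w) (Y (w, v)) False True"

lemma counts_kap:
  assumes j: "j < d" shows "counts (kap lam Y) v j = card {w. nb lam Y (ms ! j) v w}"
proof -
  let ?nb = "nb lam Y (ms ! j)"
  let ?R = "\<lambda>pr. v = fst pr \<and> ?nb v (snd pr) \<or> v = snd pr \<and> ?nb v (fst pr)"
  have "counter (pstate (kap lam Y) v pr) j = of_bool (?R pr)" if "pr \<in> set prs" for pr
  proof -
    obtain u w where pr: "pr = (u, w)" by fastforce
    have "u \<noteq> w" using prs_less[OF that] pr by simp
    then show ?thesis
      using j by (simp add: pstate_def pair_states_def kap_def pr contribution_def nb_def Let_def)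
  qed
  then have "counts (kap lam Y) v j = (\<Sum>pr\<leftarrow>prs. of_bool (?R pr))"
    unfolding counts_def by (intro arg_cong[of _ _ sum_list] map_cong) auto
  also have "\<dots> = card {pr \<in> set prs. ?R pr}" by (rule sum_list_of_bool[OF prs(1)])
  also have "\<dots> = card {w. ?nb v w}"
  proof (rule bij_betw_same_card, rule bij_betw_byWitness)
    let ?f = "\<lambda>pr. if v = fst pr then snd pr else fst pr" and ?g = "\<lambda>w. if v < w then (v, w) else (w, v)"
    show "\<forall>pr\<in>{pr \<in> set prs. ?R pr}. ?g (?f pr) = pr" using prs_less by fastforce
    show "\<forall>w\<in>{w. ?nb v w}. ?f (?g w) = w" by auto
    show "?f ` {pr \<in> set prs. ?R pr} \<subseteq> {w. ?nb v w}" by auto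
    show "?g ` {w. ?nb v w} \<subseteq> {pr \<in> set prs. ?R pr}"
    proof
      fix pr assume "pr \<in> ?g ` {w. ?nb v w}"
      then obtain w where w: "?nb v w" "pr = ?g w" by auto
      then have e: "(v, w) \<in> set es \<or> (w, v) \<in> set es" by (auto simp: nb_def)
      then have "v \<noteq> w" using es_irrefl by auto
      then show "pr \<in> {pr \<in> set prs. ?R pr}" using w e by (auto simp: prs(2))
    qed
  qed
  finally show ?thesis .
qed

definition compat :: "nat set list \<Rightarrow> edge set list \<Rightarrow> (nat \<Rightarrow> label) \<Rightarrow> (nat \<times> nat \<Rightarrow> bool list) \<Rightarrow> bool" where
  "compat Xs Ys lam Y \<longleftrightarrow>
     (\<forall>v\<in>V. length (fst (lam v)) = p \<and> length (snd (lam v)) = d \<and> (\<forall>i<p. fst (lam v) ! i = (v \<in> Xs ! i))) \<and>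
     (\<forall>e\<in>E. \<forall>j<q. Y (arc e) ! j = (e \<in> Ys ! j))"

lemma eval_sat:
  assumes c: "compat Xs Ys lam Y" and w: "w \<in> V"
  shows "\<lbrakk>wf_cml dr p q inner \<chi>; \<forall>\<mu>\<in>set (mods \<chi>). truth (snd (lam w)) \<mu> = sat \<mu> G Xs Ys None w;
    inner \<Longrightarrow> \<exists>v e. acc = Some (v, e) \<and> (\<forall>j<q. yb ! j = (e \<in> Ys ! j)) \<and>
      (dr \<longrightarrow> dn = points_to e w \<and> up = points_to e v)\<rbrakk>
    \<Longrightarrow> eval_at \<chi> (lam w) yb dn up = sat \<chi> G Xs Ys acc w"
proof (induction \<chi>)
  case (XVar i)
  then show ?case using c w by (simp add: eval_at_def compat_def)
next
  case (YVar j)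
  then show ?case by (auto simp: eval_at_def)
next
  case (Dia S \<chi>)
  then show ?case by (simp add: eval_at_def)
next
  case (Box S \<chi>)
  then show ?case by (simp add: eval_at_def)
qed (auto simp: eval_at_def)

lemma nb_sat:
  assumes c: "compat Xs Ys lam Y" and wf: "wf_cml dr p q True (body \<mu>)"
    and tr: "\<forall>w\<in>V. \<forall>\<mu>'\<in>set (mods (body \<mu>)). truth (snd (lam w)) \<mu>' = sat \<mu>' G Xs Ys None w"
  shows "nb lam Y \<mu> v w \<longleftrightarrow> w \<in> V \<and> (\<exists>e\<in>E. ends e = {v, w} \<and> sat (body \<mu>) G Xs Ys (Some (v, e)) w)"
proof -
  have out: "eval_at (body \<mu>) (lam w) (Y (v, w)) True False = sat (body \<mu>) G Xs Ys (Some (v, e)) w"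
    and wV: "w \<in> V" if e: "e \<in> E" "arc e = (v, w)" for e
  proof -
    show wV: "w \<in> V" by (rule edge_cases[OF e(1)]) (use e(2) in simp)
    have y: "\<forall>j<q. Y (v, w) ! j = (e \<in> Ys ! j)" using c e unfolding compat_def by metis
    have d: "dr \<longrightarrow> True = points_to e w \<and> False = points_to e v"
      by (rule edge_cases[OF e(1)]) (use e(2) in auto)
    show "eval_at (body \<mu>) (lam w) (Y (v, w)) True False = sat (body \<mu>) G Xs Ys (Some (v, e)) w"
      by (rule eval_sat[OF c wV wf]) (use tr wV y d in auto)
  qed
  have "in": "eval_at (body \<mu>) (lam w) (Y (w, v)) False True = sat (body \<mu>) G Xs Ys (Some (v, e)) w"
    and wV': "w \<in> V" if e: "e \<in> E" "arc e = (w, v)" for e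
  proof -
    show wV: "w \<in> V" by (rule edge_cases[OF e(1)]) (use e(2) in simp)
    have y: "\<forall>j<q. Y (w, v) ! j = (e \<in> Ys ! j)" using c e unfolding compat_def by metis
    have d: "dr \<longrightarrow> False = points_to e w \<and> True = points_to e v"
      by (rule edge_cases[OF e(1)]) (use e(2) in auto)
    show "eval_at (body \<mu>) (lam w) (Y (w, v)) False True = sat (body \<mu>) G Xs Ys (Some (v, e)) w"
      by (rule eval_sat[OF c wV wf]) (use tr wV y d in auto)
  qed
  show ?thesis
  proof
    assume "nb lam Y \<mu> v w"
    then consider "(v, w) \<in> set es" "eval_at (body \<mu>) (lam w) (Y (v, w)) True False"
      | "(w, v) \<in> set es" "eval_at (body \<mu>) (lam w) (Y (w, v)) False True" unfolding nb_def by blast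
    then show "w \<in> V \<and> (\<exists>e\<in>E. ends e = {v, w} \<and> sat (body \<mu>) G Xs Ys (Some (v, e)) w)"
    proof cases
      case 1
      then obtain e where e: "e \<in> E" "arc e = (v, w)" unfolding es by (metis imageE)
      with out[OF e] wV[OF e] 1 show ?thesis using ends_iff[OF e(1), of v w] by blast
    next
      case 2
      then obtain e where e: "e \<in> E" "arc e = (w, v)" unfolding es by (metis imageE)
      with "in"[OF e] wV'[OF e] 2 show ?thesis using ends_iff[OF e(1), of v w] by blast
    qed
  next
    assume "w \<in> V \<and> (\<exists>e\<in>E. ends e = {v, w} \<and> sat (body \<mu>) G Xs Ys (Some (v, e)) w)"
    then obtain e where e: "e \<in> E" "ends e = {v, w}" "sat (body \<mu>) G Xs Ys (Some (v, e)) w" by blast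
    from e(2) consider "arc e = (v, w)" | "arc e = (w, v)" unfolding ends_iff[OF e(1)] by blast
    then show "nb lam Y \<mu> v w"
    proof cases
      case 1
      then have "(v, w) \<in> set es" using e(1) unfolding es by (metis imageI)
      then show ?thesis using out[OF e(1) 1] e(3) unfolding nb_def by blast
    next
      case 2
      then have "(w, v) \<in> set es" using e(1) unfolding es by (metis imageI)
      then show ?thesis using "in"[OF e(1) 2] e(3) unfolding nb_def by blast
    qed
  qed
qed

lemma accepts_nb:
  assumes c: "compat Xs Ys lam Y" and wf: "wf_cml dr p q True (body \<mu>)" and m: "modal \<mu>"
    and tr: "\<forall>w\<in>V. \<forall>\<mu>'\<in>set (mods (body \<mu>)). truth (snd (lam w)) \<mu>' = sat \<mu>' G Xs Ys None w"
  shows "accepts \<mu> (card {w. nb lam Y \<mu> v w}) = sat \<mu> G Xs Ys None v"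
  unfolding nb_sat[OF c wf tr] by (rule accepts_sat[OF m])

lemma ms_wf: "\<mu> \<in> set ms \<Longrightarrow> modal \<mu> \<and> wf_cml dr p q True (body \<mu>) \<and> set (mods (body \<mu>)) \<subseteq> set ms"
  using mods_body[OF _ wf] ms by simp

lemma truth_sat:
  assumes c: "compat Xs Ys lam Y"
    and t: "\<forall>v\<in>V. \<forall>j<d. snd (lam v) ! j = accepts (ms ! j) (card {w. nb lam Y (ms ! j) v w})"
  shows "wf_cml dr p q inner \<chi> \<Longrightarrow> set (mods \<chi>) \<subseteq> set ms \<Longrightarrow>
    \<forall>w\<in>V. \<forall>\<mu>\<in>set (mods \<chi>). truth (snd (lam w)) \<mu> = sat \<mu> G Xs Ys None w"
proof -
  have truth: "truth (snd (lam v)) \<mu> = accepts \<mu> (card {w. nb lam Y \<mu> v w})" if v: "v \<in> V" and \<mu>: "\<mu> \<in> set ms" for v \<mu>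
  proof -
    from \<mu> obtain j where j: "j < d" "ms ! j = \<mu>" unfolding in_set_conv_nth by blast
    have "length (snd (lam v)) = d" using c v unfolding compat_def by blast
    from truth_nth[OF this j(1)] t v j show ?thesis by simp
  qed
  have modal_case: "\<forall>w\<in>V. truth (snd (lam w)) \<mu> = sat \<mu> G Xs Ys None w"
    if "\<mu> \<in> set ms" "\<forall>w\<in>V. \<forall>\<mu>'\<in>set (mods (body \<mu>)). truth (snd (lam w)) \<mu>' = sat \<mu>' G Xs Ys None w" for \<mu>
    using truth[OF _ that(1)] accepts_nb[OF c _ _ that(2)] ms_wf[OF that(1)] by simp
  have both: "\<forall>w\<in>V. \<forall>\<mu>\<in>A \<union> B. R w \<mu>" if "\<forall>w\<in>V. \<forall>\<mu>\<in>A. R w \<mu>" "\<forall>w\<in>V. \<forall>\<mu>\<in>B. R w \<mu>"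
    for A B and R :: "nat \<Rightarrow> cml \<Rightarrow> bool" using that by blast
  show "wf_cml dr p q inner \<chi> \<Longrightarrow> set (mods \<chi>) \<subseteq> set ms \<Longrightarrow> ?thesis"
  proof (induction \<chi> arbitrary: inner)
    case (Dia S \<chi>)
    have IH: "\<forall>w\<in>V. \<forall>\<mu>\<in>set (mods \<chi>). truth (snd (lam w)) \<mu> = sat \<mu> G Xs Ys None w"
      by (rule Dia.IH[of True]) (use Dia.prems in auto)
    have "\<forall>w\<in>V. truth (snd (lam w)) (Dia S \<chi>) = sat (Dia S \<chi>) G Xs Ys None w"
    proof (rule modal_case)
      show "Dia S \<chi> \<in> set ms" using Dia.prems(2) by simp
      show "\<forall>w\<in>V. \<forall>\<mu>\<in>set (mods (body (Dia S \<chi>))). truth (snd (lam w)) \<mu> = sat \<mu> G Xs Ys None w"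
        using IH by simp
    qed
    with IH show ?case by simp
  next
    case (Box S \<chi>)
    have IH: "\<forall>w\<in>V. \<forall>\<mu>\<in>set (mods \<chi>). truth (snd (lam w)) \<mu> = sat \<mu> G Xs Ys None w"
      by (rule Box.IH[of True]) (use Box.prems in auto)
    have "\<forall>w\<in>V. truth (snd (lam w)) (Box S \<chi>) = sat (Box S \<chi>) G Xs Ys None w"
    proof (rule modal_case)
      show "Box S \<chi> \<in> set ms" using Box.prems(2) by simp
      show "\<forall>w\<in>V. \<forall>\<mu>\<in>set (mods (body (Box S \<chi>))). truth (snd (lam w)) \<mu> = sat \<mu> G Xs Ys None w"
        using IH by simp
    qed
    with IH show ?case by simp
  next
    case (CAnd \<chi>1 \<chi>2)
    have "\<forall>w\<in>V. \<forall>\<mu>\<in>set (mods \<chi>1). truth (snd (lam w)) \<mu> = sat \<mu> G Xs Ys None w"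
      by (rule CAnd.IH(1)[of inner]) (use CAnd.prems in simp_all)
    moreover have "\<forall>w\<in>V. \<forall>\<mu>\<in>set (mods \<chi>2). truth (snd (lam w)) \<mu> = sat \<mu> G Xs Ys None w"
      by (rule CAnd.IH(2)[of inner]) (use CAnd.prems in simp_all)
    ultimately show ?case unfolding mods.simps set_append by (rule both)
  next
    case (COr \<chi>1 \<chi>2)
    have "\<forall>w\<in>V. \<forall>\<mu>\<in>set (mods \<chi>1). truth (snd (lam w)) \<mu> = sat \<mu> G Xs Ys None w"
      by (rule COr.IH(1)[of inner]) (use COr.prems in simp_all)
    moreover have "\<forall>w\<in>V. \<forall>\<mu>\<in>set (mods \<chi>2). truth (snd (lam w)) \<mu> = sat \<mu> G Xs Ys None w"
      by (rule COr.IH(2)[of inner]) (use COr.prems in simp_all)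
    ultimately show ?case unfolding mods.simps set_append by (rule both)
  next
    case (CImp \<chi>1 \<chi>2)
    have "\<forall>w\<in>V. \<forall>\<mu>\<in>set (mods \<chi>1). truth (snd (lam w)) \<mu> = sat \<mu> G Xs Ys None w"
      by (rule CImp.IH(1)[of inner]) (use CImp.prems in simp_all)
    moreover have "\<forall>w\<in>V. \<forall>\<mu>\<in>set (mods \<chi>2). truth (snd (lam w)) \<mu> = sat \<mu> G Xs Ys None w"
      by (rule CImp.IH(2)[of inner]) (use CImp.prems in simp_all)
    ultimately show ?case unfolding mods.simps set_append by (rule both)
  next
    case (CIff \<chi>1 \<chi>2)
    have "\<forall>w\<in>V. \<forall>\<mu>\<in>set (mods \<chi>1). truth (snd (lam w)) \<mu> = sat \<mu> G Xs Ys None w"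
      by (rule CIff.IH(1)[of inner]) (use CIff.prems in simp_all)
    moreover have "\<forall>w\<in>V. \<forall>\<mu>\<in>set (mods \<chi>2). truth (snd (lam w)) \<mu> = sat \<mu> G Xs Ys None w"
      by (rule CIff.IH(2)[of inner]) (use CIff.prems in simp_all)
    ultimately show ?case unfolding mods.simps set_append by (rule both)
  qed simp_all
qed

lemma truth_iff_sat:
  assumes c: "compat Xs Ys lam Y"
  shows "(\<forall>v\<in>V. \<forall>j<d. snd (lam v) ! j = accepts (ms ! j) (card {w. nb lam Y (ms ! j) v w})) \<longleftrightarrow>
    (\<forall>v\<in>V. snd (lam v) = map (\<lambda>\<mu>. sat \<mu> G Xs Ys None v) ms)" (is "?L \<longleftrightarrow> ?R")
proof
  assume ?L
  from truth_sat[OF c this wf] ms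
  have *: "\<forall>w\<in>V. \<forall>\<mu>\<in>set ms. truth (snd (lam w)) \<mu> = sat \<mu> G Xs Ys None w" by simp
  show ?R
  proof
    fix v assume v: "v \<in> V"
    have l: "length (snd (lam v)) = d" using c v unfolding compat_def by blast
    show "snd (lam v) = map (\<lambda>\<mu>. sat \<mu> G Xs Ys None v) ms"
    proof (rule nth_equalityI)
      fix j assume "j < length (snd (lam v))"
      then have j: "j < d" using l by simp
      have "truth (snd (lam v)) (ms ! j) = sat (ms ! j) G Xs Ys None v" using * v nth_mem[OF j] by blast
      then show "snd (lam v) ! j = map (\<lambda>\<mu>. sat \<mu> G Xs Ys None v) ms ! j"
        using truth_nth[OF l j] j by simp
    qed (simp add: l)
  qed
next
  assume R: ?R
  have *: "\<forall>w\<in>V. \<forall>\<mu>\<in>set ms. truth (snd (lam w)) \<mu> = sat \<mu> G Xs Ys None w"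
  proof (intro ballI)
    fix w \<mu> assume w: "w \<in> V" and "\<mu> \<in> set ms"
    then obtain j where j: "j < d" "ms ! j = \<mu>" unfolding in_set_conv_nth by blast
    have l: "length (snd (lam w)) = d" using c w unfolding compat_def by blast
    show "truth (snd (lam w)) \<mu> = sat \<mu> G Xs Ys None w"
      using truth_nth[OF l j(1)] R w j by simp
  qed
  show ?L
  proof (intro ballI allI impI)
    fix v j assume v: "v \<in> V" and j: "j < d"
    have \<mu>: "ms ! j \<in> set ms" using j by simp
    have "accepts (ms ! j) (card {w. nb lam Y (ms ! j) v w}) = sat (ms ! j) G Xs Ys None v"
    proof (rule accepts_nb[OF c])
      show "\<forall>w\<in>V. \<forall>\<mu>'\<in>set (mods (body (ms ! j))). truth (snd (lam w)) \<mu>' = sat \<mu>' G Xs Ys None w"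
        using * ms_wf[OF \<mu>] by (meson subsetD)
    qed (use ms_wf[OF \<mu>] in simp_all)
    then show "snd (lam v) ! j = accepts (ms ! j) (card {w. nb lam Y (ms ! j) v w})"
      using R v j by simp
  qed
qed

lemma card_vector_X:
  assumes c: "compat Xs Ys lam Y" and X: "Xs ! j \<subseteq> V" and j: "j < p"
  shows "card_vector lam (kap lam Y) j = card (Xs ! j)"
proof -
  have 1: "(\<Sum>pr\<leftarrow>prs. get 0 (snd (snd (pstates (kap lam Y) pr))) j) = (\<Sum>pr\<leftarrow>prs. 0)"
    using j by (intro arg_cong[of _ _ sum_list] map_cong) (auto simp: pair_states_def Let_def get_def nth_append)
  have "(\<Sum>v\<leftarrow>us. get 0 (map of_bool (fst (lam v))) j) = (\<Sum>v\<leftarrow>us. of_bool (v \<in> Xs ! j))"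
  proof (intro arg_cong[of _ _ sum_list] map_cong refl)
    fix v assume "v \<in> set us"
    then have "length (fst (lam v)) = p" "fst (lam v) ! j = (v \<in> Xs ! j)"
      using c us(2) j unfolding compat_def by blast+
    then show "get 0 (map of_bool (fst (lam v))) j = of_bool (v \<in> Xs ! j)" using j by (simp add: get_def)
  qed
  also have "\<dots> = card {v \<in> set us. v \<in> Xs ! j}" by (rule sum_list_of_bool[OF us(1)])
  also have "{v \<in> set us. v \<in> Xs ! j} = Xs ! j" using X us(2) by auto
  finally show ?thesis unfolding card_vector_def 1 by simp
qed

lemma card_vector_Y:
  assumes c: "compat Xs Ys lam Y" and Ys: "Ys ! j \<subseteq> E" and j: "j < q"
    and Y: "\<And>a. length (Y a) = q" "\<And>a. a \<notin> set es \<Longrightarrow> Y a = replicate q False"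
  shows "card_vector lam (kap lam Y) (p + j) = card (Ys ! j)"
proof -
  let ?A = "{a \<in> set es. Y a ! j}"
  have 1: "(\<Sum>v\<leftarrow>us. get 0 (map of_bool (fst (lam v))) (p + j)) = (\<Sum>v\<leftarrow>us. 0)"
  proof (intro arg_cong[of _ _ sum_list] map_cong refl)
    fix v assume "v \<in> set us"
    then have "length (fst (lam v)) = p" using c us(2) unfolding compat_def by blast
    then show "get 0 (map of_bool (fst (lam v))) (p + j) = 0" by (simp add: get_def)
  qed
  have "card_vector lam (kap lam Y) (p + j) = (\<Sum>pr\<leftarrow>prs. get 0 (snd (snd (pstates (kap lam Y) pr))) (p + j))"
    unfolding card_vector_def 1 by simp
  also have "\<dots> = (\<Sum>pr\<leftarrow>prs. of_bool (pr \<in> ?A) + of_bool (swap pr \<in> ?A))"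
  proof (intro arg_cong[of _ _ sum_list] map_cong refl)
    fix pr
    have y: "Y a ! j \<longleftrightarrow> a \<in> ?A" for a using Y(2)[of a] j by (cases "a \<in> set es") auto
    have "get 0 (snd (snd (pstates (kap lam Y) pr))) (p + j) = of_bool (Y pr ! j) + of_bool (Y (swap pr) ! j)"
      using j Y(1) by (simp add: pair_states_def Let_def kap_def get_def nth_append)
    also have "\<dots> = of_bool (pr \<in> ?A) + of_bool (swap pr \<in> ?A)"
      by (rule arg_cong2[where f = "(+)"]) (rule arg_cong[OF y])+
    finally show "get 0 (snd (snd (pstates (kap lam Y) pr))) (p + j) = of_bool (pr \<in> ?A) + of_bool (swap pr \<in> ?A)" .
  qed
  also have "\<dots> = card {pr \<in> set prs. pr \<in> ?A} + card {pr \<in> set prs. swap pr \<in> ?A}"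
    unfolding sum_list_addf sum_list_of_bool[OF prs(1)] ..
  also have "card {pr \<in> set prs. swap pr \<in> ?A} = card {a \<in> ?A. snd a < fst a}"
  proof -
    have "pr \<in> set prs \<and> swap pr \<in> ?A \<longleftrightarrow> swap pr \<in> {a \<in> ?A. snd a < fst a}" for pr
      unfolding prs(2) mem_Collect_eq prod.collapse fst_conv snd_conv by blast
    moreover have "x \<in> swap ` S \<longleftrightarrow> swap x \<in> S" for x :: "nat \<times> nat" and S
    proof
      assume "swap x \<in> S"
      then show "x \<in> swap ` S" by (intro image_eqI[of _ _ "swap x"]) simp_all
    qed auto
    ultimately have "{pr \<in> set prs. swap pr \<in> ?A} = swap ` {a \<in> ?A. snd a < fst a}" by blast
    moreover have "inj_on swap {a \<in> ?A. snd a < fst a}" by (rule inj_onI) (simp add: prod_eq_iff)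
    ultimately show ?thesis by (simp only: card_image)
  qed
  also have "{pr \<in> set prs. pr \<in> ?A} = {a \<in> ?A. fst a < snd a}" unfolding prs(2) by blast
  also have "card {a \<in> ?A. fst a < snd a} + card {a \<in> ?A. snd a < fst a} = card ?A"
  proof (subst card_Un_disjoint[symmetric])
    have "fst a < snd a \<or> snd a < fst a" if "a \<in> set es" for a
    proof (rule ccontr)
      assume "\<not> (fst a < snd a \<or> snd a < fst a)"
      then have "a = (fst a, fst a)" by (simp add: prod_eq_iff)
      then show False using that es_irrefl[of "fst a"] by simp
    qed
    then have "{a \<in> ?A. fst a < snd a} \<union> {a \<in> ?A. snd a < fst a} = ?A" by blast
    then show "card ({a \<in> ?A. fst a < snd a} \<union> {a \<in> ?A. snd a < fst a}) = card ?A" by simp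
  qed auto
  also have "?A = arc ` (Ys ! j)"
  proof -
    have "arc e \<in> ?A \<longleftrightarrow> e \<in> Ys ! j" if "e \<in> E" for e
    proof -
      have "Y (arc e) ! j = (e \<in> Ys ! j)" using c j that unfolding compat_def by blast
      then show ?thesis using that es by simp
    qed
    note iff = this
    show ?thesis
    proof (rule Set.set_eqI)
      fix a
      show "a \<in> ?A \<longleftrightarrow> a \<in> arc ` (Ys ! j)"
      proof
        assume "a \<in> ?A"
        then obtain e where "e \<in> E" "a = arc e" unfolding es by blast
        then show "a \<in> arc ` (Ys ! j)" using iff \<open>a \<in> ?A\<close> by blast
      next
        assume "a \<in> arc ` (Ys ! j)"
        then obtain e where "e \<in> Ys ! j" "a = arc e" by blast
        then show "a \<in> ?A" using iff[of e] Ys by blast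
      qed
    qed
  qed
  also have "card (arc ` (Ys ! j)) = card (Ys ! j)"
    by (rule card_image, rule inj_on_subset[OF inj_arc Ys])
  finally show ?thesis .
qed


definition sols :: "(nat set list \<times> edge set list) set" where
  "sols = {(Xs, Ys). length Xs = kX \<and> (\<forall>X\<in>set Xs. X \<subseteq> V) \<and> length Ys = kY \<and> (\<forall>Y\<in>set Ys. Y \<subseteq> E) \<and>
     aholds G ks (FXs @ Xs) (FYs @ Ys) \<phi> \<and> (\<forall>v\<in>V. sat \<psi> G (FXs @ Xs) (FYs @ Ys) None v)}"

definition accepted_choices :: "(label list \<times> pair_choice list) set" where
  "accepted_choices = {(ls, cs). list_all2 (\<lambda>l v. l \<in> set labels) ls us \<and> list_all2 (\<lambda>c pr. c \<in> set (choices pr)) cs prs \<and>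
     accepted (comb (foldr comb (map2 (vertex_entry us) us ls) ([], []))
       (foldr comb (map2 (\<lambda>pr c. pair_entry us pr (pair_states (pr \<in> set es) (swap pr \<in> set es) c)) prs cs) ([], [])))}"

definition lab :: "nat set list \<Rightarrow> edge set list \<Rightarrow> nat \<Rightarrow> label" where
  "lab Xs Ys v = (map (\<lambda>X. v \<in> X) (FXs @ Xs), map (\<lambda>\<mu>. sat \<mu> G (FXs @ Xs) (FYs @ Ys) None v) ms)"

definition elab :: "edge set list \<Rightarrow> nat \<times> nat \<Rightarrow> bool list" where
  "elab Ys a = map (\<lambda>Y. a \<in> arc ` Y) (FYs @ Ys)"

definition choice_of :: "nat set list \<times> edge set list \<Rightarrow> label list \<times> pair_choice list" where
  "choice_of S = (map (lab (fst S) (snd S)) us, map (kap (lab (fst S) (snd S)) (elab (snd S))) prs)"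

lemma accepted_choices_map:
  "(map lam us, map \<kappa> prs) \<in> accepted_choices \<longleftrightarrow>
     (\<forall>v\<in>V. lam v \<in> set labels) \<and> (\<forall>pr\<in>set prs. \<kappa> pr \<in> set (choices pr)) \<and> accepted (total lam \<kappa>)"
  unfolding accepted_choices_def total_def mem_Collect_eq prod.case map2_map us(2)[symmetric]
  by (simp add: list_all2_map1 list_all2_same)

lemma set_choices:
  "kap lam Y pr \<in> set (choices pr) \<longleftrightarrow> lam (fst pr) \<in> set labels \<and> lam (snd pr) \<in> set labels \<and>
     Y pr \<in> set (edge_labels (pr \<in> set es) (pair_info pr)) \<and>
     Y (swap pr) \<in> set (edge_labels (swap pr \<in> set es) (pair_info (swap pr)))"
  by (simp add: choices_def pair_choices_def kap_def)

lemma accepted_sols: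
  assumes c: "compat (FXs @ Xs) (FYs @ Ys) lam Y"
    and Xs: "length Xs = kX" "\<forall>X\<in>set Xs. X \<subseteq> V" and Ys: "length Ys = kY" "\<forall>Y\<in>set Ys. Y \<subseteq> E"
    and Y: "\<And>a. length (Y a) = q" "\<And>a. a \<notin> set es \<Longrightarrow> Y a = replicate q False"
  shows "accepted (total lam (kap lam Y)) \<longleftrightarrow>
    (\<forall>v\<in>V. snd (lam v) = map (\<lambda>\<mu>. sat \<mu> G (FXs @ Xs) (FYs @ Ys) None v) ms) \<and> (Xs, Ys) \<in> sols"
proof -
  let ?Xs = "FXs @ Xs" and ?Ys = "FYs @ Ys"
  have len: "length ?Xs = p" "length ?Ys = q" using Xs Ys FXs FYs p q by simp_all
  have XsV: "?Xs ! i \<subseteq> V" if "i < p" for i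
  proof -
    have "?Xs ! i \<in> set ?Xs" using that len by (intro nth_mem) simp
    then show ?thesis using Xs(2) FXs(2) by auto
  qed
  have YsE: "?Ys ! i \<subseteq> E" if "i < q" for i
  proof -
    have "?Ys ! i \<in> set ?Ys" using that len by (intro nth_mem) simp
    then show ?thesis using Ys(2) FYs(2) by auto
  qed
  have 1: "consistent lam (kap lam Y)" by (simp add: consistent_def kap_def)
  have 2: "take nX (fst (lam v)) = vertex_info v" if v: "v \<in> V" for v
  proof (rule nth_equalityI)
    have l: "length (fst (lam v)) = p" using c v unfolding compat_def by blast
    show "length (take nX (fst (lam v))) = length (vertex_info v)"
      using l p FXs by (simp add: vertex_info_def)
    fix i assume "i < length (take nX (fst (lam v)))"
    then have i: "i < nX" "i < p" using p by simp_all
    then show "take nX (fst (lam v)) ! i = vertex_info v ! i"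
      using c v FXs by (simp add: compat_def vertex_info_def nth_append)
  qed
  have 3: "\<Phi> (card_vector lam (kap lam Y)) = aholds G ks ?Xs ?Ys \<phi>"
    by (rule \<Phi>[OF len]) (simp_all add: card_vector_X[OF c XsV] card_vector_Y[OF c YsE _ Y])
  have 4: "eval_at \<psi> (lam v) (replicate q False) False False = sat \<psi> G ?Xs ?Ys None v"
    if t: "\<forall>v\<in>V. snd (lam v) = map (\<lambda>\<mu>. sat \<mu> G ?Xs ?Ys None v) ms" and v: "v \<in> V" for v
  proof (rule eval_sat[OF c v wf])
    show "\<forall>\<mu>\<in>set (mods \<psi>). truth (snd (lam v)) \<mu> = sat \<mu> G ?Xs ?Ys None v"
    proof
      fix \<mu> assume "\<mu> \<in> set (mods \<psi>)"
      then obtain j where j: "j < d" "ms ! j = \<mu>" unfolding ms[symmetric] in_set_conv_nth by blast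
      show "truth (snd (lam v)) \<mu> = sat \<mu> G ?Xs ?Ys None v"
        using truth_nth[of "snd (lam v)" j] t v j by simp
    qed
  qed simp
  have 5: "(\<forall>v\<in>V. \<forall>j<d. snd (lam v) ! j = accepts (ms ! j) (counts (kap lam Y) v j)) \<longleftrightarrow>
     (\<forall>v\<in>V. snd (lam v) = map (\<lambda>\<mu>. sat \<mu> G ?Xs ?Ys None v) ms)"
    unfolding truth_iff_sat[OF c, symmetric] by (simp add: counts_kap)
  have 6: "(Xs, Ys) \<in> sols \<longleftrightarrow> aholds G ks ?Xs ?Ys \<phi> \<and> (\<forall>v\<in>V. sat \<psi> G ?Xs ?Ys None v)"
    using Xs Ys by (simp add: sols_def)
  have "accepted (total lam (kap lam Y)) \<longleftrightarrow>
    (\<forall>v\<in>V. \<forall>j<d. snd (lam v) ! j = accepts (ms ! j) (counts (kap lam Y) v j)) \<and>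
    (\<forall>v\<in>V. eval_at \<psi> (lam v) (replicate q False) False False) \<and> aholds G ks ?Xs ?Ys \<phi>"
    unfolding accepted_total 3 using 1 2 by blast
  then show ?thesis unfolding 5 6 using 4 by blast
qed

lemma compat_choice:
  assumes "length Xs = kX" "length Ys = kY" "\<forall>Y\<in>set Ys. Y \<subseteq> E"
  shows "compat (FXs @ Xs) (FYs @ Ys) (lab Xs Ys) (elab Ys)"
  unfolding compat_def
proof (intro conjI ballI allI impI)
  fix v show "length (fst (lab Xs Ys v)) = p" using assms FXs p by (simp add: lab_def)
  show "length (snd (lab Xs Ys v)) = d" by (simp add: lab_def)
  fix i assume "i < p" then show "fst (lab Xs Ys v) ! i = (v \<in> (FXs @ Xs) ! i)"
    using assms FXs p by (simp add: lab_def del: map_append)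
next
  fix e j assume e: "e \<in> E" and j: "j < q"
  have "(FYs @ Ys) ! j \<in> set (FYs @ Ys)" using j assms FYs q by (intro nth_mem) simp
  then have "(FYs @ Ys) ! j \<subseteq> E" using assms(3) FYs(2) by auto
  from arc_mem[OF this e] show "elab Ys (arc e) ! j = (e \<in> (FYs @ Ys) ! j)"
    using j assms FYs q by (simp add: elab_def del: map_append)
qed

lemma elab_props:
  assumes "length Ys = kY" "\<forall>Y\<in>set Ys. Y \<subseteq> E"
  shows "length (elab Ys a) = q" "a \<notin> set es \<Longrightarrow> elab Ys a = replicate q False" "take nY (elab Ys a) = pair_info a"
proof -
  show l: "length (elab Ys a) = q" using assms FYs q by (simp add: elab_def)
  show "take nY (elab Ys a) = pair_info a" using FYs by (simp add: elab_def pair_info_def)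
  assume a: "a \<notin> set es"
  have "a \<notin> arc ` Y" if "Y \<in> set (FYs @ Ys)" for Y
  proof -
    have "Y \<subseteq> E" using that assms(2) FYs(2) by auto
    then show ?thesis using a es by auto
  qed
  then have "elab Ys a = map (\<lambda>_. False) (FYs @ Ys)" unfolding elab_def by (intro map_cong) auto
  then show "elab Ys a = replicate q False" using l by (simp add: map_replicate_const elab_def)
qed

lemma solsD:
  assumes "(Xs, Ys) \<in> sols"
  shows "length Xs = kX" "\<forall>X\<in>set Xs. X \<subseteq> V" "length Ys = kY" "\<forall>Y\<in>set Ys. Y \<subseteq> E"
  using assms by (simp_all add: sols_def)

lemma choice_of_accepted: "S \<in> sols \<Longrightarrow> choice_of S \<in> accepted_choices"
proof -
  obtain Xs Ys where S: "S = (Xs, Ys)" by fastforce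
  assume "S \<in> sols"
  then have s: "(Xs, Ys) \<in> sols" by (simp add: S)
  note D = solsD[OF s]
  note c = compat_choice[OF D(1,3,4)] and Y = elab_props[OF D(3,4)]
  have l: "lab Xs Ys v \<in> set labels" for v
    unfolding set_labels using D(1) FXs p by (simp add: lab_def)
  have "accepted (total (lab Xs Ys) (kap (lab Xs Ys) (elab Ys)))"
    using accepted_sols[where lam = "lab Xs Ys" and Y = "elab Ys", OF c D Y(1) Y(2)] s by (simp add: lab_def)
  moreover have "elab Ys a \<in> set (edge_labels (a \<in> set es) (pair_info a))" for a
    unfolding set_edge_labels using Y by simp
  ultimately show ?thesis
    unfolding choice_of_def S fst_conv snd_conv accepted_choices_map set_choices using l by blast
qed

lemma inj_choice_of: "inj_on choice_of sols"
proof (rule inj_onI)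
  fix S S' assume s: "S \<in> sols" and s': "S' \<in> sols" and eq: "choice_of S = choice_of S'"
  obtain Xs Ys Xs' Ys' where S: "S = (Xs, Ys)" "S' = (Xs', Ys')" by (metis surj_pair)
  note D = solsD[OF s[unfolded S]] and D' = solsD[OF s'[unfolded S]]
  have X: "lab Xs Ys v = lab Xs' Ys' v" if "v \<in> V" for v
    using eq that us(2) unfolding choice_of_def S by simp
  have "kap (lab Xs Ys) (elab Ys) pr = kap (lab Xs' Ys') (elab Ys') pr" if "pr \<in> set prs" for pr
    using eq that unfolding choice_of_def S by simp
  then have Y1: "elab Ys pr = elab Ys' pr \<and> elab Ys (swap pr) = elab Ys' (swap pr)" if "pr \<in> set prs" for pr
    using that unfolding kap_def by simp
  have Y: "elab Ys a = elab Ys' a" if a: "a \<in> set es" for a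
  proof (cases "fst a < snd a")
    case True
    then have "a \<in> set prs" using a by (simp add: prs(2))
    then show ?thesis using Y1 by blast
  next
    case False
    moreover have "fst a \<noteq> snd a" using es_irrefl[of "fst a"] a by (cases a) auto
    ultimately have "swap a \<in> set prs" using a by (simp add: prs(2))
    from Y1[OF this] show ?thesis by simp
  qed
  have "Xs = Xs'"
  proof (rule nth_equalityI)
    show "length Xs = length Xs'" using D D' by simp
    fix i assume i: "i < length Xs"
    have "v \<in> Xs ! i \<longleftrightarrow> v \<in> Xs' ! i" if v: "v \<in> V" for v
      using arg_cong[OF X[OF v], of "\<lambda>l. fst l ! (length FXs + i)"] i D(1) D'(1)
      by (simp add: lab_def nth_append)
    moreover have "Xs ! i \<subseteq> V" "Xs' ! i \<subseteq> V" using D D' i by simp_all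
    ultimately show "Xs ! i = Xs' ! i" by blast
  qed
  moreover have "Ys = Ys'"
  proof (rule nth_equalityI)
    show "length Ys = length Ys'" using D D' by simp
    fix i assume i: "i < length Ys"
    have sub: "Ys ! i \<subseteq> E" "Ys' ! i \<subseteq> E" using D D' i by simp_all
    have "e \<in> Ys ! i \<longleftrightarrow> e \<in> Ys' ! i" if e: "e \<in> E" for e
    proof -
      have "arc e \<in> set es" using e es by simp
      from arg_cong[OF Y[OF this], of "\<lambda>l. l ! (length FYs + i)"]
      have "arc e \<in> arc ` (Ys ! i) \<longleftrightarrow> arc e \<in> arc ` (Ys' ! i)"
        using i D(3) D'(3) by (simp add: elab_def nth_append)
      then show ?thesis using arc_mem sub e by blast
    qed
    with sub show "Ys ! i = Ys' ! i" by blast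
  qed
  ultimately show "S = S'" by (simp add: S)
qed

lemma accepted_choice_of:
  assumes "A \<in> accepted_choices" shows "A \<in> choice_of ` sols"
proof -
  obtain ls cs where A: "A = (ls, cs)" by fastforce
  have "length ls = length us" "length cs = length prs"
    using assms unfolding A accepted_choices_def by (auto dest: list_all2_lengthD)
  then obtain lam \<kappa> where eq: "ls = map lam us" "cs = map \<kappa> prs"
    using list_eq_map[OF us(1), of ls] list_eq_map[OF prs(1), of cs] by blast
  have acc: "\<forall>v\<in>V. lam v \<in> set labels" "\<forall>pr\<in>set prs. \<kappa> pr \<in> set (choices pr)" "accepted (total lam \<kappa>)"
    using assms unfolding A eq accepted_choices_map by blast+
  have con: "consistent lam \<kappa>" using acc(3) unfolding accepted_total by blast
  define Y where "Y a = (if a \<in> set prs then fst (snd (snd (\<kappa> a))) else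
    if swap a \<in> set prs then snd (snd (snd (\<kappa> (swap a)))) else replicate q False)" for a
  have \<kappa>: "\<kappa> pr = kap lam Y pr" if pr: "pr \<in> set prs" for pr
  proof -
    have "swap pr \<notin> set prs" using prs_less[OF pr] prs_less[of "swap pr"] by fastforce
    then have "Y pr = fst (snd (snd (\<kappa> pr)))" "Y (swap pr) = snd (snd (snd (\<kappa> pr)))"
      using pr by (simp_all add: Y_def)
    then show ?thesis using con pr by (simp add: consistent_def kap_def prod_eq_iff)
  qed
  have Y: "Y a \<in> set (edge_labels (a \<in> set es) (pair_info a))" for a
  proof -
    consider "a \<in> set prs" | "swap a \<in> set prs" "a \<notin> set prs" | "a \<notin> set prs" "swap a \<notin> set prs" by blast
    then show ?thesis
    proof cases
      case 1
      then show ?thesis using acc(2) \<kappa> set_choices by metis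
    next
      case 2
      then have "kap lam Y (swap a) \<in> set (choices (swap a))" using acc(2) \<kappa> by metis
      then show ?thesis unfolding set_choices by simp
    next
      case 3
      have "a \<notin> set es"
      proof
        assume a: "a \<in> set es"
        have "fst a \<noteq> snd a" using es_irrefl[of "fst a"] a by (cases a) auto
        then show False using a 3 by (auto simp: prs(2) neq_iff)
      qed
      then show ?thesis using 3 by (simp add: Y_def set_edge_labels)
    qed
  qed
  have Ylen: "length (Y a) = q" and Yno: "a \<notin> set es \<Longrightarrow> Y a = replicate q False"
    and Yfix: "a \<in> set es \<Longrightarrow> take nY (Y a) = pair_info a" for a
    using Y[of a] unfolding set_edge_labels by (auto split: if_splits)
  have lamlen: "length (fst (lam v)) = p" "length (snd (lam v)) = d" if "v \<in> V" for v
    using acc(1) that set_labels by blast+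
  define Xs where "Xs = map (\<lambda>i. {v \<in> V. fst (lam v) ! (nX + i)}) [0..<kX]"
  define Ys where "Ys = map (\<lambda>i. {e \<in> E. Y (arc e) ! (nY + i)}) [0..<kY]"
  have D: "length Xs = kX" "\<forall>X\<in>set Xs. X \<subseteq> V" "length Ys = kY" "\<forall>Y\<in>set Ys. Y \<subseteq> E"
    by (auto simp: Xs_def Ys_def)
  have c: "compat (FXs @ Xs) (FYs @ Ys) lam Y"
    unfolding compat_def
  proof (intro conjI ballI allI impI)
    fix v i assume v: "v \<in> V" and i: "i < p"
    show "fst (lam v) ! i = (v \<in> (FXs @ Xs) ! i)"
    proof (cases "i < nX")
      case True
      have "take nX (fst (lam v)) = vertex_info v" using acc(3) v unfolding accepted_total by blast
      from arg_cong[OF this, of "\<lambda>l. l ! i"] show ?thesis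
        using True FXs by (simp add: vertex_info_def nth_append)
    next
      case False
      then show ?thesis using i p v FXs by (simp add: Xs_def nth_append)
    qed
  next
    fix e j assume e: "e \<in> E" and j: "j < q"
    have a: "arc e \<in> set es" using e es by simp
    show "Y (arc e) ! j = (e \<in> (FYs @ Ys) ! j)"
    proof (cases "j < nY")
      case True
      then have "FYs ! j \<subseteq> E" using FYs nth_mem[of j FYs] by simp
      then have "arc e \<in> arc ` (FYs ! j) \<longleftrightarrow> e \<in> FYs ! j" using arc_mem e by blast
      with arg_cong[OF Yfix[OF a], of "\<lambda>l. l ! j"] show ?thesis
        using True FYs by (simp add: pair_info_def nth_append)
    next
      case False
      then show ?thesis using j q e FYs by (simp add: Ys_def nth_append)
    qed
  qed (use lamlen in auto)
  have "total lam \<kappa> = total lam (kap lam Y)"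
  proof -
    have "map (\<lambda>pr. pair_entry us pr (pstates \<kappa> pr)) prs = map (\<lambda>pr. pair_entry us pr (pstates (kap lam Y) pr)) prs"
      by (rule map_cong[OF refl]) (simp add: \<kappa>)
    then show ?thesis unfolding total_def by (simp only:)
  qed
  then have "(\<forall>v\<in>V. snd (lam v) = map (\<lambda>\<mu>. sat \<mu> G (FXs @ Xs) (FYs @ Ys) None v) ms) \<and> (Xs, Ys) \<in> sols"
    using acc(3) accepted_sols[where lam = lam and Y = Y, OF c D Ylen Yno] by simp
  then have t: "\<forall>v\<in>V. snd (lam v) = map (\<lambda>\<mu>. sat \<mu> G (FXs @ Xs) (FYs @ Ys) None v) ms" and s: "(Xs, Ys) \<in> sols"
    by blast+
  note c' = compat_choice[OF D(1,3,4)] and Y' = elab_props[OF D(3,4)]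
  have L: "lab Xs Ys v = lam v" if v: "v \<in> V" for v
  proof (rule prod_eqI)
    show "snd (lab Xs Ys v) = snd (lam v)" using t v by (simp add: lab_def)
    show "fst (lab Xs Ys v) = fst (lam v)"
      by (rule nth_equalityI) (use c c' v in \<open>simp_all add: compat_def\<close>)
  qed
  have EL: "elab Ys a = Y a" for a
  proof (cases "a \<in> set es")
    case True
    then obtain e where e: "e \<in> E" "a = arc e" using es by auto
    show ?thesis
      by (rule nth_equalityI) (use c c' e Ylen Y'(1) in \<open>simp_all add: compat_def\<close>)
  next
    case False
    then show ?thesis using Yno Y'(2) by simp
  qed
  have "map (lab Xs Ys) us = ls" unfolding eq by (rule map_cong[OF refl]) (simp add: L us(2))
  moreover have "map (kap (lab Xs Ys) (elab Ys)) prs = cs"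
    unfolding eq by (rule map_cong[OF refl]) (simp add: \<kappa> kap_def L EL prs_V)
  ultimately have "A = choice_of (Xs, Ys)" unfolding choice_of_def A by simp
  then show ?thesis using s by blast
qed

theorem card_accepted_choices: "card accepted_choices = card sols"
proof -
  have "choice_of ` sols = accepted_choices"
    using choice_of_accepted accepted_choice_of by blast
  then show ?thesis using card_image[OF inj_choice_of] by simp
qed

end

section \<open>The algorithm\<close>

definition lookup :: "nat \<Rightarrow> (nat \<times> 'a list) list \<Rightarrow> 'a list" where
  "lookup i xs = concat (map (\<lambda>p. if fst p = i then snd p else []) xs)"

definition vertex_order :: "(nat \<times> nat) list \<Rightarrow> nat list list \<Rightarrow> nat list" where
  "vertex_order te bags = dedup (concat (map (\<lambda>i. lookup i (index_from 0 bags)) (tree_nodes te bags)))"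

definition orient :: "nat \<times> nat \<Rightarrow> nat \<times> nat" where
  "orient a = (if fst a < snd a then a else (snd a, fst a))"

definition pairs_of :: "(nat \<times> nat) list \<Rightarrow> (nat \<times> nat) list" where
  "pairs_of es = dedup (map orient es)"

lemma lookup_simps [simp]:
  "lookup i [] = []" "lookup i (p # ps) = (if fst p = i then snd p else []) @ lookup i ps"
  by (simp_all add: lookup_def)

lemma lookup_index_from: "i < length xs \<Longrightarrow> lookup (n + i) (index_from n xs) = xs ! i"
proof (induction xs arbitrary: n i)
  case (Cons x xs)
  have none: "j < n \<Longrightarrow> lookup j (index_from n xs) = []" for j n
    by (induction xs arbitrary: n) auto
  show ?case
  proof (cases i)
    case 0
    then show ?thesis using none[of n "Suc n"] by simp
  next
    case (Suc j)
    then show ?thesis using Cons.IH[of j "Suc n"] Cons.prems by simp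
  qed
qed simp

lemma pt_lookup: "pt D m i \<Longrightarrow> pt D m xs \<Longrightarrow> pt D m (\<lambda>s. lookup (i s) (xs s))"
proof -
  assume i: "pt D m i" and xs: "pt D m xs"
  have "pt {p. fst p \<in> D \<and> snd p \<in> set (xs (fst p))} (\<lambda>p. m (fst p)) (\<lambda>p. i (fst p))"
    by (rule pt_lift_fst[OF i]) simp
  then show ?thesis
    unfolding lookup_def by (intro pt_concat pt_map[OF xs] pt_if' pt_eq pt_fst pt_snd pt_id pt_const)
qed

lemma pt_vertex_order:
  assumes "pt D m te" "pt D m bags" shows "pt D m (\<lambda>s. vertex_order (te s) (bags s))"
  unfolding vertex_order_def
  by (intro pt_dedup pt_concat pt_map pt_tree_nodes assms pt_lookup pt_snd pt_id pt_lift_fst[OF pt_index_from[OF assms(2)]])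
    simp

lemma pt_pairs_of: "pt D m es \<Longrightarrow> pt D m (\<lambda>s. pairs_of (es s))"
  unfolding pairs_of_def orient_def
  by (intro pt_dedup pt_map pt_if' pt_less pt_Pair pt_fst pt_snd pt_id)

text \<open>Integers are represented as differences of natural numbers.\<close>

primrec aeval :: "nat \<Rightarrow> nat \<Rightarrow> nat \<Rightarrow> (bool \<times> nat) list \<Rightarrow> (nat \<Rightarrow> nat) \<Rightarrow> aterm \<Rightarrow> nat \<times> nat" where
  "aeval p n m ks g (Const c) = (nat c, nat (- c))"
| "aeval p n m ks g (Param i) = (let k = get (False, 0) ks i in if fst k then (0, snd k) else (snd k, 0))"
| "aeval p n m ks g NumV = (n, 0)"
| "aeval p n m ks g NumE = (m, 0)"
| "aeval p n m ks g (CardX i) = (g i, 0)"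
| "aeval p n m ks g (CardY j) = (g (p + j), 0)"
| "aeval p n m ks g (Add s t) = (fst (aeval p n m ks g s) + fst (aeval p n m ks g t), snd (aeval p n m ks g s) + snd (aeval p n m ks g t))"
| "aeval p n m ks g (Sub s t) = (fst (aeval p n m ks g s) + snd (aeval p n m ks g t), snd (aeval p n m ks g s) + fst (aeval p n m ks g t))"
| "aeval p n m ks g (Mul s t) =
     (fst (aeval p n m ks g s) * fst (aeval p n m ks g t) + snd (aeval p n m ks g s) * snd (aeval p n m ks g t),
      fst (aeval p n m ks g s) * snd (aeval p n m ks g t) + snd (aeval p n m ks g s) * fst (aeval p n m ks g t))"

primrec ahold :: "nat \<Rightarrow> nat \<Rightarrow> nat \<Rightarrow> (bool \<times> nat) list \<Rightarrow> (nat \<Rightarrow> nat) \<Rightarrow> arith \<Rightarrow> bool" where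
  "ahold p n m ks g (Equal s t) \<longleftrightarrow> fst (aeval p n m ks g s) + snd (aeval p n m ks g t) = fst (aeval p n m ks g t) + snd (aeval p n m ks g s)"
| "ahold p n m ks g (Less s t) \<longleftrightarrow> fst (aeval p n m ks g s) + snd (aeval p n m ks g t) < fst (aeval p n m ks g t) + snd (aeval p n m ks g s)"
| "ahold p n m ks g (ANot a) \<longleftrightarrow> \<not> ahold p n m ks g a"
| "ahold p n m ks g (AAnd a b) \<longleftrightarrow> ahold p n m ks g a \<and> ahold p n m ks g b"
| "ahold p n m ks g (AOr a b) \<longleftrightarrow> ahold p n m ks g a \<or> ahold p n m ks g b"

definition sign_abs :: "int \<Rightarrow> bool \<times> nat" where "sign_abs k = (k < 0, nat \<bar>k\<bar>)"

lemma aeval_aval: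
  assumes "wf_aterm r p q t" "length ks = r" "n = card (verts G)" "m = card (edges G)"
    "\<And>i. i < p \<Longrightarrow> g i = card (Xs ! i)" "\<And>j. j < q \<Longrightarrow> g (p + j) = card (Ys ! j)"
  shows "int (fst (aeval p n m (map sign_abs ks) g t)) - int (snd (aeval p n m (map sign_abs ks) g t)) = aval G ks Xs Ys t"
  using assms
proof (induction t)
  case (Param i)
  then show ?case by (simp add: get_map sign_abs_def Let_def)
next
  case (Add s t)
  then show ?case by simp
next
  case (Sub s t)
  then show ?case by simp
next
  case (Mul s t)
  have "int (fst (aeval p n m (map sign_abs ks) g (Mul s t))) - int (snd (aeval p n m (map sign_abs ks) g (Mul s t))) =
    (int (fst (aeval p n m (map sign_abs ks) g s)) - int (snd (aeval p n m (map sign_abs ks) g s))) *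
    (int (fst (aeval p n m (map sign_abs ks) g t)) - int (snd (aeval p n m (map sign_abs ks) g t)))"
    by (simp add: algebra_simps)
  then show ?case using Mul by simp
qed simp_all

lemma ahold_aholds:
  assumes "wf_arith r p q a" "length ks = r" "n = card (verts G)" "m = card (edges G)"
    "\<And>i. i < p \<Longrightarrow> g i = card (Xs ! i)" "\<And>j. j < q \<Longrightarrow> g (p + j) = card (Ys ! j)"
  shows "ahold p n m (map sign_abs ks) g a = aholds G ks Xs Ys a"
  using assms(1)
proof (induction a)
  case (Equal s t)
  have *: "int (fst (aeval p n m (map sign_abs ks) g u)) - int (snd (aeval p n m (map sign_abs ks) g u)) = aval G ks Xs Ys u"
    if "wf_aterm r p q u" for u by (rule aeval_aval[OF that assms(2-6)])
  show ?case using *[of s] *[of t] Equal by simp linarith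
next
  case (Less s t)
  have *: "int (fst (aeval p n m (map sign_abs ks) g u)) - int (snd (aeval p n m (map sign_abs ks) g u)) = aval G ks Xs Ys u"
    if "wf_aterm r p q u" for u by (rule aeval_aval[OF that assms(2-6)])
  show ?case using *[of s] *[of t] Less by simp linarith
qed simp_all

lemma pt_get: "pt D m xs \<Longrightarrow> pt D m (\<lambda>s. get c (xs s) i)"
proof (induction i arbitrary: xs)
  case 0
  show ?case unfolding get_Cons_0 by (intro pt_hd_or pt_const 0)
next
  case (Suc i)
  show ?case unfolding get_Suc by (rule Suc.IH[OF pt_tl[OF Suc.prems]])
qed

lemma pt_aeval:
  assumes "pt D m n" "pt D m e" "pt D m ks" "pt D m cs"
  shows "pt D m (\<lambda>s. aeval p (n s) (e s) (ks s) (get 0 (cs s)) t)"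
  by (induction t)
    (simp_all only: aeval.simps Let_def, (intro pt_Pair pt_if' pt_add pt_mult pt_fst pt_snd pt_const pt_get assms; assumption)+)

lemma pt_ahold:
  assumes "pt D m n" "pt D m e" "pt D m ks" "pt D m cs"
  shows "pt D m (\<lambda>s. ahold p (n s) (e s) (ks s) (get 0 (cs s)) a)"
  by (induction a)
    (simp_all only: ahold.simps, (intro pt_eq pt_less pt_not pt_conj' pt_disj pt_add pt_fst pt_snd pt_aeval[OF assms]; assumption)+)

lemma pt_collect_map:
  "pt D m xs \<Longrightarrow> pt {p. fst p \<in> D \<and> snd p \<in> set (xs (fst p))} (\<lambda>p. m (fst p)) (\<lambda>p. g (fst p) (snd p)) \<Longrightarrow>
     pt D m (\<lambda>s. collect (map (g s) (xs s)))"
  by (intro pt_collect pt_map)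

type_synonym input = "((nat \<times> (nat \<times> nat) list) \<times> nat list list \<times> (nat \<times> nat) list list \<times> (bool \<times> nat) list \<times> unit) \<times>
   ((nat \<times> (nat \<times> nat) list) \<times> nat list list)"

abbreviation in_n :: "input \<Rightarrow> nat" where "in_n x \<equiv> fst (fst (fst x))"
abbreviation in_es :: "input \<Rightarrow> (nat \<times> nat) list" where "in_es x \<equiv> snd (fst (fst x))"
abbreviation in_fx :: "input \<Rightarrow> nat list list" where "in_fx x \<equiv> fst (snd (fst x))"
abbreviation in_fy :: "input \<Rightarrow> (nat \<times> nat) list list" where "in_fy x \<equiv> fst (snd (snd (fst x)))"
abbreviation in_ks :: "input \<Rightarrow> (bool \<times> nat) list" where "in_ks x \<equiv> fst (snd (snd (snd (fst x))))"
abbreviation in_te :: "input \<Rightarrow> (nat \<times> nat) list" where "in_te x \<equiv> snd (fst (snd x))"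
abbreviation in_bags :: "input \<Rightarrow> nat list list" where "in_bags x \<equiv> snd (snd x)"

context machine
begin

definition vertex_table :: "nat list \<Rightarrow> nat \<Rightarrow> vstate table" where
  "vertex_table us v = collect (map (\<lambda>l. (vertex_entry us v l, 1)) labels)"

definition pair_results :: "bool \<times> bool \<times> bool list \<times> bool list \<Rightarrow> (vstate \<times> vstate \<times> nat list) list" where
  "pair_results i = map (pair_states (fst i) (fst (snd i)))
     (pair_choices (fst i) (fst (snd i)) (fst (snd (snd i))) (snd (snd (snd i))))"

definition info :: "(nat \<times> nat) list \<Rightarrow> (nat \<times> nat) list list \<Rightarrow> nat \<times> nat \<Rightarrow> bool \<times> bool \<times> bool list \<times> bool list" where
  "info es fy pr = (pr \<in> set es, (snd pr, fst pr) \<in> set es, map (\<lambda>Y. pr \<in> set Y) fy, map (\<lambda>Y. (snd pr, fst pr) \<in> set Y) fy)"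

definition pair_table :: "nat list \<Rightarrow> (nat \<times> nat) list \<Rightarrow> (nat \<times> nat) list list \<Rightarrow> nat \<times> nat \<Rightarrow> vstate table" where
  "pair_table us es fy pr = collect (map (\<lambda>r. (pair_entry us pr r, 1)) (pair_results (info es fy pr)))"

definition tables :: "nat list \<Rightarrow> (nat \<times> nat) list \<Rightarrow> (nat \<times> nat) list list \<Rightarrow> vstate table list" where
  "tables us es fy = map (vertex_table us) us @ map (pair_table us es fy) (pairs_of es)"

definition good :: "nat list list \<Rightarrow> nat \<Rightarrow> vstate \<Rightarrow> bool" where
  "good fx v s = good_state (map (\<lambda>X. v \<in> set X) fx) s"

abbreviation "order x \<equiv> vertex_order (in_te x) (in_bags x)"
abbreviation "all_tables x \<equiv> tables (order x) (in_es x) (in_fy x)"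

definition solve :: "arith \<Rightarrow> input \<Rightarrow> nat" where
  "solve \<phi> x = count (\<lambda>cs. ahold p (in_n x) (length (in_es x)) (in_ks x) (get 0 cs) \<phi>)
     (joins (elim (good (in_fx x)) (all_tables x) (order x)))"

definition main :: "arith \<Rightarrow> input \<Rightarrow> bool \<times> nat" where
  "main \<phi> x = (solve \<phi> x \<noteq> 0, solve \<phi> x)"


lemma pt_vertex_entry:
  assumes us: "pt D m us" and v: "pt D m v" and l: "pt D m l" "\<And>s. s \<in> D \<Longrightarrow> l s \<in> set labels"
  shows "pt D m (\<lambda>s. vertex_entry (us s) (v s) (l s))"
proof -
  have S: "pt D m (\<lambda>s. State (fst (l s)) (snd (l s)) (replicate d 0))"
    by (rule pt_finite[OF List.finite_set[of labels] l])
  show ?thesis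
    unfolding vertex_entry_def
    by (intro pt_Pair pt_map us pt_if' pt_eq pt_snd pt_id pt_const pt_lift_fst[OF v] pt_lift_fst[OF S]) simp_all
qed

lemma pt_vertex_table:
  assumes us: "pt D m us" and v: "pt D m v" shows "pt D m (\<lambda>s. vertex_table (us s) (v s))"
  unfolding vertex_table_def
  by (intro pt_collect_map pt_const pt_Pair pt_vertex_entry pt_lift_fst[OF us] pt_lift_fst[OF v] pt_snd pt_id) simp_all

lemma pt_pair_entry:
  assumes us: "pt D m us" and pr: "pt D m pr" and r: "pt D m r"
  shows "pt D m (\<lambda>s. pair_entry (us s) (pr s) (r s))"
  unfolding pair_entry_def
  by (intro pt_Pair pt_map us pt_if' pt_eq pt_snd[OF r] pt_snd[OF pt_snd[OF r]] pt_fst pt_snd pt_id pt_const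
      pt_lift_fst[OF pr] pt_lift_fst[OF r]) simp_all

lemma pt_info:
  assumes es: "pt D m es" and fy: "pt D m fy" and pr: "pt D m pr"
  shows "pt D m (\<lambda>s. info (es s) (fy s) (pr s))"
  unfolding info_def
  by (intro pt_Pair pt_member es pr pt_map fy pt_fst[OF pr] pt_snd[OF pr] pt_snd pt_fst pt_id pt_lift_fst[OF pr]) simp_all

lemma pt_pair_table:
  assumes us: "pt D m us" and es: "pt D m es" and fy: "pt D m fy" and pr: "pt D m pr"
    and nY: "\<And>s. s \<in> D \<Longrightarrow> length (fy s) = nY"
  shows "pt D m (\<lambda>s. pair_table (us s) (es s) (fy s) (pr s))"
proof -
  let ?B = "{y :: bool list. set y \<subseteq> UNIV \<and> length y = nY}"
  have "finite ((UNIV :: bool set) \<times> (UNIV :: bool set) \<times> ?B \<times> ?B)"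
    by (intro finite_cartesian_product finite_lists_length_eq) simp_all
  then have R: "pt D m (\<lambda>s. pair_results (info (es s) (fy s) (pr s)))"
    by (rule pt_finite[OF _ pt_info[OF es fy pr]]) (use nY in \<open>simp add: info_def\<close>)
  show ?thesis
    unfolding pair_table_def
    by (intro pt_collect_map R pt_const pt_Pair pt_pair_entry pt_lift_fst[OF us] pt_lift_fst[OF pr] pt_snd pt_id) simp_all
qed

lemma pt_tables:
  assumes us: "pt D m us" and es: "pt D m es" and fy: "pt D m fy"
    and nY: "\<And>s. s \<in> D \<Longrightarrow> length (fy s) = nY"
  shows "pt D m (\<lambda>s. tables (us s) (es s) (fy s))"
  unfolding tables_def
  by (intro pt_append pt_map us pt_pairs_of es pt_vertex_table pt_pair_table pt_lift_fst[OF us] pt_lift_fst[OF es]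
      pt_lift_fst[OF fy] pt_snd pt_id) (simp_all add: nY)

lemma pt_good:
  assumes fx: "pt D m fx" and v: "pt D m v" and s: "pt D m s"
    and nX: "\<And>x. x \<in> D \<Longrightarrow> length (fx x) = nX" and st: "\<And>x. x \<in> D \<Longrightarrow> s x \<in> states"
  shows "pt D m (\<lambda>x. good (fx x) (v x) (s x))"
proof -
  let ?B = "{y :: bool list. set y \<subseteq> UNIV \<and> length y = nX}"
  have fin: "finite (?B \<times> states)"
    by (intro finite_cartesian_product finite_lists_length_eq finite_states) simp_all
  have "pt D m (\<lambda>x. (map (\<lambda>X. v x \<in> set X) (fx x), s x))"
    by (intro pt_Pair pt_map fx s pt_member pt_lift_fst[OF v] pt_snd pt_id) simp
  from pt_finite[OF fin this, of "\<lambda>a. good_state (fst a) (snd a)"] show ?thesis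
    unfolding good_def using nX st by simp
qed


lemma keys_map:
  "(\<And>u. u \<in> set us \<Longrightarrow> f u \<in> states \<and> (f u \<noteq> Absent \<longrightarrow> u \<in> B)) \<Longrightarrow> map f us \<in> keys us B"
  by (induction us) auto

lemma length_labels: "length labels = 2 ^ p * 2 ^ d"
  by (simp add: labels_def length_n_lists numeral_2_eq_2)

lemma length_edge_labels: "length (edge_labels f y) \<le> 2 ^ q"
proof (cases f)
  case True
  have "length (filter (\<lambda>y'. take nY y' = y) (List.n_lists q [True, False])) \<le> length (List.n_lists q [True, False])"
    by (rule length_filter_le)
  then show ?thesis using True by (simp add: edge_labels_def length_n_lists numeral_2_eq_2)
qed (simp add: edge_labels_def)

lemma length_pair_choices: "length (pair_choices f b y y') \<le> branching"
  unfolding pair_choices_def branching_def length_product length_labels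
  by (intro mult_le_mono order_refl length_edge_labels)

lemma weight_ones: "weight (map (\<lambda>x. (g x, 1)) xs) (\<lambda>_. 1) = length xs"
  by (induction xs) auto

lemma tab_ok_vertex:
  assumes "v \<in> B" shows "tab_ok us B 1 (vertex_table us v)"
  unfolding vertex_table_def
proof (rule tab_ok_collect)
  have "2 ^ p * 2 ^ d \<le> 2 ^ p * 2 ^ d * (2 ^ p * 2 ^ d * (2 ^ q * 2 ^ q) :: nat)" by simp
  then show "weight (map (\<lambda>l. (vertex_entry us v l, 1)) labels) (\<lambda>_. 1) \<le> branching ^ 1"
    unfolding weight_ones length_labels branching_def by simp
  fix a assume "a \<in> set (map (\<lambda>l. (vertex_entry us v l, 1::nat)) labels)"
  then obtain l where l: "l \<in> set labels" "fst a = vertex_entry us v l" by auto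
  have "State (fst l) (snd l) (replicate d 0) \<in> states"
    using l(1) T_pos unfolding set_labels states_def by auto
  moreover have "Absent \<in> states" by (simp add: states_def)
  ultimately have "fst (vertex_entry us v l) \<in> keys us B"
    unfolding vertex_entry_def fst_conv using assms by (intro keys_map) auto
  then show "fst (fst a) \<in> keys us B \<and> length (snd (fst a)) \<le> p + q \<and> (\<forall>n\<in>set (snd (fst a)). n \<le> 2 * 1)"
    unfolding l(2) by (simp add: vertex_entry_def)
qed

lemma contribution_bound: "set (contribution f y b y' l) \<subseteq> {..<T + P}"
proof
  fix n assume "n \<in> set (contribution f y b y' l)"
  then have "n \<le> 1" unfolding contribution_def by auto
  then show "n \<in> {..<T + P}" using T_pos P_pos by simp
qed

lemma tab_ok_pair:
  assumes "fst pr \<in> B" "snd pr \<in> B" shows "tab_ok us B 1 (pair_table us es fy pr)"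
  unfolding pair_table_def
proof (rule tab_ok_collect)
  show "weight (map (\<lambda>r. (pair_entry us pr r, 1)) (pair_results (info es fy pr))) (\<lambda>_. 1) \<le> branching ^ 1"
    unfolding weight_ones pair_results_def length_map power_one_right by (rule length_pair_choices)
  fix a assume "a \<in> set (map (\<lambda>r. (pair_entry us pr r, 1::nat)) (pair_results (info es fy pr)))"
  then obtain r where r: "r \<in> set (pair_results (info es fy pr))" "fst a = pair_entry us pr r" by auto
  then obtain f b y y' c where c: "c \<in> set (pair_choices f b y y')" "r = pair_states f b c"
    unfolding pair_results_def by auto
  obtain l l' z z' where cc: "c = (l, l', z, z')" by (metis prod_cases4)
  have l: "length (fst l) = p" "length (snd l) = d" "length (fst l') = p" "length (snd l') = d"
    and z: "length z = q" "length z' = q"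
    using c(1) unfolding cc pair_choices_def
    by (auto simp: set_labels set_edge_labels split: if_splits)
  have len: "length (contribution f' w b' w' k) = d" for f' w b' w' k by (simp add: contribution_def)
  have s1: "fst r \<in> states" and s2: "fst (snd r) \<in> states"
    using l contribution_bound len unfolding c(2) cc pair_states_def Let_def states_def by auto
  have s3: "Absent \<in> states" by (simp add: states_def)
  have k: "fst (pair_entry us pr r) \<in> keys us B"
    unfolding pair_entry_def fst_conv using assms s1 s2 s3 by (intro keys_map) auto
  have n: "snd (snd r) = replicate p 0 @ map2 (\<lambda>m n. of_bool m + of_bool n) z z'"
    by (simp add: c(2) cc pair_states_def Let_def)
  have "x \<le> 2" if "x \<in> set (map2 (\<lambda>m n. of_bool m + of_bool n :: nat) z z')" for x
    using that by (auto simp: of_bool_def split: if_splits)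
  then have "\<forall>x\<in>set (snd (snd r)). x \<le> 2" unfolding n by auto
  then show "fst (fst a) \<in> keys us B \<and> length (snd (fst a)) \<le> p + q \<and> (\<forall>n\<in>set (snd (fst a)). n \<le> 2 * 1)"
    unfolding r(2) using k z n by (simp add: pair_entry_def)
qed

lemma state_ok_tables:
  assumes "\<And>v. v \<in> set us \<Longrightarrow> \<exists>B\<in>BB. v \<in> B"
    and "\<And>pr. pr \<in> set (pairs_of es) \<Longrightarrow> \<exists>B\<in>BB. fst pr \<in> B \<and> snd pr \<in> B"
  shows "state_ok BB us (length (tables us es fy) + length us) (tables us es fy)"
proof -
  let ?fs = "tables us es fy"
  have "\<exists>B\<in>BB. tab_ok us B 1 F" if "F \<in> set ?fs" for F
  proof -
    from that consider v where "v \<in> set us" "F = vertex_table us v"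
      | pr where "pr \<in> set (pairs_of es)" "F = pair_table us es fy pr"
      unfolding tables_def by auto
    then show ?thesis
    proof cases
      case 1
      then show ?thesis using assms(1)[OF 1(1)] tab_ok_vertex by blast
    next
      case 2
      then show ?thesis using assms(2)[OF 2(1)] tab_ok_pair by blast
    qed
  qed
  then have "list_all2 (\<lambda>w F. \<exists>B\<in>BB. tab_ok us B w F) (replicate (length ?fs) 1) ?fs"
    by (intro list_all2_all_nthI) simp_all
  then show ?thesis
    unfolding state_ok_def by (intro conjI exI[of _ "replicate (length ?fs) 1"]) (simp_all add: sum_list_replicate)
qed

definition max_bag :: "input \<Rightarrow> nat" where "max_bag x = Max (length ` set (in_bags x))"

definition measure_of :: "input \<Rightarrow> nat" where "measure_of x = card states ^ max_bag x"

definition bag_sets :: "input \<Rightarrow> nat set set" where "bag_sets x = set ` set (in_bags x)"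

theorem pt_main:
  assumes nX: "\<And>x. x \<in> D \<Longrightarrow> length (in_fx x) = nX" and nY: "\<And>x. x \<in> D \<Longrightarrow> length (in_fy x) = nY"
    and ord: "\<And>x. x \<in> D \<Longrightarrow> elim_order (bag_sets x) (order x)"
    and vs: "\<And>x v. x \<in> D \<Longrightarrow> v \<in> set (order x) \<Longrightarrow> \<exists>B\<in>bag_sets x. v \<in> B"
    and prs: "\<And>x pr. x \<in> D \<Longrightarrow> pr \<in> set (pairs_of (in_es x)) \<Longrightarrow> \<exists>B\<in>bag_sets x. fst pr \<in> B \<and> snd pr \<in> B"
  shows "pt D measure_of (main \<phi>)"
proof -
  have us: "pt D measure_of order" by (intro pt_vertex_order pt_fst pt_snd pt_id)
  have fs: "pt D measure_of all_tables" by (rule pt_tables) (intro us pt_fst pt_snd pt_id nY | assumption)+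
  let ?N = "\<lambda>x. length (all_tables x) + length (order x)"
  have J: "pt D measure_of (\<lambda>x. joins (elim (good (in_fx x)) (all_tables x) (order x)))"
  proof (rule pt_elim[OF fs us, where N = ?N and b = max_bag and BB = bag_sets])
    show "pt {p. fst p \<in> D \<and> fst (snd p) \<in> set (order (fst p)) \<and> snd (snd p) \<in> states} (\<lambda>p. measure_of (fst p))
      (\<lambda>p. good (in_fx (fst p)) (fst (snd p)) (snd (snd p)))"
      by (rule pt_good) (auto intro!: pt_fst pt_snd pt_id nX)
    show "pb D measure_of ?N"
      by (rule pb_mono[OF pb_add[OF pt_sz[OF fs] pt_sz[OF us]]]) (intro add_mono length_le_sz)
    show "pb D measure_of (\<lambda>s. card states ^ max_bag s)"
      by (rule pb_mono[OF pb_measure]) (simp add: measure_of_def)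
    fix x assume x: "x \<in> D"
    show "state_ok (bag_sets x) (order x) (?N x) (all_tables x)"
      by (rule state_ok_tables[OF vs[OF x] prs[OF x]])
    show "elim_order (bag_sets x) (order x)" by (rule ord[OF x])
    show "distinct (order x)" by (simp add: vertex_order_def)
    fix B assume "B \<in> bag_sets x"
    then obtain l where l: "l \<in> set (in_bags x)" "B = set l" by (auto simp: bag_sets_def)
    have "card B \<le> length l" unfolding l(2) by (rule card_length)
    also have "\<dots> \<le> max_bag x" unfolding max_bag_def using l(1) by (intro Max_ge) auto
    finally show "finite B \<and> card B \<le> max_bag x" using l(2) by simp
  qed
  have S: "pt D measure_of (solve \<phi>)"
    unfolding solve_def
  proof (rule pt_count[OF J], rule pt_ahold)
  qed (intro pt_length pt_fst pt_snd pt_id)+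
  show ?thesis unfolding main_def by (intro pt_Pair pt_not pt_eq pt_const S)
qed

end

section \<open>Correctness and running time\<close>

lemma (in elimination) val_collect: "val (map (\<lambda>i. collect (F i)) xs @ fs) h = val (map F xs @ fs) h"
  by (induction xs arbitrary: h) (simp_all add: weight_collect)

context machine_instance
begin

lemma solve_correct:
  assumes fx: "\<And>v. map (\<lambda>X. v \<in> set X) fx = vertex_info v" and fy: "\<And>a. map (\<lambda>Y. a \<in> set Y) fy = pair_info a"
    and prs': "prs = pairs_of es"
  shows "count (\<lambda>cs. \<Phi> (get 0 cs)) (joins (elim (good fx) (tables us es fy) us)) = card sols"
proof -
  let ?vt = "\<lambda>v. map (\<lambda>l. (vertex_entry us v l, 1)) labels"
  let ?pe = "\<lambda>pr c. pair_entry us pr (pair_states (pr \<in> set es) (swap pr \<in> set es) c)"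
  let ?pt = "\<lambda>pr. map (\<lambda>c. (?pe pr c, 1)) (choices pr)"
  have pt: "pair_table us es fy = (\<lambda>pr. collect (?pt pr))"
    by (rule ext) (simp add: pair_table_def pair_results_def info_def choices_def fy comp_def)
  have vt: "vertex_table us = (\<lambda>v. collect (?vt v))"
    by (rule ext) (simp add: vertex_table_def)
  have "count (\<lambda>cs. \<Phi> (get 0 cs)) (joins (elim (good fx) (tables us es fy) us)) =
      val (tables us es fy) (accept (good fx) (\<lambda>cs. \<Phi> (get 0 cs)) us)"
    by (rule count_elim)
  also have "\<dots> = val (map ?vt us @ map ?pt prs) (accept (good fx) (\<lambda>cs. \<Phi> (get 0 cs)) us)"
    unfolding tables_def vt pt prs'[symmetric] val_collect
    unfolding val_append using val_collect[of ?pt prs "[]"] by simp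
  also have "accept (good fx) (\<lambda>cs. \<Phi> (get 0 cs)) us = (\<lambda>k. of_bool (accepted k))"
    by (rule ext) (simp only: accept_iff accepted_def good_def fx)
  also have "val (map ?vt us @ map ?pt prs) (\<lambda>k. of_bool (accepted k)) =
    card {(ls, cs). list_all2 (\<lambda>l v. l \<in> set labels) ls us \<and> list_all2 (\<lambda>c pr. c \<in> set (choices pr)) cs prs \<and>
       accepted (comb (foldr comb (map2 (vertex_entry us) us ls) ([], [])) (foldr comb (map2 ?pe prs cs) ([], [])))}"
    by (rule val_two_choices) (simp_all add: distinct_labels choices_def distinct_pair_choices)
  also have "\<dots> = card sols" unfolding accepted_choices_def[symmetric] by (rule card_accepted_choices)
  finally show ?thesis .
qed

lemma finite_sols: "finite sols"
proof (rule finite_subset)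
  have V: "finite V" using us(2) by (metis List.finite_set)
  show "sols \<subseteq> {Xs. set Xs \<subseteq> Pow V \<and> length Xs = kX} \<times> {Ys. set Ys \<subseteq> Pow E \<and> length Ys = kY}"
    unfolding sols_def by blast
  show "finite ({Xs. set Xs \<subseteq> Pow V \<and> length Xs = kX} \<times> {Ys. set Ys \<subseteq> Pow E \<and> length Ys = kY})"
    using V finite_E by (intro finite_cartesian_product finite_lists_length_eq) simp_all
qed

end


subsection \<open>Periods of recognizable sets\<close>

definition periodic :: "nat \<Rightarrow> nat \<Rightarrow> nat set \<Rightarrow> bool" where
  "periodic t k S \<longleftrightarrow> (\<forall>n\<ge>t. n + k \<in> S \<longleftrightarrow> n \<in> S)"

lemma recognizable_periodic:
  assumes "finitely_recognizable S" shows "\<exists>t k. k > 0 \<and> periodic t k S"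
proof -
  obtain M :: "nat monoid" and \<alpha> F where M: "finite (carrier M)" "S = \<alpha> -` F"
    and \<alpha>: "\<alpha> \<in> hom \<lparr>carrier = UNIV, mult = (+), one = 0\<rparr> M"
    using assms unfolding finitely_recognizable_def by blast
  have add: "\<alpha> (m + n) = \<alpha> m \<otimes>\<^bsub>M\<^esub> \<alpha> n" for m n
    using hom_mult[OF \<alpha>, of m n] by simp
  have "range \<alpha> \<subseteq> carrier M" using \<alpha> by (auto simp: hom_def)
  then have "finite (range \<alpha>)" using M(1) finite_subset by blast
  then have "\<not> inj \<alpha>" using finite_imageD[of \<alpha> UNIV] by auto
  then obtain i j where "\<alpha> i = \<alpha> j" "i \<noteq> j" unfolding inj_def by blast
  then obtain i k where ik: "\<alpha> i = \<alpha> (i + k)" "k > 0"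
    by (metis less_imp_add_positive linorder_neqE_nat)
  have "\<alpha> (n + k) = \<alpha> n" if "n \<ge> i" for n
  proof -
    have "\<alpha> (n + k) = \<alpha> ((i + k) + (n - i))" using that by (simp add: ac_simps)
    also have "\<dots> = \<alpha> i \<otimes>\<^bsub>M\<^esub> \<alpha> (n - i)" unfolding add[of "i + k"] ik(1)[symmetric] ..
    also have "\<dots> = \<alpha> (i + (n - i))" by (rule add[symmetric])
    also have "i + (n - i) = n" using that by simp
    finally show ?thesis .
  qed
  then have "periodic i k S" by (simp add: periodic_def M(2))
  with ik(2) show ?thesis by blast
qed

lemma periodic_mult:
  assumes "periodic t k S" "n \<ge> t" shows "n + c * k \<in> S \<longleftrightarrow> n \<in> S"
proof (induction c)
  case (Suc c)
  have "n + c * k + k \<in> S \<longleftrightarrow> n + c * k \<in> S" using assms by (simp add: periodic_def)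
  with Suc show ?case by (simp add: ac_simps)
qed simp

lemma common_period:
  assumes "finite A" "\<And>S. S \<in> A \<Longrightarrow> finitely_recognizable S"
  shows "\<exists>t k. t > 0 \<and> k > 0 \<and> (\<forall>S\<in>A. periodic t k S)"
  using assms
proof (induction A rule: finite_induct)
  case empty
  show ?case by (intro exI[of _ 1]) simp
next
  case (insert S A)
  then obtain t k where A: "t > 0" "k > 0" "\<forall>S\<in>A. periodic t k S" by blast
  obtain t' k' where S: "k' > 0" "periodic t' k' S" using recognizable_periodic[of S] insert.prems by blast
  have "periodic (t + t') (k' * k) R" if "R \<in> A" for R
    unfolding periodic_def using periodic_mult[of t k R] A(3) that by auto
  moreover have "periodic (t + t') (k' * k) S"
    unfolding periodic_def using periodic_mult[OF S(2), of _ k] by (auto simp: mult.commute)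
  ultimately show ?case using A(1,2) S(1) by (intro exI[of _ "t + t'"] exI[of _ "k' * k"]) simp
qed

lemma (in machine) red_periodic: "periodic T P S \<Longrightarrow> red n \<in> S \<longleftrightarrow> n \<in> S"
proof (cases "n < T")
  case False
  assume p: "periodic T P S"
  have "n = T + (n - T) mod P + (n - T) div P * P" using False by (simp add: add.assoc)
  with periodic_mult[OF p, of "T + (n - T) mod P" "(n - T) div P"] show ?thesis
    using False by (simp add: red_def)
qed (simp add: red_def)

lemma accepts_index_set:
  "modal \<mu> \<Longrightarrow> (m \<in> index_set \<mu> \<longleftrightarrow> n \<in> index_set \<mu>) \<Longrightarrow> accepts \<mu> m = accepts \<mu> n"
  by (auto simp: modal_def)


subsection \<open>Decoding\<close>

definition lists_set :: "'a set \<Rightarrow> 'a list \<Rightarrow> bool" where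
  "lists_set A xs \<longleftrightarrow> distinct xs \<and> set xs = A"

definition lists_edges :: "edge set \<Rightarrow> (nat \<times> nat) list \<Rightarrow> bool" where
  "lists_edges A xs \<longleftrightarrow> (\<exists>as. lists_set A as \<and> xs = map arc as)"

definition represents :: "ecml_instance \<Rightarrow> tree_decomp \<Rightarrow> input \<Rightarrow> bool" where
  "represents I Dc x \<longleftrightarrow> in_n x = card (verts (graph_of I)) \<and> lists_edges (edges (graph_of I)) (in_es x) \<and>
     list_all2 lists_set (fixed_X I) (in_fx x) \<and> list_all2 lists_edges (fixed_Y I) (in_fy x) \<and>
     in_ks x = map sign_abs (params I) \<and>
     fst (fst (snd x)) = card (verts (tree Dc)) \<and> lists_edges (edges (tree Dc)) (in_te x) \<and>
     list_all2 lists_set (map (bag Dc) [0..<card (verts (tree Dc))]) (in_bags x)"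

lemma enc_edge_arc: "enc_edge e = enc (arc e)"
  by (cases e) (simp_all add: enc_nat')

lemma encodes_set_nat: "encodes_set enc_nat A x \<Longrightarrow> \<exists>l. lists_set A l \<and> x = enc l"
  by (auto simp: encodes_set_def lists_set_def enc_list' enc_nat')

lemma encodes_set_edge: "encodes_set enc_edge A x \<Longrightarrow> \<exists>l. lists_edges A l \<and> x = enc l"
proof -
  assume "encodes_set enc_edge A x"
  then obtain as where "distinct as" "set as = A" "x = enc_list (map enc_edge as)"
    by (auto simp: encodes_set_def)
  then have "lists_edges A (map arc as) \<and> x = enc (map arc as)"
    by (auto simp: lists_edges_def lists_set_def enc_list' enc_edge_arc[abs_def] comp_def)
  then show ?thesis by blast
qed

lemma list_all2_enc:
  "(\<And>A x. R A x \<Longrightarrow> \<exists>l. R' A l \<and> x = enc l) \<Longrightarrow> list_all2 R As xs \<Longrightarrow> \<exists>ls. list_all2 R' As ls \<and> enc_list xs = enc ls"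
proof -
  assume R: "\<And>A x. R A x \<Longrightarrow> \<exists>l. R' A l \<and> x = enc l"
  assume "list_all2 R As xs"
  then show ?thesis
  proof (induction rule: list_all2_induct)
    case Nil
    show ?case by (intro exI[of _ "[]"]) simp
  next
    case (Cons A As x xs)
    then obtain ls where "list_all2 R' As ls" "enc_list xs = enc ls" by blast
    moreover obtain l where "R' A l" "x = enc l" using R[OF Cons.hyps(1)] by blast
    ultimately show ?case by (intro exI[of _ "l # ls"]) simp
  qed
qed

lemma enc_list_int: "enc_list (map enc_int ks) = enc (map sign_abs ks)"
  by (induction ks) (simp_all add: enc_int_def sign_abs_def enc_bool' enc_nat')

lemma decode_input:
  assumes x: "encodes_instance I x" and y: "encodes_tree_decomp Dc y"
  shows "\<exists>inp. Cell x y = enc inp \<and> represents I Dc inp"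
proof -
  from x obtain g xs ys where g: "encodes_graph (graph_of I) g"
    and xs: "list_all2 (encodes_set enc_nat) (fixed_X I) xs" and ys: "list_all2 (encodes_set enc_edge) (fixed_Y I) ys"
    and x: "x = enc_list [g, enc_list xs, enc_list ys, enc_list (map enc_int (params I))]"
    unfolding encodes_instance_def by blast
  from y obtain t bs where t: "encodes_graph (tree Dc) t"
    and bs: "list_all2 (encodes_set enc_nat) (map (bag Dc) [0..<card (verts (tree Dc))]) bs"
    and y: "y = Cell t (enc_list bs)" unfolding encodes_tree_decomp_def by blast
  obtain es where es: "lists_edges (edges (graph_of I)) es" "g = Cell (enc_nat (card (verts (graph_of I)))) (enc es)"
    using g encodes_set_edge unfolding encodes_graph_def by blast
  obtain te where te: "lists_edges (edges (tree Dc)) te" "t = Cell (enc_nat (card (verts (tree Dc)))) (enc te)"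
    using t encodes_set_edge unfolding encodes_graph_def by blast
  obtain fx where fx: "list_all2 lists_set (fixed_X I) fx" "enc_list xs = enc fx"
    using list_all2_enc[where R' = lists_set, OF encodes_set_nat xs] by blast
  obtain fy where fy: "list_all2 lists_edges (fixed_Y I) fy" "enc_list ys = enc fy"
    using list_all2_enc[where R' = lists_edges, OF encodes_set_edge ys] by blast
  obtain bags where bags: "list_all2 lists_set (map (bag Dc) [0..<card (verts (tree Dc))]) bags" "enc_list bs = enc bags"
    using list_all2_enc[where R' = lists_set, OF encodes_set_nat bs] by blast
  let ?inp = "(((card (verts (graph_of I)), es), fx, fy, map sign_abs (params I), ()), ((card (verts (tree Dc)), te), bags))"
  have "Cell x y = enc (?inp :: input)"
    by (simp add: x y es te fx fy bags enc_list_int enc_nat')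
  moreover have "represents I Dc ?inp" unfolding represents_def using es te fx fy bags by simp
  ultimately show ?thesis by blast
qed

lemma undirected_ends:
  assumes "undirected_graph G" "e \<in> edges G"
  shows "ends e = {u, v} \<longleftrightarrow> arc e = (u, v) \<or> arc e = (v, u)"
proof -
  obtain s where s: "e = Undirected s" "card s = 2" using assms by (auto simp: undirected_graph_def)
  then obtain a b where ab: "s = {a, b}" "a \<noteq> b" by (meson card_2_iff)
  show ?thesis
  proof (cases "a < b")
    case True
    then have "arc e = (a, b)" using s ab by simp
    then show ?thesis using s ab by (auto simp: doubleton_eq_iff)
  next
    case False
    then have "arc e = (b, a)" using s ab by (simp add: min_def max_def)
    then show ?thesis using s ab by (auto simp: doubleton_eq_iff)
  qed
qed

lemma set_pairs_of:
  assumes "\<And>u. (u, u) \<notin> set es"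
  shows "set (pairs_of es) = {pr. fst pr < snd pr \<and> (pr \<in> set es \<or> (snd pr, fst pr) \<in> set es)}"
proof (rule Set.set_eqI)
  fix pr :: "nat \<times> nat"
  obtain u w where pr: "pr = (u, w)" by fastforce
  show "pr \<in> set (pairs_of es) \<longleftrightarrow> pr \<in> {pr. fst pr < snd pr \<and> (pr \<in> set es \<or> (snd pr, fst pr) \<in> set es)}"
  proof
    assume "pr \<in> set (pairs_of es)"
    then obtain a where a: "a \<in> set es" "pr = orient a" unfolding pairs_of_def by auto
    moreover have "fst a \<noteq> snd a" using assms[of "fst a"] a(1) by (cases a) auto
    ultimately show "pr \<in> {pr. fst pr < snd pr \<and> (pr \<in> set es \<or> (snd pr, fst pr) \<in> set es)}"
      unfolding orient_def by (cases a) (auto split: if_splits)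
  next
    assume "pr \<in> {pr. fst pr < snd pr \<and> (pr \<in> set es \<or> (snd pr, fst pr) \<in> set es)}"
    then have "u < w" "(u, w) \<in> set es \<or> (w, u) \<in> set es" by (auto simp: pr)
    moreover have "pr = orient (u, w)" "pr = orient (w, u)" using \<open>u < w\<close> by (simp_all add: orient_def pr)
    ultimately show "pr \<in> set (pairs_of es)" unfolding pairs_of_def set_dedup set_map by blast
  qed
qed

definition valid_input :: "signature \<Rightarrow> ecml_instance \<Rightarrow> tree_decomp \<Rightarrow> input \<Rightarrow> bool" where
  "valid_input \<Sigma> I Dc x \<longleftrightarrow> I \<in> instances \<Sigma> \<and> numbered (graph_of I) \<and> tree_decomposition (graph_of I) Dc \<and>
     numbered (tree Dc) \<and> represents I Dc x"

lemma lists_edges_set: "lists_edges A l \<Longrightarrow> set l = arc ` A"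
  by (auto simp: lists_edges_def lists_set_def)

context
  fixes \<Sigma> I Dc x
  assumes valid: "valid_input \<Sigma> I Dc x"
begin

private abbreviation (input) "G \<equiv> graph_of I"
private abbreviation (input) "t \<equiv> tree Dc"

private lemma graph: "if is_directed \<Sigma> then directed_graph G else undirected_graph G"
  and tdec: "tree_decomposition G Dc" and rep: "represents I Dc x"
  and num: "verts t = {..<card (verts t)}" "verts G = {..<card (verts G)}"
  using valid unfolding valid_input_def instances_def numbered_def by auto

private lemma is_tree: "is_tree t"
  using tdec by (simp add: tree_decomposition_def)

private lemma len_bags: "length (in_bags x) = card (verts t)"
  using rep list_all2_lengthD unfolding represents_def by fastforce

private lemma node_less: "i \<in> verts t \<Longrightarrow> i < card (verts t)"
  using num(1) by (metis lessThan_iff)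

private lemma bag_list: "i \<in> verts t \<Longrightarrow> lists_set (bag Dc i) (in_bags x ! i)"
proof -
  assume "i \<in> verts t"
  then have i: "i < card (verts t)" by (rule node_less)
  have "list_all2 lists_set (map (bag Dc) [0..<card (verts t)]) (in_bags x)"
    using rep by (simp add: represents_def)
  from list_all2_nthD[OF this, of i] show ?thesis using i by simp
qed

lemma valid_bag_sets: "set ` set (in_bags x) = bag Dc ` verts t"
proof -
  have "set (in_bags x) = (\<lambda>i. in_bags x ! i) ` {..<card (verts t)}"
    unfolding len_bags[symmetric] set_conv_nth by blast
  then have "set ` set (in_bags x) = (\<lambda>i. set (in_bags x ! i)) ` {..<card (verts t)}"
    by (simp only: image_image)
  also have "\<dots> = bag Dc ` {..<card (verts t)}"
    using bag_list num(1) by (intro image_cong) (auto simp: lists_set_def)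
  finally show ?thesis using num(1) by simp
qed

private lemma nodes: "grown t (tree_nodes (in_te x) (in_bags x))" "set (tree_nodes (in_te x) (in_bags x)) = verts t"
proof -
  have und: "undirected_graph t" using is_tree by (simp add: is_tree_def)
  have te: "set (in_te x) = arc ` edges t" using rep lists_edges_set by (simp add: represents_def)
  have "adjacent t u v \<longleftrightarrow> (u, v) \<in> set (in_te x) \<or> (v, u) \<in> set (in_te x)" for u v
    unfolding adjacent_def te using undirected_ends[OF und, of _ u v] by (auto simp: image_iff) metis+
  note adj = this
  have V: "verts t = {..<length (in_bags x)}" unfolding len_bags by (rule num(1))
  show "grown t (tree_nodes (in_te x) (in_bags x))" "set (tree_nodes (in_te x) (in_bags x)) = verts t"
    by (rule tree_nodes[OF is_tree V adj])+
qed

private lemma lookup_bag: "i \<in> verts t \<Longrightarrow> set (lookup i (index_from 0 (in_bags x))) = bag Dc i"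
  using lookup_index_from[of i "in_bags x" 0] bag_list[of i] node_less[of i] len_bags by (simp add: lists_set_def)

lemma valid_order: "elim_order (set ` set (in_bags x)) (vertex_order (in_te x) (in_bags x))"
  unfolding valid_bag_sets vertex_order_def
proof (rule elim_order_dedup[OF is_tree nodes])
  show "v \<in> verts G \<Longrightarrow> connected_in t {x \<in> verts t. v \<in> bag Dc x}" for v
    using tdec by (simp add: tree_decomposition_def)
  show "x \<in> verts t \<Longrightarrow> bag Dc x \<subseteq> verts G" for x
    using tdec by (simp add: tree_decomposition_def)
qed (rule lookup_bag)

lemma valid_set_order: "set (vertex_order (in_te x) (in_bags x)) = verts G"
proof -
  have "set (vertex_order (in_te x) (in_bags x)) = (\<Union>i\<in>verts t. bag Dc i)"
    unfolding vertex_order_def using nodes(2) lookup_bag by simp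
  also have "\<dots> = verts G" using tdec unfolding tree_decomposition_def by blast
  finally show ?thesis .
qed

lemma valid_edge_bag: "e \<in> edges G \<Longrightarrow> \<exists>B\<in>set ` set (in_bags x). ends e \<subseteq> B"
  unfolding valid_bag_sets using tdec unfolding tree_decomposition_def by blast

end


subsection \<open>The size of the input\<close>

lemma sz_lists_set:
  assumes "lists_set A l" "A \<subseteq> {..<n}" "n \<le> J" shows "sz l \<le> J * (2 * J + 1)"
proof -
  have "length l = card A" using assms(1) distinct_card[of l] by (auto simp: lists_set_def)
  also have "\<dots> \<le> card {..<n}" using assms(2) by (intro card_mono) auto
  finally have len: "length l \<le> J" using assms(3) by simp
  have "sz v \<le> 2 * J" if "v \<in> set l" for v
  proof -
    have "v < n" using that assms(1,2) by (auto simp: lists_set_def)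
    then show ?thesis using sz_nat_le_self[of v] assms(3) by linarith
  qed
  then have "sz l \<le> length l * Suc (2 * J)" by (rule sz_list_le)
  also have "\<dots> \<le> J * (2 * J + 1)" using len by (intro mult_le_mono) auto
  finally show ?thesis .
qed

lemma arc_less:
  assumes "directed_graph G \<or> undirected_graph G" "e \<in> edges G" "verts G \<subseteq> {..<n}"
  shows "fst (arc e) < n \<and> snd (arc e) < n"
proof (cases e)
  case (Undirected s)
  then have "s \<subseteq> verts G" "card s = 2" using assms(1,2) by (auto simp: directed_graph_def undirected_graph_def)
  moreover from this have "finite s" "s \<noteq> {}" using card_ge_0_finite[of s] by auto
  then have "Min s \<in> s" "Max s \<in> s" by (auto intro!: Min_in Max_in)
  ultimately show ?thesis using assms(3) Undirected by auto
next
  case (Directed u v)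
  then have "u \<in> verts G" "v \<in> verts G" using assms(1,2) by (auto simp: directed_graph_def undirected_graph_def)
  then show ?thesis using assms(3) Directed by auto
qed

lemma sz_lists_edges:
  assumes "lists_edges A l" "A \<subseteq> edges G" "directed_graph G \<or> undirected_graph G" "verts G \<subseteq> {..<n}"
    "n \<le> J" "length l \<le> K"
  shows "sz l \<le> K * (4 * J + 2)"
proof -
  have "sz a \<le> 4 * J + 1" if a: "a \<in> set l" for a
  proof -
    from assms(1) a obtain e where e: "e \<in> A" "a = arc e" by (auto simp: lists_edges_def lists_set_def)
    then have "fst a < n" "snd a < n" using arc_less[of G e n] assms(2-4) by auto
    then show ?thesis
      using sz_nat_le_self[of "fst a"] sz_nat_le_self[of "snd a"] assms(5) unfolding sz_pair by linarith
  qed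
  then have "sz l \<le> length l * Suc (4 * J + 1)" by (rule sz_list_le)
  also have "\<dots> \<le> K * (4 * J + 2)" using assms(6) by (intro mult_le_mono) auto
  finally show ?thesis .
qed

lemma length_lists_edges: "lists_edges A l \<Longrightarrow> length l = card A"
  using distinct_card by (fastforce simp: lists_edges_def lists_set_def)

lemma card_tree_edges:
  assumes "undirected_graph G" "verts G \<subseteq> {..<n}" shows "card (edges G) \<le> n * n"
proof -
  have "inj_on arc (edges G)"
  proof (rule inj_onI)
    fix e e' assume e: "e \<in> edges G" "e' \<in> edges G" "arc e = arc e'"
    obtain s where "e = Undirected s" using assms(1) e(1) by (auto simp: undirected_graph_def)
    moreover obtain s' where "e' = Undirected s'" using assms(1) e(2) by (auto simp: undirected_graph_def)
    ultimately have s: "e = Undirected s" "e' = Undirected s'" by blast+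
    have "ends e = {fst (arc e), snd (arc e)}" using undirected_ends[OF assms(1) e(1)] by simp
    also have "\<dots> = ends e'" using undirected_ends[OF assms(1) e(2), of "fst (arc e)" "snd (arc e)"] e(3) by simp
    finally show "e = e'" using s by simp
  qed
  moreover have "arc ` edges G \<subseteq> {..<n} \<times> {..<n}"
  proof
    fix a assume "a \<in> arc ` edges G"
    then obtain e where "e \<in> edges G" "a = arc e" by blast
    then show "a \<in> {..<n} \<times> {..<n}" using arc_less[of G e n] assms by (simp add: mem_Times_iff)
  qed
  ultimately have "card (edges G) \<le> card ({..<n} \<times> {..<n})" by (intro card_inj_on_le) auto
  then show ?thesis by (simp add: card_cartesian_product)
qed

lemma sz_list_le2: "length xs = n \<Longrightarrow> (\<And>x. x \<in> set xs \<Longrightarrow> sz x \<le> B) \<Longrightarrow> sz xs \<le> n * Suc B"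
  using sz_list_le[of xs B] by simp

lemma input_sz:
  assumes valid: "valid_input \<Sigma> I Dc x"
  shows "sz x \<le> (50 + 4 * num_FX \<Sigma> + 7 * num_FY \<Sigma> + 5 * num_params \<Sigma>) * input_size I Dc ^ 3"
proof -
  let ?G = "graph_of I" and ?t = "tree Dc" and ?J = "input_size I Dc"
  let ?n = "card (verts ?G)" and ?N = "card (verts ?t)"
  have rep: "represents I Dc x" and I: "I \<in> instances \<Sigma>" and tdec: "tree_decomposition ?G Dc"
    and num: "verts ?G = {..<?n}" "verts ?t = {..<?N}"
    using valid by (auto simp: valid_input_def numbered_def)
  have gr: "directed_graph ?G \<or> undirected_graph ?G"
    using I by (auto simp: instances_def split: if_splits)
  have und: "undirected_graph ?t" and ne: "verts ?t \<noteq> {}" using tdec by (auto simp: tree_decomposition_def is_tree_def)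
  have J: "?n \<le> ?J" "card (edges ?G) \<le> ?J" "?N \<le> ?J" by (simp_all add: input_size_def graph_size_def)
  have "?N > 0" using ne und by (simp add: undirected_graph_def card_gt_0_iff)
  then have J1: "1 \<le> ?J" using J(3) by linarith
  have J2: "?J \<le> ?J ^ 3" "?J ^ 2 \<le> ?J ^ 3" "1 \<le> ?J ^ 3"
    using J1 power_increasing[of 1 3 ?J] power_increasing[of 2 3 ?J] by simp_all
  note r = rep[unfolded represents_def]
  have "lists_edges (edges ?G) (in_es x)" using r by blast
  then obtain as where as: "set as = edges ?G" unfolding lists_edges_def lists_set_def by blast
  have fE: "finite (edges ?G)" unfolding as[symmetric] by simp
  have n: "sz (in_n x) \<le> 2 * ?J" using r sz_nat_le_self[of "in_n x"] J(1) by linarith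
  have es: "sz (in_es x) \<le> ?J * (4 * ?J + 2)"
    by (rule sz_lists_edges[of "edges ?G" _ ?G ?n]) (use r gr num J length_lists_edges in auto)
  have fx: "sz (in_fx x) \<le> num_FX \<Sigma> * Suc (?J * (2 * ?J + 1))"
  proof (rule sz_list_le2)
    have l: "list_all2 lists_set (fixed_X I) (in_fx x)" using r by blast
    then show "length (in_fx x) = num_FX \<Sigma>" using I list_all2_lengthD by (fastforce simp: instances_def)
    fix l assume "l \<in> set (in_fx x)"
    then obtain A where "A \<in> set (fixed_X I)" "lists_set A l"
      using list_all2_nthD2[OF l] list_all2_lengthD[OF l] by (metis in_set_conv_nth)
    moreover have "A \<subseteq> {..<?n}" using I calculation(1) num(1) by (auto simp: instances_def)
    ultimately show "sz l \<le> ?J * (2 * ?J + 1)" using sz_lists_set J(1) by blast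
  qed
  have fy: "sz (in_fy x) \<le> num_FY \<Sigma> * Suc (?J * (4 * ?J + 2))"
  proof (rule sz_list_le2)
    have l: "list_all2 lists_edges (fixed_Y I) (in_fy x)" using r by blast
    then show "length (in_fy x) = num_FY \<Sigma>" using I list_all2_lengthD by (fastforce simp: instances_def)
    fix l assume "l \<in> set (in_fy x)"
    then obtain A where A: "A \<in> set (fixed_Y I)" "lists_edges A l"
      using list_all2_nthD2[OF l] list_all2_lengthD[OF l] by (metis in_set_conv_nth)
    then have AE: "A \<subseteq> edges ?G" using I by (auto simp: instances_def)
    have "length l \<le> ?J" using length_lists_edges[OF A(2)] card_mono[OF fE AE] J(2) by linarith
    then show "sz l \<le> ?J * (4 * ?J + 2)" using sz_lists_edges[OF A(2) AE gr _ J(1)] num(1) by blast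
  qed
  have ks: "sz (in_ks x) \<le> num_params \<Sigma> * Suc (2 * ?J + 2)"
  proof (rule sz_list_le2)
    have k: "in_ks x = map sign_abs (params I)" using r by blast
    then show "length (in_ks x) = num_params \<Sigma>" using I by (simp add: instances_def)
    fix a assume "a \<in> set (in_ks x)"
    then obtain z where z: "z \<in> set (params I)" "a = sign_abs z" using k by auto
    have "bit_length (nat \<bar>z\<bar>) \<le> (\<Sum>k\<leftarrow>params I. bit_length (nat \<bar>k\<bar>))"
      using z(1) by (intro member_le_sum_list) auto
    then have "bit_length (nat \<bar>z\<bar>) \<le> ?J" by (simp add: input_size_def)
    then show "sz a \<le> 2 * ?J + 2"
      using sz_nat_le[of "nat \<bar>z\<bar>"] sz_bool[of "z < 0"] unfolding z(2) sign_abs_def sz_simps by linarith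
  qed
  have N: "sz (fst (fst (snd x))) \<le> 2 * ?J" using r sz_nat_le_self[of "fst (fst (snd x))"] J(3) by linarith
  have te: "sz (in_te x) \<le> (?J * ?J) * (4 * ?J + 2)"
  proof (rule sz_lists_edges[of "edges ?t" _ ?t ?N])
    have "length (in_te x) = card (edges ?t)" using r length_lists_edges by blast
    also have "\<dots> \<le> ?N * ?N" by (rule card_tree_edges[OF und]) (use num(2) in simp)
    also have "\<dots> \<le> ?J * ?J" using J(3) by (intro mult_le_mono)
    finally show "length (in_te x) \<le> ?J * ?J" .
  qed (use r und num J in auto)
  have bags: "sz (in_bags x) \<le> ?N * Suc (?J * (2 * ?J + 1))"
  proof (rule sz_list_le2)
    have l: "list_all2 lists_set (map (bag Dc) [0..<?N]) (in_bags x)" using r by blast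
    then show "length (in_bags x) = ?N" using list_all2_lengthD by fastforce
    fix b assume "b \<in> set (in_bags x)"
    then obtain A where A: "A \<in> set (map (bag Dc) [0..<?N])" "lists_set A b"
      using list_all2_nthD2[OF l] list_all2_lengthD[OF l] by (metis in_set_conv_nth)
    then obtain i where "i < ?N" "A = bag Dc i" by auto
    then have "i \<in> verts ?t" "A = bag Dc i" using num(2) by auto
    then have "A \<subseteq> {..<?n}" using tdec num(1) by (auto simp: tree_decomposition_def)
    then show "sz b \<le> ?J * (2 * ?J + 1)" using sz_lists_set A(2) J(1) by blast
  qed
  have bags': "?N * Suc (?J * (2 * ?J + 1)) \<le> ?J * Suc (?J * (2 * ?J + 1))" using J(3) by (intro mult_right_mono) auto
  have "sz x = 8 + sz (in_n x) + sz (in_es x) + sz (in_fx x) + sz (in_fy x) + sz (in_ks x)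
     + sz (fst (fst (snd x))) + sz (in_te x) + sz (in_bags x)"
    by (cases x) (auto simp: sz_pair split: prod.split)
  also have "\<dots> \<le> 9 + 2 * ?J + ?J * (4 * ?J + 2) + num_FX \<Sigma> * Suc (?J * (2 * ?J + 1)) +
      num_FY \<Sigma> * Suc (?J * (4 * ?J + 2)) + num_params \<Sigma> * Suc (2 * ?J + 2) + 2 * ?J + (?J * ?J) * (4 * ?J + 2) +
      ?J * Suc (?J * (2 * ?J + 1))"
    using n es fx fy ks N te bags bags' by linarith
  also have "\<dots> \<le> 9 * ?J ^ 3 + 2 * ?J ^ 3 + 6 * ?J ^ 3 + num_FX \<Sigma> * (4 * ?J ^ 3) +
      num_FY \<Sigma> * (7 * ?J ^ 3) + num_params \<Sigma> * (5 * ?J ^ 3) + 2 * ?J ^ 3 + 6 * ?J ^ 3 + 4 * ?J ^ 3"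
  proof (intro add_mono mult_left_mono)
    define j2 j3 where "j2 = ?J ^ 2" and "j3 = ?J ^ 3"
    then have j: "?J \<le> j3" "j2 \<le> j3" "1 \<le> j3" using J2 by simp_all
    have "?J * (4 * ?J + 2) = 4 * j2 + 2 * ?J" "?J * (2 * ?J + 1) = 2 * j2 + ?J"
      "?J * ?J * (4 * ?J + 2) = 4 * j3 + 2 * j2" "?J * Suc (?J * (2 * ?J + 1)) = ?J + 2 * j3 + j2"
      by (simp_all add: j2_def j3_def power2_eq_square power3_eq_cube algebra_simps)
    note e = this
    show "?J * (4 * ?J + 2) \<le> 6 * ?J ^ 3" "Suc (?J * (2 * ?J + 1)) \<le> 4 * ?J ^ 3" "Suc (?J * (4 * ?J + 2)) \<le> 7 * ?J ^ 3"
      "Suc (2 * ?J + 2) \<le> 5 * ?J ^ 3" "?J * ?J * (4 * ?J + 2) \<le> 6 * ?J ^ 3"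
      unfolding e j3_def[symmetric] using j by linarith+
    show "?J * Suc (?J * (2 * ?J + 1)) \<le> 4 * ?J ^ 3"
      unfolding e(4) j3_def[symmetric] using j by linarith
  qed (use J2 in simp_all)
  also have "\<dots> = (29 + 4 * num_FX \<Sigma> + 7 * num_FY \<Sigma> + 5 * num_params \<Sigma>) * ?J ^ 3"
    by (simp add: algebra_simps)
  also have "\<dots> \<le> (50 + 4 * num_FX \<Sigma> + 7 * num_FY \<Sigma> + 5 * num_params \<Sigma>) * ?J ^ 3"
    by (intro mult_right_mono) auto
  finally show ?thesis .
qed


subsection \<open>The main theorem\<close>

lemma arc_ends:
  assumes "directed_graph G \<or> undirected_graph G" "e \<in> edges G"
  shows "ends e = {fst (arc e), snd (arc e)} \<and> fst (arc e) \<noteq> snd (arc e)"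
proof (cases e)
  case (Undirected s)
  then have u: "undirected_graph G" "card s = 2"
    using assms by (auto simp: directed_graph_def undirected_graph_def)
  have "ends e = {fst (arc e), snd (arc e)}" using undirected_ends[OF u(1) assms(2)] by simp
  moreover from this have "card {fst (arc e), snd (arc e)} = 2" using u(2) unfolding Undirected by simp
  then have "fst (arc e) \<noteq> snd (arc e)" by auto
  ultimately show ?thesis by blast
next
  case (Directed u v)
  then show ?thesis using assms by (auto simp: directed_graph_def undirected_graph_def)
qed

lemma map_member_lists_set:
  "list_all2 lists_set Xs ls \<Longrightarrow> map (\<lambda>l. v \<in> set l) ls = map (\<lambda>X. v \<in> X) Xs"
  by (induction rule: list_all2_induct) (auto simp: lists_set_def)

lemma map_member_lists_edges:
  "list_all2 lists_edges Ys es \<Longrightarrow> map (\<lambda>l. a \<in> set l) es = map (\<lambda>Y. a \<in> arc ` Y) Ys"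
  by (induction rule: list_all2_induct) (auto simp: lists_edges_set)

context machine
begin

lemma valid_machine_instance:
  assumes valid: "valid_input \<Sigma> I Dc x"
    and nX: "nX = num_FX \<Sigma>" and nY: "nY = num_FY \<Sigma>" and p: "p = num_FX \<Sigma> + num_X \<phi>" and q: "q = num_FY \<Sigma> + num_Y \<phi>"
    and wf: "wf_ecml \<Sigma> \<phi>" and \<psi>: "\<psi> = modal_part \<phi>" and ms: "set ms = set (mods \<psi>)"
    and per: "\<And>\<mu>. \<mu> \<in> set ms \<Longrightarrow> periodic T P (index_set \<mu>)"
  shows "machine_instance T P p q nX nY \<psi> ms (is_directed \<Sigma>) (graph_of I) (fixed_X I) (fixed_Y I)
     (order x) (in_es x) (pairs_of (in_es x)) (num_X \<phi>) (num_Y \<phi>)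
     (\<lambda>g. ahold p (in_n x) (length (in_es x)) (in_ks x) g (arith_part \<phi>)) (arith_part \<phi>) (params I)"
proof -
  let ?G = "graph_of I"
  have rep: "represents I Dc x" and I: "I \<in> instances \<Sigma>" using valid by (auto simp: valid_input_def)
  note r = rep[unfolded represents_def]
  have g: "if is_directed \<Sigma> then directed_graph ?G else undirected_graph ?G"
    and FX: "length (fixed_X I) = nX" "\<forall>X\<in>set (fixed_X I). X \<subseteq> verts ?G"
    and FY: "length (fixed_Y I) = nY" "\<forall>Y\<in>set (fixed_Y I). Y \<subseteq> edges ?G"
    and par: "length (params I) = num_params \<Sigma>"
    using I by (simp_all add: instances_def nX nY)
  have g': "directed_graph ?G \<or> undirected_graph ?G" using g by (auto split: if_splits)
  have es: "set (in_es x) = arc ` edges ?G" using r lists_edges_set by blast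
  have irr: "(u, u) \<notin> set (in_es x)" for u
  proof
    assume "(u, u) \<in> set (in_es x)"
    then obtain e where "e \<in> edges ?G" "arc e = (u, u)" unfolding es by (metis imageE)
    then show False using arc_ends[OF g', of e] by simp
  qed
  have wfm: "wf_cml (is_directed \<Sigma>) p q False \<psi>" and wfa: "wf_arith (num_params \<Sigma>) p q (arith_part \<phi>)"
    using wf unfolding wf_ecml_def p q \<psi> by blast+
  show ?thesis
  proof
    show "if is_directed \<Sigma> then directed_graph ?G else undirected_graph ?G" by (rule g)
    show "distinct (order x)" by (simp add: vertex_order_def)
    show "set (order x) = verts ?G" by (rule valid_set_order[OF valid])
    show "set (in_es x) = arc ` edges ?G" by (rule es)
    show "distinct (pairs_of (in_es x))" by (simp add: pairs_of_def)
    show "set (pairs_of (in_es x)) = {pr. fst pr < snd pr \<and> (pr \<in> set (in_es x) \<or> (snd pr, fst pr) \<in> set (in_es x))}"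
      by (rule set_pairs_of[OF irr])
    show "length (fixed_X I) = nX" "\<forall>X\<in>set (fixed_X I). X \<subseteq> verts ?G" by (rule FX)+
    show "length (fixed_Y I) = nY" "\<forall>Y\<in>set (fixed_Y I). Y \<subseteq> edges ?G" by (rule FY)+
    show "p = nX + num_X \<phi>" "q = nY + num_Y \<phi>" by (simp_all add: p q nX nY)
    show "wf_cml (is_directed \<Sigma>) p q False \<psi>" by (rule wfm)
    show "set ms = set (mods \<psi>)" by (rule ms)
    show "accepts \<mu> (red n) = accepts \<mu> n" if "\<mu> \<in> set ms" for \<mu> n
    proof (rule accepts_index_set)
      show "modal \<mu>" using that mods_body[OF _ wfm] unfolding ms by blast
      show "red n \<in> index_set \<mu> \<longleftrightarrow> n \<in> index_set \<mu>" by (rule red_periodic[OF per[OF that]])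
    qed
    show "ahold p (in_n x) (length (in_es x)) (in_ks x) g (arith_part \<phi>) = aholds ?G (params I) Xs Ys (arith_part \<phi>)"
      if "\<And>i. i < p \<Longrightarrow> g i = card (Xs ! i)" "\<And>j. j < q \<Longrightarrow> g (p + j) = card (Ys ! j)" for Xs Ys g
    proof -
      have k: "in_ks x = map sign_abs (params I)" using r by blast
      have l: "length (in_es x) = card (edges ?G)" using r length_lists_edges by blast
      have n: "in_n x = card (verts ?G)" using r by blast
      show ?thesis unfolding k by (rule ahold_aholds[OF wfa par n l that])
    qed
  qed
qed

lemma main_correct:
  assumes valid: "valid_input \<Sigma> I Dc x"
    and nX: "nX = num_FX \<Sigma>" and nY: "nY = num_FY \<Sigma>" and p: "p = num_FX \<Sigma> + num_X \<phi>" and q: "q = num_FY \<Sigma> + num_Y \<phi>"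
    and wf: "wf_ecml \<Sigma> \<phi>" and \<psi>: "\<psi> = modal_part \<phi>" and ms: "set ms = set (mods \<psi>)"
    and per: "\<And>\<mu>. \<mu> \<in> set ms \<Longrightarrow> periodic T P (index_set \<mu>)"
  shows "main (arith_part \<phi>) x = (satisfies I \<phi>, card (solutions \<phi> I))"
proof -
  interpret machine_instance T P p q nX nY \<psi> ms "is_directed \<Sigma>" "graph_of I" "fixed_X I" "fixed_Y I"
     "order x" "in_es x" "pairs_of (in_es x)" "num_X \<phi>" "num_Y \<phi>"
     "\<lambda>g. ahold p (in_n x) (length (in_es x)) (in_ks x) g (arith_part \<phi>)" "arith_part \<phi>" "params I"
    by (rule valid_machine_instance[OF assms])
  have r: "list_all2 lists_set (fixed_X I) (in_fx x)" "list_all2 lists_edges (fixed_Y I) (in_fy x)"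
    using valid unfolding valid_input_def represents_def by blast+
  have s: "sols = solutions \<phi> I" unfolding sols_def solutions_def \<psi>[symmetric] ..
  have "solve (arith_part \<phi>) x = card (solutions \<phi> I)"
    unfolding solve_def s[symmetric]
    by (rule solve_correct) (simp_all add: map_member_lists_set[OF r(1)] map_member_lists_edges[OF r(2)] vertex_info_def pair_info_def)
  moreover have "card (solutions \<phi> I) \<noteq> 0 \<longleftrightarrow> satisfies I \<phi>"
    using finite_sols unfolding s by (auto simp: satisfies_def card_eq_0_iff)
  ultimately show ?thesis by (simp add: main_def)
qed

lemma pt_main_valid:
  assumes nX: "nX = num_FX \<Sigma>" and nY: "nY = num_FY \<Sigma>"
  shows "pt {x. \<exists>I Dc. valid_input \<Sigma> I Dc x} measure_of (main \<phi>)"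
proof (rule pt_main)
  fix x assume "x \<in> {x. \<exists>I Dc. valid_input \<Sigma> I Dc x}"
  then obtain I Dc where valid: "valid_input \<Sigma> I Dc x" by blast
  let ?G = "graph_of I"
  have r: "list_all2 lists_set (fixed_X I) (in_fx x)" "list_all2 lists_edges (fixed_Y I) (in_fy x)"
    "lists_edges (edges ?G) (in_es x)"
    and I: "I \<in> instances \<Sigma>" and td: "tree_decomposition ?G Dc"
    using valid unfolding valid_input_def represents_def by blast+
  show "length (in_fx x) = nX" "length (in_fy x) = nY"
    using I list_all2_lengthD[OF r(1)] list_all2_lengthD[OF r(2)] by (simp_all add: instances_def nX nY)
  show "elim_order (bag_sets x) (order x)" unfolding bag_sets_def by (rule valid_order[OF valid])
  show "\<exists>B\<in>bag_sets x. v \<in> B" if "v \<in> set (order x)" for v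
    using that td unfolding bag_sets_def valid_bag_sets[OF valid] valid_set_order[OF valid] tree_decomposition_def by blast
  show "\<exists>B\<in>bag_sets x. fst pr \<in> B \<and> snd pr \<in> B" if pr: "pr \<in> set (pairs_of (in_es x))" for pr
  proof -
    from pr obtain a where a: "a \<in> set (in_es x)" "pr = orient a" unfolding pairs_of_def by auto
    then obtain e where e: "e \<in> edges ?G" "a = arc e" unfolding lists_edges_set[OF r(3)] by blast
    have g: "directed_graph ?G \<or> undirected_graph ?G" using I by (auto simp: instances_def split: if_splits)
    obtain B where "B \<in> bag_sets x" "ends e \<subseteq> B"
      using valid_edge_bag[OF valid e(1)] unfolding bag_sets_def by blast
    then show ?thesis using arc_ends[OF g e(1)] a(2) e(2) by (auto simp: orient_def)
  qed
qed

lemma measure_of_le: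
  assumes valid: "valid_input \<Sigma> I Dc x" shows "measure_of x \<le> card states ^ (width Dc + 1)"
proof -
  let ?bs = "map (bag Dc) [0..<card (verts (tree Dc))]"
  have bs: "list_all2 lists_set ?bs (in_bags x)"
    using valid unfolding valid_input_def represents_def by blast
  have "distinct l" if l: "l \<in> set (in_bags x)" for l
  proof -
    obtain i where i: "i < length (in_bags x)" "in_bags x ! i = l"
      using l unfolding in_set_conv_nth by blast
    have "lists_set (?bs ! i) (in_bags x ! i)" by (rule list_all2_nthD2[OF bs i(1)])
    then show ?thesis unfolding i(2) lists_set_def by blast
  qed
  then have "length ` set (in_bags x) = card ` (set ` set (in_bags x))"
    unfolding image_image by (intro image_cong refl) (rule distinct_card[symmetric])
  also have "\<dots> = (\<lambda>i. card (bag Dc i)) ` verts (tree Dc)"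
    unfolding valid_bag_sets[OF valid] image_image ..
  finally have "max_bag x = Max ((\<lambda>i. card (bag Dc i)) ` verts (tree Dc))" by (simp only: max_bag_def)
  then have "max_bag x \<le> width Dc + 1" unfolding width_def by linarith
  then show ?thesis unfolding measure_of_def using card_Q_pos by (intro power_increasing) simp_all
qed

end

theorem theorem1:
  fixes \<Sigma> :: signature and \<phi> :: ecml and \<K> :: "ecml_instance set"
  assumes "defines_class \<Sigma> \<phi> \<K>"
  shows "\<exists>(c::nat) (P::program) (a::nat) (b::nat).
    \<forall>I D x y. I \<in> instances \<Sigma> \<and> numbered (graph_of I) \<and>
      tree_decomposition (graph_of I) D \<and> numbered (tree D) \<and>
      encodes_instance I x \<and> encodes_tree_decomp D y \<longrightarrow>
      (\<exists>n. computes_in P (Cell x y)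
             (Cell (enc_bool (I \<in> \<K>)) (enc_nat (card (solutions \<phi> I)))) n \<and>
           n \<le> a * c ^ width D * input_size I D ^ b)"
proof -
  let ?\<psi> = "modal_part \<phi>" and ?p = "num_FX \<Sigma> + num_X \<phi>" and ?q = "num_FY \<Sigma> + num_Y \<phi>"
  let ?ms = "remdups (mods ?\<psi>)"
  have wf: "wf_ecml \<Sigma> \<phi>" and K: "\<And>I. I \<in> instances \<Sigma> \<Longrightarrow> I \<in> \<K> \<longleftrightarrow> satisfies I \<phi>"
    using assms by (auto simp: defines_class_def)
  have wfm: "wf_cml (is_directed \<Sigma>) ?p ?q False ?\<psi>" using wf unfolding wf_ecml_def by blast
  have "finite (index_set ` set (mods ?\<psi>))" by simp
  moreover have "finitely_recognizable S" if "S \<in> index_set ` set (mods ?\<psi>)" for S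
    using that mods_recognizable[OF _ wfm] by blast
  ultimately have "\<exists>t k. t > 0 \<and> k > 0 \<and> (\<forall>S\<in>index_set ` set (mods ?\<psi>). periodic t k S)"
    by (rule common_period)
  then obtain T P where TP: "T > 0" "P > 0" and per: "\<forall>S\<in>index_set ` set (mods ?\<psi>). periodic T P S"
    by (elim exE conjE)
  interpret machine T P ?p ?q "num_FX \<Sigma>" "num_FY \<Sigma>" ?\<psi> ?ms
    by (rule machine.intro[OF TP distinct_remdups])
  have correct: "main (arith_part \<phi>) inp = (satisfies I \<phi>, card (solutions \<phi> I))"
    if "valid_input \<Sigma> I Dc inp" for I Dc inp
  proof (rule main_correct[OF that refl refl refl refl wf refl set_remdups])
    fix \<mu> assume "\<mu> \<in> set ?ms"
    then have "index_set \<mu> \<in> index_set ` set (mods ?\<psi>)" by simp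
    with per show "periodic T P (index_set \<mu>)" ..
  qed
  let ?D = "{x. \<exists>I Dc. valid_input \<Sigma> I Dc x}"
  have "pt ?D measure_of (main (arith_part \<phi>))" by (rule pt_main_valid[OF refl refl])
  then obtain Pr Tm where Tm: "pb ?D measure_of Tm"
    and Pr: "\<forall>s\<in>?D. \<exists>t\<le>Tm s. computes_in Pr (enc s) (enc (main (arith_part \<phi>) s)) t"
    by (blast dest: pt_program)
  obtain k where k: "\<forall>s\<in>?D. Tm s \<le> (measure_of s + sz s + 2) ^ k"
    using Tm unfolding pb_def by (elim exE)
  let ?S = "card states" and ?C = "50 + 4 * num_FX \<Sigma> + 7 * num_FY \<Sigma> + 5 * num_params \<Sigma>"
  have time: "Tm inp \<le> (?S * (?C + 3)) ^ k * (?S ^ k) ^ width Dc * input_size I Dc ^ (3 * k)"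
    if valid: "valid_input \<Sigma> I Dc inp" for I Dc inp
  proof -
    let ?J = "input_size I Dc"
    have mem: "inp \<in> ?D" using valid by blast
    have "is_tree (tree Dc)" using valid unfolding valid_input_def tree_decomposition_def by blast
    then have "card (verts (tree Dc)) > 0"
      unfolding is_tree_def undirected_graph_def card_gt_0_iff by blast
    then have J: "1 \<le> ?J ^ 3" by (simp add: input_size_def)
    have S: "1 \<le> ?S ^ (width Dc + 1)" using card_Q_pos by simp
    have "measure_of inp + sz inp + 2 \<le> ?S ^ (width Dc + 1) + ?C * ?J ^ 3 + 2"
      using measure_of_le[OF valid] input_sz[OF valid] by linarith
    also have "\<dots> \<le> ?S ^ (width Dc + 1) * ?J ^ 3 + ?C * (?S ^ (width Dc + 1) * ?J ^ 3) + 2 * (?S ^ (width Dc + 1) * ?J ^ 3)"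
    proof (intro add_mono)
      have 1: "1 \<le> ?S ^ (width Dc + 1) * ?J ^ 3" using mult_le_mono[OF S J] by simp
      then show "2 \<le> 2 * (?S ^ (width Dc + 1) * ?J ^ 3)" by linarith
      show "?S ^ (width Dc + 1) \<le> ?S ^ (width Dc + 1) * ?J ^ 3" using J by simp
      show "?C * ?J ^ 3 \<le> ?C * (?S ^ (width Dc + 1) * ?J ^ 3)"
        using mult_le_mono1[OF S, of "?J ^ 3"] by (intro mult_le_mono2) simp
    qed
    also have "\<dots> = ?S * (?C + 3) * ?S ^ width Dc * ?J ^ 3" by (simp add: algebra_simps)
    finally have "(measure_of inp + sz inp + 2) ^ k \<le> (?S * (?C + 3) * ?S ^ width Dc * ?J ^ 3) ^ k"
      by (rule power_mono) simp
    also have "\<dots> = (?S * (?C + 3)) ^ k * (?S ^ k) ^ width Dc * ?J ^ (3 * k)"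
      by (simp add: power_mult_distrib power_mult[symmetric] mult.commute)
    finally show ?thesis using bspec[OF k mem] by (rule order_trans[rotated])
  qed
  show ?thesis
  proof (rule exI[of _ "?S ^ k"], rule exI[of _ Pr], rule exI[of _ "(?S * (?C + 3)) ^ k"], rule exI[of _ "3 * k"],
      rule allI, rule allI, rule allI, rule allI, rule impI)
    fix I D x y
    assume *: "I \<in> instances \<Sigma> \<and> numbered (graph_of I) \<and> tree_decomposition (graph_of I) D \<and> numbered (tree D) \<and>
      encodes_instance I x \<and> encodes_tree_decomp D y"
    then obtain inp where inp: "Cell x y = enc inp" "represents I D inp" using decode_input[of I x D y] by blast
    have valid: "valid_input \<Sigma> I D inp" using * inp(2) by (simp add: valid_input_def)
    then have "inp \<in> ?D" by blast
    with Pr obtain t where t: "t \<le> Tm inp" "computes_in Pr (enc inp) (enc (main (arith_part \<phi>) inp)) t"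
      by blast
    have "computes_in Pr (Cell x y) (Cell (enc_bool (I \<in> \<K>)) (enc_nat (card (solutions \<phi> I)))) t"
      using t(2) K[of I] * unfolding correct[OF valid] inp(1) by (simp add: enc_bool' enc_nat')
    moreover have "t \<le> (?S * (?C + 3)) ^ k * (?S ^ k) ^ width D * input_size I D ^ (3 * k)"
      using t(1) time[OF valid] by (rule order_trans)
    ultimately show "\<exists>n. computes_in Pr (Cell x y) (Cell (enc_bool (I \<in> \<K>)) (enc_nat (card (solutions \<phi> I)))) n \<and>
       n \<le> (?S * (?C + 3)) ^ k * (?S ^ k) ^ width D * input_size I D ^ (3 * k)" by blast
  qed
qed

end
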